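(* Let $G$ be a partial cube. The following are equivalent: (i) $G$ is mediangle and antipodal; (ii) $G$ is apiculate and antipodal; (iii) $G$ is the tope graph of a simplicial oriented matroid.
   Context: A partial cube is a graph admitting an isometric embedding into a hypercube $Q(U)$ (vertices: finite subsets of $U$, adjacent iff symmetric difference has size 1); partial cubes are bipartite. $d$ is graph distance, $[u,v]=\{x:d(u,x)+d(x,v)=d(u,v)\}$. A subgraph is convex if it contains all intervals between its vertices. $G$ is mediangle (here necessarily bipartite) if: for all $u,x,y,z$ with $d(u,x)=d(u,y)=d(u,z)-1$ and $d(x,z)=d(y,z)=1$, there is a convex cycle $C$ containing edges $zx,zy$ whose vertex opposite $z$ lies in $[u,x]\cap[u,y]$; and any two convex cycles intersect in at most one edge. $G$ is antipodal if every vertex $v$ has a vertex $\bar v$ with $V(G)=[v,\bar v]$. $G$ is apiculate if for every vertex $u$, the order $x\preceq_u y \iff x\in[u,y]$ makes $V(G)$ a meet-semilattice (equivalently, for all $x,y$ the set of $u$-apices, i.e. vertices $u'\in[u,x]\cap[u,y]$ with $[u,u']$ inclusion-maximal, is a single vertex). An oriented matroid (OM) is a simple system of sign vectors $\mathcal{L}\subseteq\{-1,0,+1\}^U$ on a finite set $U$ satisfying strong elimination (for $X,Y\in\mathcal{L}$, $e$ with $X_eY_e=-1$, there is $Z\in\mathcal{L}$, $Z_e=0$, $Z_f=(X\circ Y)_f$ for all $f$ with $X_fY_f\ne-1$), face symmetry ($X\circ(-Y)\in\mathcal{L}$), and containing the zero vector; here $(X\circ Y)_e=X_e$ if $X_e\neq0$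 and $Y_e$ otherwise, and simple means every coordinate takes all three values. Order $\le$: product order from $0\le\pm1$. Topes are the maximal covectors; the tope graph has topes as vertices, adjacent iff they differ in one coordinate. The rank of the OM is the length of a longest chain in $(\mathcal{L},\le)$. A tope is simplicial if its degree in the tope graph equals the rank (equivalently $\{X\in\mathcal{L}: X\le T\}$ is a Boolean lattice); the OM is simplicial if all its topes are simplicial. *)

theory Defs
  imports "HOL-Algebra.Lattice"
begin

section \<open>Graphs, distance, intervals\<close>

text \<open>A simple undirected graph is a nonempty vertex set \<open>V\<close> together with a symmetric
  irreflexive adjacency relation \<open>E\<close> on \<open>V\<close>. Vertex sets may be infinite.\<close>

definition graph :: "'a set \<Rightarrow> ('a \<times> 'a) set \<Rightarrow> bool" where
  "graph V E \<longleftrightarrow> V \<noteq> {} \<and> E \<subseteq> V \<times> V \<and> sym E \<and> irrefl E"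

definition connected_graph :: "'a set \<Rightarrow> ('a \<times> 'a) set \<Rightarrow> bool" where
  "connected_graph V E \<longleftrightarrow> graph V E \<and> (\<forall>u\<in>V. \<forall>v\<in>V. (u, v) \<in> E\<^sup>*)"

definition graph_isomorphic ::
  "'a set \<Rightarrow> ('a \<times> 'a) set \<Rightarrow> 'b set \<Rightarrow> ('b \<times> 'b) set \<Rightarrow> bool" where
  "graph_isomorphic V E V' E' \<longleftrightarrow>
     (\<exists>f. bij_betw f V V' \<and> (\<forall>u\<in>V. \<forall>v\<in>V. (u, v) \<in> E \<longleftrightarrow> (f u, f v) \<in> E'))"

definition degree :: "('a \<times> 'a) set \<Rightarrow> 'a \<Rightarrow> nat" where
  "degree E v = card {w. (v, w) \<in> E}"

text \<open>The length of a shortest walk; an unspecified number if \<open>u\<close> and \<open>v\<close> lie in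
  different components, so it is only used on connected graphs.\<close>

definition gdist :: "('a \<times> 'a) set \<Rightarrow> 'a \<Rightarrow> 'a \<Rightarrow> nat" where
  "gdist E u v = (LEAST n. (u, v) \<in> E ^^ n)"

definition geod_interval :: "'a set \<Rightarrow> ('a \<times> 'a) set \<Rightarrow> 'a \<Rightarrow> 'a \<Rightarrow> 'a set" where
  "geod_interval V E u v = {x \<in> V. gdist E u x + gdist E x v = gdist E u v}"


section \<open>Partial cubes\<close>

definition hypercube_edges :: "'u set \<Rightarrow> ('u set \<times> 'u set) set" where
  "hypercube_edges U = {(A, B). A \<in> Fpow U \<and> B \<in> Fpow U \<and> card (sym_diff A B) = 1}"

text \<open>The hypercube \<open>Q(U)\<close> has vertex set \<open>Fpow U\<close> and is connected, so \<open>gdist\<close> is its graph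
  distance. Being a partial cube means being one over some \<open>U\<close>; the type of \<open>U\<close> is left
  polymorphic.\<close>

definition partial_cube_over :: "'u set \<Rightarrow> 'a set \<Rightarrow> ('a \<times> 'a) set \<Rightarrow> bool" where
  "partial_cube_over U V E \<longleftrightarrow> connected_graph V E \<and>
     (\<exists>f. f ` V \<subseteq> Fpow U \<and>
        (\<forall>u\<in>V. \<forall>v\<in>V. gdist (hypercube_edges U) (f u) (f v) = gdist E u v))"


section \<open>Convex cycles and mediangle graphs\<close>

text \<open>A cycle is given by a list of its vertices in cyclic order. Several lists describe the
  same cycle; two cycles are the same subgraph iff their edge sets agree.\<close>

definition cycle_edges :: "'a list \<Rightarrow> 'a set set" where
  "cycle_edges c = {{c ! i, c ! (Suc i mod length c)} | i. i < length c}"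

definition cycle :: "'a set \<Rightarrow> ('a \<times> 'a) set \<Rightarrow> 'a list \<Rightarrow> bool" where
  "cycle V E c \<longleftrightarrow> 3 \<le> length c \<and> distinct c \<and> set c \<subseteq> V \<and>
     (\<forall>i<length c. (c ! i, c ! (Suc i mod length c)) \<in> E)"

text \<open>Intervals are regarded as induced subgraphs. Hence a convex subgraph contains every edge
  between its vertices, and a convex cycle has no chords.\<close>

definition convex_cycle :: "'a set \<Rightarrow> ('a \<times> 'a) set \<Rightarrow> 'a list \<Rightarrow> bool" where
  "convex_cycle V E c \<longleftrightarrow> cycle V E c \<and>
     (\<forall>u\<in>set c. \<forall>v\<in>set c. geod_interval V E u v \<subseteq> set c) \<and>
     (\<forall>u\<in>set c. \<forall>v\<in>set c. (u, v) \<in> E \<longrightarrow> {u, v} \<in> cycle_edges c)"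

definition opposite :: "'a list \<Rightarrow> 'a \<Rightarrow> 'a \<Rightarrow> bool" where
  "opposite c z w \<longleftrightarrow> even (length c) \<and>
     (\<exists>i<length c. c ! i = z \<and> c ! ((i + length c div 2) mod length c) = w)"

text \<open>The definition for bipartite graphs: the conditions on triangles that are imposed on general
  graphs hold vacuously there. The vertices \<open>x\<close> and \<open>y\<close> are distinct in the first condition, and the
  two cycles are distinct in the second.\<close>

definition mediangle :: "'a set \<Rightarrow> ('a \<times> 'a) set \<Rightarrow> bool" where
  "mediangle V E \<longleftrightarrow>
     (\<forall>u\<in>V. \<forall>x\<in>V. \<forall>y\<in>V. \<forall>z\<in>V.
        x \<noteq> y \<and> gdist E u x = gdist E u y \<and> gdist E u z = gdist E u x + 1 \<and>
        gdist E x z = 1 \<and> gdist E y z = 1 \<longrightarrow>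
        (\<exists>c w. convex_cycle V E c \<and> {z, x} \<in> cycle_edges c \<and> {z, y} \<in> cycle_edges c \<and>
           opposite c z w \<and> w \<in> geod_interval V E u x \<inter> geod_interval V E u y)) \<and>
     (\<forall>c c'. convex_cycle V E c \<and> convex_cycle V E c' \<and> cycle_edges c \<noteq> cycle_edges c' \<longrightarrow>
        card (cycle_edges c \<inter> cycle_edges c') \<le> 1)"


section \<open>Antipodal and apiculate graphs\<close>

definition antipodal :: "'a set \<Rightarrow> ('a \<times> 'a) set \<Rightarrow> bool" where
  "antipodal V E \<longleftrightarrow> (\<forall>v\<in>V. \<exists>v'\<in>V. V = geod_interval V E v v')"

definition base_point_order :: "'a set \<Rightarrow> ('a \<times> 'a) set \<Rightarrow> 'a \<Rightarrow> 'a gorder" where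
  "base_point_order V E u = \<lparr>carrier = V, eq = (=), le = (\<lambda>x y. x \<in> geod_interval V E u y)\<rparr>"

definition apiculate :: "'a set \<Rightarrow> ('a \<times> 'a) set \<Rightarrow> bool" where
  "apiculate V E \<longleftrightarrow> (\<forall>u\<in>V. lower_semilattice (base_point_order V E u))"


section \<open>Oriented matroids\<close>

text \<open>A sign vector on \<open>U\<close> is an integer-valued function with values in \<open>{-1, 0, 1}\<close> that vanishes
  outside \<open>U\<close>. This makes equality of functions agree with equality of sign vectors, and it is
  preserved by composition and by pointwise negation.\<close>

definition sign_vectors :: "'e set \<Rightarrow> ('e \<Rightarrow> int) set" where
  "sign_vectors U = {X. (\<forall>e\<in>U. X e \<in> {-1, 0, 1}) \<and> (\<forall>e. e \<notin> U \<longrightarrow> X e = 0)}"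

definition sv_comp :: "('e \<Rightarrow> int) \<Rightarrow> ('e \<Rightarrow> int) \<Rightarrow> 'e \<Rightarrow> int" where
  "sv_comp X Y = (\<lambda>e. if X e \<noteq> 0 then X e else Y e)"

definition sv_le :: "('e \<Rightarrow> int) \<Rightarrow> ('e \<Rightarrow> int) \<Rightarrow> bool" where
  "sv_le X Y \<longleftrightarrow> (\<forall>e. X e = 0 \<or> X e = Y e)"

definition simple_system :: "'e set \<Rightarrow> ('e \<Rightarrow> int) set \<Rightarrow> bool" where
  "simple_system U L \<longleftrightarrow> (\<forall>e\<in>U. (\<lambda>X. X e) ` L = {-1, 0, 1})"

definition strong_elimination :: "'e set \<Rightarrow> ('e \<Rightarrow> int) set \<Rightarrow> bool" where
  "strong_elimination U L \<longleftrightarrow>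
     (\<forall>X\<in>L. \<forall>Y\<in>L. \<forall>e\<in>U. X e * Y e = -1 \<longrightarrow>
        (\<exists>Z\<in>L. Z e = 0 \<and> (\<forall>f\<in>U. X f * Y f \<noteq> -1 \<longrightarrow> Z f = sv_comp X Y f)))"

definition face_symmetry :: "('e \<Rightarrow> int) set \<Rightarrow> bool" where
  "face_symmetry L \<longleftrightarrow> (\<forall>X\<in>L. \<forall>Y\<in>L. sv_comp X (- Y) \<in> L)"

definition oriented_matroid :: "'e set \<Rightarrow> ('e \<Rightarrow> int) set \<Rightarrow> bool" where
  "oriented_matroid U L \<longleftrightarrow> finite U \<and> L \<subseteq> sign_vectors U \<and> simple_system U L \<and>
     strong_elimination U L \<and> face_symmetry L \<and> (\<lambda>_. 0) \<in> L"

definition topes :: "('e \<Rightarrow> int) set \<Rightarrow> ('e \<Rightarrow> int) set" where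
  "topes L = {T \<in> L. \<forall>X\<in>L. sv_le T X \<longrightarrow> X = T}"

definition tope_edges :: "'e set \<Rightarrow> ('e \<Rightarrow> int) set \<Rightarrow> (('e \<Rightarrow> int) \<times> ('e \<Rightarrow> int)) set" where
  "tope_edges U L = {(S, T). S \<in> topes L \<and> T \<in> topes L \<and> card {e \<in> U. S e \<noteq> T e} = 1}"

text \<open>The length of a chain is the number of its elements minus one, so that the oriented matroid
  consisting of the zero vector only has rank \<open>0\<close>.\<close>

definition om_rank :: "('e \<Rightarrow> int) set \<Rightarrow> nat" where
  "om_rank L = Max {card C - 1 | C. C \<subseteq> L \<and> Complete_Partial_Order.chain sv_le C}"

definition simplicial_tope :: "'e set \<Rightarrow> ('e \<Rightarrow> int) set \<Rightarrow> ('e \<Rightarrow> int) \<Rightarrow> bool" where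
  "simplicial_tope U L T \<longleftrightarrow> degree (tope_edges U L) T = om_rank L"

definition simplicial_oriented_matroid :: "'e set \<Rightarrow> ('e \<Rightarrow> int) set \<Rightarrow> bool" where
  "simplicial_oriented_matroid U L \<longleftrightarrow>
     oriented_matroid U L \<and> (\<forall>T\<in>topes L. simplicial_tope U L T)"

text \<open>Ground sets are finite, so up to renaming they are sets of natural numbers.\<close>

definition tope_graph_of_simplicial_om :: "'a set \<Rightarrow> ('a \<times> 'a) set \<Rightarrow> bool" where
  "tope_graph_of_simplicial_om V E \<longleftrightarrow>
     (\<exists>(F :: nat set) L. simplicial_oriented_matroid F L \<and>
        graph_isomorphic V E (topes L) (tope_edges F L))"

end

theory Submission
  imports Defs
begin

text \<open>Embed \<open>G\<close> in a cube as a family \<open>T\<close> of subsets of a finite set, so that distances become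
  cardinalities of symmetric differences and every vertex \<open>v\<close> has its antipode \<open>- v\<close> in \<open>T\<close>. By the lattice
  criterion of Bjorner, Edelman and Ziegler, all base point orders are lattices as soon as any two
  neighbours of a vertex have a join in the order based at that vertex. In a mediangle graph this join is
  the vertex opposite to \<open>v\<close> in a convex cycle, and in a simplicial oriented matroid it comes from the
  face of codimension two that contains both facets.

  Conversely, suppose that all base point orders are lattices. Changing the base point to a neighbour shows
  that atoms are join prime. Hence the join of a set \<open>A\<close> of neighbours of \<open>v\<close> spans an antipodal gated
  interval in which the neighbours of \<open>v\<close> are exactly \<open>A\<close>. These intervals are the faces of a simplicial
  oriented matroid whose covectors are the sign vectors \<open>X\<close> with \<open>X \<circ> t \<in> T\<close> for all \<open>t \<in> T\<close>, and the
  faces with two atoms are the convex cycles that the mediangle condition asks for.\<close>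

section \<open>Isometric antipodal families of sets\<close>

text \<open>The order based at \<open>v\<close> is inclusion of the sets \<open>sep v x\<close>, and
  antipodes act on these sets as complements in \<open>W\<close>; this is why meets give joins. It
  also makes the ground set finite when the cube is infinite: \<open>W\<close> collects the
  coordinates in which one vertex differs from its antipode.

  Two points shape the oriented matroid part. Simpliciality is given only as a count, degree equals
  rank, so the faces of codimension two have to be produced. A longest chain of covectors lies below
  one tope and has rank plus one members; the traces of their zero sets on the neighbours of that
  tope form a full flag of subsets. Strong elimination gives a diamond property that completes this
  flag to all subsets, and having such a chain passes from a tope to its neighbours. Secondly,
  \<open>simple_system\<close> admits parallel elements, which would disconnect the tope graph.
  Connectedness of \<open>G\<close> excludes them: it provides a tope edge in every direction, and
  from these edges follows that the tope graph is embedded isometrically.\<close>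

definition sep :: "'e set \<Rightarrow> 'e set \<Rightarrow> 'e set" where
  "sep u v = {e. (e \<in> u) \<noteq> (e \<in> v)}"

lemma mem_sep [simp]: "e \<in> sep u v \<longleftrightarrow> (e \<in> u) \<noteq> (e \<in> v)"
  by (simp add: sep_def)

lemma sym_diff_eq_sep: "sym_diff u v = sep u v"
  by (auto simp: sep_def)

lemma sep_commute: "sep u v = sep v u"
  by auto

lemma sep_assoc: "sep (sep u v) w = sep u (sep v w)"
  by auto

lemma sep_self [simp]: "sep u u = {}"
  by auto

lemma sep_empty [simp]: "sep u {} = u"
  by auto

lemma sep_eq_empty_iff [simp]: "sep u v = {} \<longleftrightarrow> u = v"
  by (auto simp: set_eq_iff)

lemma sep_sep [simp]: "sep u (sep u v) = v" "sep (sep v u) u = v"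
  by auto

lemma sep_inj [simp]: "sep u v = sep u w \<longleftrightarrow> v = w"
  by (metis sep_sep(1))

lemma sep_eq_self_iff [simp]: "sep u v = u \<longleftrightarrow> v = {}"
  by (metis sep_empty sep_inj)

lemma sep_sep_cancel: "sep (sep u w) (sep v w) = sep u v"
  by auto

lemma sep_subset_trans:
  assumes "sep u v \<subseteq> D" "sep u w \<subseteq> D"
  shows "sep v w \<subseteq> D"
proof
  fix e assume "e \<in> sep v w"
  then show "e \<in> D" using subsetD[OF assms(1), of e] subsetD[OF assms(2), of e] by auto
qed

lemma sep_image:
  assumes "inj_on g D" "A \<subseteq> D" "B \<subseteq> D"
  shows "sep (g ` A) (g ` B) = g ` sep A B"
proof -
  have "A - B \<subseteq> D" "B - A \<subseteq> D" using assms(2,3) by blast+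
  then show ?thesis
    unfolding sym_diff_eq_sep[symmetric] image_Un
    using inj_on_image_set_diff[OF assms(1) _ assms(3)] inj_on_image_set_diff[OF assms(1) _ assms(2)] by simp
qed

lemma finite_sep [simp]: "finite u \<Longrightarrow> finite v \<Longrightarrow> finite (sep u v)"
  by (rule finite_subset[of _ "u \<union> v"]) auto

section \<open>Distances in cubes and isometric families\<close>

definition cube_edges :: "'e set set \<Rightarrow> ('e set \<times> 'e set) set" where
  "cube_edges T = {(u, v). u \<in> T \<and> v \<in> T \<and> card (sep u v) = 1}"

lemma cube_edges_subset: "cube_edges T \<subseteq> T \<times> T"
  by (auto simp: cube_edges_def)

lemma cube_edges_iff: "(u, v) \<in> cube_edges T \<longleftrightarrow> u \<in> T \<and> v \<in> T \<and> (\<exists>a. v = sep u {a})"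
proof -
  have "card (sep u v) = 1 \<longleftrightarrow> (\<exists>a. v = sep u {a})"
    by (metis One_nat_def card_1_singleton_iff sep_sep(1))
  then show ?thesis
    by (simp add: cube_edges_def)
qed

lemma cube_edges_flip: "(u, sep u {a}) \<in> cube_edges T \<longleftrightarrow> u \<in> T \<and> sep u {a} \<in> T"
  by (auto simp: cube_edges_def)

lemma sym_cube_edges: "sym (cube_edges T)"
  by (auto simp: sym_def cube_edges_def sep_commute)

lemma card_sep_triangle:
  assumes "finite u" "finite v" "finite w"
  shows "card (sep u w) \<le> card (sep u v) + card (sep v w)"
proof -
  have "card (sep u w) \<le> card (sep u v \<union> sep v w)"
    using assms by (intro card_mono) auto
  then show ?thesis
    using card_Un_le le_trans by blast
qed

text \<open>The two legs together exceed \<open>card (sep u w)\<close> by twice the number of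
  coordinates flipped on both, so additivity means that no coordinate is flipped twice.\<close>

lemma card_sep_additive_iff:
  assumes "finite u" "finite v" "finite w"
  shows "card (sep u v) + card (sep v w) = card (sep u w) \<longleftrightarrow> sep u v \<subseteq> sep u w"
proof -
  let ?A = "sep u v" and ?B = "sep v w"
  have fin: "finite ?A" "finite ?B"
    using assms by auto
  have "card ?A + card ?B = card (?A \<union> ?B) + card (?A \<inter> ?B)"
    using fin by (rule card_Un_Int)
  also have "?A \<union> ?B = sep u w \<union> (?A \<inter> ?B)"
    by auto
  also have "card \<dots> = card (sep u w) + card (?A \<inter> ?B)"
    using assms by (intro card_Un_disjoint) auto
  finally have "card ?A + card ?B = card (sep u w) \<longleftrightarrow> ?A \<inter> ?B = {}"
    using fin by auto
  also have "?A \<inter> ?B = {} \<longleftrightarrow> ?A \<subseteq> sep u w"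
    by auto
  finally show ?thesis .
qed

lemma card_sep_flip:
  assumes "finite u" "finite v" "a \<in> sep u v"
  shows "card (sep u v) = Suc (card (sep (sep u {a}) v))"
proof -
  have "sep (sep u {a}) v = sep u v - {a}"
    using assms(3) by auto
  then show ?thesis
    using assms by (metis card_Suc_Diff1 finite_sep)
qed

text \<open>The condition \<open>step\<close> encodes isometry: repeated steps inside
  \<open>sep u v\<close> form a walk of length \<open>card (sep u v)\<close>, and no walk in a cube
  is shorter.\<close>

locale isometric_family =
  fixes T :: "'e set set"
  assumes finite_members: "v \<in> T \<Longrightarrow> finite v"
    and step: "u \<in> T \<Longrightarrow> v \<in> T \<Longrightarrow> u \<noteq> v \<Longrightarrow> \<exists>a\<in>sep u v. sep u {a} \<in> T"
begin

lemma walk_exists: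
  assumes "u \<in> T" "v \<in> T"
  shows "(u, v) \<in> cube_edges T ^^ card (sep u v)"
  using assms
proof (induction "card (sep u v)" arbitrary: u)
  case 0
  then show ?case using finite_members by auto
next
  case (Suc n)
  then have "u \<noteq> v" by auto
  then obtain a where a: "a \<in> sep u v" "sep u {a} \<in> T"
    using step Suc.prems by blast
  then have n: "card (sep (sep u {a}) v) = n"
    using Suc card_sep_flip finite_members by (metis Suc_inject)
  have "(u, sep u {a}) \<in> cube_edges T"
    using a Suc.prems by (auto simp: cube_edges_iff)
  moreover have "(sep u {a}, v) \<in> cube_edges T ^^ n"
    using Suc(1)[of "sep u {a}"] n a Suc.prems by auto
  ultimately show ?case
    using Suc.hyps(2) relpow_Suc_I2 by metis
qed

lemma walk_length:
  assumes "(u, v) \<in> cube_edges T ^^ n" "u \<in> T"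
  shows "v \<in> T \<and> card (sep u v) \<le> n"
  using assms(1)
proof (induction n arbitrary: v)
  case 0
  then show ?case using assms by auto
next
  case (Suc n)
  then obtain w where w: "(u, w) \<in> cube_edges T ^^ n" "(w, v) \<in> cube_edges T"
    by auto
  then have "w \<in> T" "v \<in> T" "card (sep u w) \<le> n" "card (sep w v) = 1"
    using Suc.IH[of w] by (auto simp: cube_edges_def)
  then show ?case
    using card_sep_triangle[of u w v] finite_members assms(2) by fastforce
qed

lemma gdist_eq:
  assumes "u \<in> T" "v \<in> T"
  shows "gdist (cube_edges T) u v = card (sep u v)"
  unfolding gdist_def
  using walk_exists[OF assms] walk_length assms by (intro Least_equality) auto

lemma interval_eq:
  assumes "u \<in> T" "v \<in> T"
  shows "geod_interval T (cube_edges T) u v = {x \<in> T. sep u x \<subseteq> sep u v}"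
  unfolding geod_interval_def using assms finite_members
  by (intro Collect_cong conj_cong refl) (simp add: gdist_eq card_sep_additive_iff)

end

lemma isometric_Fpow: "isometric_family (Fpow U)"
proof
  fix u v :: "'a set"
  assume uv: "u \<in> Fpow U" "v \<in> Fpow U" "u \<noteq> v"
  then obtain a where a: "a \<in> sep u v"
    by (metis ex_in_conv sep_eq_empty_iff)
  moreover have "sep u {a} \<in> Fpow U"
    using uv a by (auto simp: Fpow_def)
  ultimately show "\<exists>a\<in>sep u v. sep u {a} \<in> Fpow U" by blast
qed (auto simp: Fpow_def)

lemma gdist_hypercube:
  "A \<in> Fpow U \<Longrightarrow> B \<in> Fpow U \<Longrightarrow> gdist (hypercube_edges U) A B = card (sep A B)"
proof -
  have "hypercube_edges U = cube_edges (Fpow U)"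
    by (simp add: hypercube_edges_def cube_edges_def sym_diff_eq_sep)
  then show "A \<in> Fpow U \<Longrightarrow> B \<in> Fpow U \<Longrightarrow> gdist (hypercube_edges U) A B = card (sep A B)"
    using isometric_family.gdist_eq[OF isometric_Fpow] by metis
qed

section \<open>Antipodal families and their base point orders\<close>

locale antipodal_family = isometric_family T for T :: "'e set set" +
  fixes W :: "'e set"
  assumes finite_ground: "finite W" and members_subset: "v \<in> T \<Longrightarrow> v \<subseteq> W"
    and nonempty: "T \<noteq> {}" and antipode: "v \<in> T \<Longrightarrow> sep v W \<in> T"
begin

definition nbr :: "'e set \<Rightarrow> 'e set" where
  "nbr v = {a. sep v {a} \<in> T}"

lemma mem_nbr: "a \<in> nbr v \<longleftrightarrow> sep v {a} \<in> T"
  by (simp add: nbr_def)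

lemma sep_subset: "u \<in> T \<Longrightarrow> v \<in> T \<Longrightarrow> sep u v \<subseteq> W"
  using members_subset[of u] members_subset[of v] by auto

lemma nbr_subset: "v \<in> T \<Longrightarrow> nbr v \<subseteq> W"
  using sep_subset[of v "sep v {a}" for a] by (fastforce simp: mem_nbr)

lemma finite_nbr: "v \<in> T \<Longrightarrow> finite (nbr v)"
  using nbr_subset finite_ground finite_subset by blast

lemma nbr_back: "v \<in> T \<Longrightarrow> a \<in> nbr (sep v {a})"
  by (simp add: mem_nbr)

lemma sep_antipode: "u \<in> T \<Longrightarrow> v \<in> T \<Longrightarrow> sep u (sep v W) = W - sep u v"
  using members_subset[of u] members_subset[of v] by auto

lemma step_nbr: "u \<in> T \<Longrightarrow> v \<in> T \<Longrightarrow> u \<noteq> v \<Longrightarrow> \<exists>a\<in>sep u v. a \<in> nbr u"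
  using step by (simp add: mem_nbr)

text \<open>A geodesic from \<open>v\<close> to \<open>y\<close> flips only coordinates of
  \<open>sep v y\<close>, so it stays among the vertices that differ from \<open>v\<close> within
  \<open>F\<close>. An invariant of a face therefore has to be checked across single edges
  only.\<close>

lemma face_induct [consumes 3, case_names base step]:
  assumes "y \<in> T" "v \<in> T" "sep v y \<subseteq> F" "P v"
    and "\<And>y a. y \<in> T \<Longrightarrow> a \<in> nbr y \<Longrightarrow> a \<notin> sep v y \<Longrightarrow> a \<in> F \<Longrightarrow> sep v y \<subseteq> F \<Longrightarrow> P y \<Longrightarrow> P (sep y {a})"
  shows "P y"
  using assms(1,3)
proof (induction "card (sep v y)" arbitrary: y)
  case 0
  then show ?case using assms finite_members by auto
next
  case (Suc n)
  then have "y \<noteq> v" by auto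
  then obtain a where a: "a \<in> sep y v" "sep y {a} \<in> T"
    using step Suc.prems assms(2) by blast
  let ?y = "sep y {a}"
  have "card (sep v y) = Suc (card (sep ?y v))"
    using a card_sep_flip[of y v a] Suc.prems assms(2) finite_members by (metis sep_commute)
  then have "n = card (sep v ?y)" 
    using Suc(2) by (metis Suc_inject sep_commute)
  moreover have sub: "sep v ?y \<subseteq> F" "a \<in> F" "a \<notin> sep v ?y"
    using a Suc.prems by auto
  ultimately have "P ?y"
    using Suc(1) a(2) by blast
  then have "P (sep ?y {a})"
    using assms(5)[of ?y a] a(2) sub Suc.prems by (auto simp: mem_nbr)
  then show ?case by simp
qed

lemma antipodal_cube_edges: "antipodal T (cube_edges T)"
  unfolding antipodal_def
proof
  fix v assume v: "v \<in> T"
  have "T = geod_interval T (cube_edges T) v (sep v W)"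
    using v antipode sep_subset by (auto simp: interval_eq)
  then show "\<exists>v'\<in>T. T = geod_interval T (cube_edges T) v v'"
    using v antipode by blast
qed

definition has_meets :: bool where
  "has_meets \<longleftrightarrow> (\<forall>v\<in>T. \<forall>x\<in>T. \<forall>y\<in>T. \<exists>m\<in>T. sep v m \<subseteq> sep v x \<inter> sep v y \<and>
     (\<forall>t\<in>T. sep v t \<subseteq> sep v x \<inter> sep v y \<longrightarrow> sep v t \<subseteq> sep v m))"

definition has_local_joins :: bool where
  "has_local_joins \<longleftrightarrow> (\<forall>v\<in>T. \<forall>a\<in>nbr v. \<forall>b\<in>nbr v. a \<noteq> b \<longrightarrow> (\<exists>w\<in>T. a \<in> sep v w \<and> b \<in> sep v w \<and>
     (\<forall>t\<in>T. a \<in> sep v t \<and> b \<in> sep v t \<longrightarrow> sep v w \<subseteq> sep v t)))"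

text \<open>The lattice criterion of Bjorner, Edelman and Ziegler: by induction on a common upper bound \<open>z\<close>,
  it suffices to have meets of elements that are both covered by \<open>z\<close>.\<close>

lemma meet_below:
  assumes loc: has_local_joins and u: "u \<in> T"
  shows "z \<in> T \<Longrightarrow> x \<in> T \<Longrightarrow> y \<in> T \<Longrightarrow> sep u x \<subseteq> sep u z \<Longrightarrow> sep u y \<subseteq> sep u z \<Longrightarrow>
    \<exists>m\<in>T. sep u m \<subseteq> sep u x \<inter> sep u y \<and>
     (\<forall>t\<in>T. sep u t \<subseteq> sep u x \<inter> sep u y \<longrightarrow> sep u t \<subseteq> sep u m)"
proof (induction "card (sep u z)" arbitrary: z x y rule: less_induct)
  case less
  note z = less.prems(1) and x = less.prems(2) and y = less.prems(3)
    and xz = less.prems(4) and yz = less.prems(5)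
  show ?case
  proof (cases "x = z \<or> y = z")
    case True
    then show ?thesis
    proof
      assume "x = z" then show ?thesis using y yz by (intro bexI[of _ y]) auto
    next
      assume "y = z" then show ?thesis using x xz by (intro bexI[of _ x]) auto
    qed
  next
    case False
    obtain a where a: "a \<in> sep z x" "sep z {a} \<in> T"
      using step[OF z x] False by blast
    obtain b where b: "b \<in> sep z y" "sep z {b} \<in> T"
      using step[OF z y] False by blast
    have lower: "c \<in> sep u z" "card (sep u (sep z {c})) < card (sep u z)" "sep u (sep z {c}) = sep u z - {c}"
      "sep u t \<subseteq> sep u (sep z {c})"
      if "c \<in> sep z t" "sep u t \<subseteq> sep u z" for c t
    proof -
      show c: "c \<in> sep u z" using that by auto
      show e: "sep u (sep z {c}) = sep u z - {c}" using c by auto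
      show "card (sep u (sep z {c})) < card (sep u z)"
        unfolding e using c z u finite_members by (intro card_Diff1_less) auto
      show "sep u t \<subseteq> sep u (sep z {c})" using that by auto
    qed
    \<comment> \<open>On the interval between \<open>u\<close> and \<open>z\<close> the order based
      at \<open>z\<close> is the reverse of the one based at \<open>u\<close>, so the local join of
      \<open>a\<close> and \<open>b\<close> at \<open>z\<close> is the meet of the two lower covers
      of \<open>z\<close>.\<close>
    have "\<exists>m\<in>T. sep u m \<subseteq> sep u (sep z {a}) \<inter> sep u (sep z {b}) \<and>
       (\<forall>t\<in>T. sep u t \<subseteq> sep u (sep z {a}) \<inter> sep u (sep z {b}) \<longrightarrow> sep u t \<subseteq> sep u m)"
    proof (cases "a = b")
      case True
      then show ?thesis using a by auto
    next
      case False
      then obtain w where w: "w \<in> T" "a \<in> sep z w" "b \<in> sep z w"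
        and least: "\<And>t. t \<in> T \<Longrightarrow> a \<in> sep z t \<Longrightarrow> b \<in> sep z t \<Longrightarrow> sep z w \<subseteq> sep z t"
        using loc[unfolded has_local_joins_def, rule_format, OF z, of a b] a(2) b(2) False
        unfolding mem_nbr by blast
      have ab: "a \<in> sep u z" "b \<in> sep u z"
        using lower(1) a b xz yz by blast+
      then have "sep z w \<subseteq> sep z u" using least[OF u] by auto
      then have "sep u w \<subseteq> sep u (sep z {a}) \<inter> sep u (sep z {b})"
        using w by auto
      moreover have "sep u t \<subseteq> sep u w"
        if t: "t \<in> T" "sep u t \<subseteq> sep u (sep z {a}) \<inter> sep u (sep z {b})" for t
      proof -
        have "sep u t \<subseteq> sep u z - {a, b}" using t ab by auto
        then have "a \<in> sep z t" "b \<in> sep z t" using ab by auto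
        then have "sep z w \<subseteq> sep z t" using least t by blast
        show ?thesis
        proof
          fix e assume "e \<in> sep u t"
          then show "e \<in> sep u w"
            using \<open>sep z w \<subseteq> sep z t\<close>[THEN subsetD, of e] \<open>sep u t \<subseteq> sep u z - {a, b}\<close>[THEN subsetD, of e]
            by auto
        qed
      qed
      ultimately show ?thesis using w by blast
    qed
    then obtain m where m: "m \<in> T" "sep u m \<subseteq> sep u (sep z {a})" "sep u m \<subseteq> sep u (sep z {b})"
      and m_max: "\<And>t. t \<in> T \<Longrightarrow> sep u t \<subseteq> sep u (sep z {a}) \<Longrightarrow> sep u t \<subseteq> sep u (sep z {b}) \<Longrightarrow> sep u t \<subseteq> sep u m"
      by (metis Int_subset_iff)
    \<comment> \<open>The induction hypothesis applies twice: \<open>x\<close> and \<open>m\<close>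
      lie below \<open>sep z {a}\<close>, then \<open>p\<close> and \<open>y\<close> lie below
      \<open>sep z {b}\<close>. Passing through \<open>m\<close> loses nothing, since every common
      lower bound of \<open>x\<close> and \<open>y\<close> is below \<open>m\<close>.\<close>
    obtain p where p: "p \<in> T" "sep u p \<subseteq> sep u x" "sep u p \<subseteq> sep u m"
      and p_max: "\<And>t. t \<in> T \<Longrightarrow> sep u t \<subseteq> sep u x \<Longrightarrow> sep u t \<subseteq> sep u m \<Longrightarrow> sep u t \<subseteq> sep u p"
      using less.hyps[OF lower(2)[OF a(1) xz] a(2) x m(1) lower(4)[OF a(1) xz] m(2)] by (metis Int_subset_iff)
    have "sep u p \<subseteq> sep u (sep z {b})" using p m by blast
    then obtain q where q: "q \<in> T" "sep u q \<subseteq> sep u p" "sep u q \<subseteq> sep u y"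
      and q_max: "\<And>t. t \<in> T \<Longrightarrow> sep u t \<subseteq> sep u p \<Longrightarrow> sep u t \<subseteq> sep u y \<Longrightarrow> sep u t \<subseteq> sep u q"
      using less.hyps[OF lower(2)[OF b(1) yz] b(2) p(1) y _ lower(4)[OF b(1) yz]] by (metis Int_subset_iff)
    have "sep u t \<subseteq> sep u q" if "t \<in> T" "sep u t \<subseteq> sep u x \<inter> sep u y" for t
    proof -
      have "sep u t \<subseteq> sep u m"
        using m_max that lower(4)[OF a(1) xz] lower(4)[OF b(1) yz] by blast
      then show ?thesis using q_max p_max that by blast
    qed
    then show ?thesis using q p by (intro bexI[of _ q]) blast+
  qed
qed

lemma local_joins_imp_meets: "has_local_joins \<Longrightarrow> has_meets"
  unfolding has_meets_def
proof (intro ballI)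
  fix v x y assume "has_local_joins" "v \<in> T" "x \<in> T" "y \<in> T"
  then show "\<exists>m\<in>T. sep v m \<subseteq> sep v x \<inter> sep v y \<and>
     (\<forall>t\<in>T. sep v t \<subseteq> sep v x \<inter> sep v y \<longrightarrow> sep v t \<subseteq> sep v m)"
    using meet_below[of v "sep v W" x y] antipode sep_subset by (simp del: mem_sep)
qed

lemma apiculate_iff_has_meets: "apiculate T (cube_edges T) \<longleftrightarrow> has_meets"
proof -
  have "lower_semilattice (base_point_order T (cube_edges T) u) \<longleftrightarrow>
      (\<forall>x\<in>T. \<forall>y\<in>T. \<exists>m\<in>T. sep u m \<subseteq> sep u x \<inter> sep u y \<and>
        (\<forall>t\<in>T. sep u t \<subseteq> sep u x \<inter> sep u y \<longrightarrow> sep u t \<subseteq> sep u m))" (is "_ \<longleftrightarrow> ?R")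
    if u: "u \<in> T" for u
  proof -
    let ?B = "base_point_order T (cube_edges T) u"
    have le: "x \<sqsubseteq>\<^bsub>?B\<^esub> y \<longleftrightarrow> sep u x \<subseteq> sep u y" if "x \<in> T" "y \<in> T" for x y
      using u that by (simp add: base_point_order_def interval_eq)
    have car: "carrier ?B = T" "\<And>x y. x .=\<^bsub>?B\<^esub> y \<longleftrightarrow> x = y"
      by (simp_all add: base_point_order_def)
    have po: "partial_order ?B"
    proof unfold_locales
      show "(.=\<^bsub>?B\<^esub>) = (=)" by (simp add: base_point_order_def)
      fix x y assume "x \<sqsubseteq>\<^bsub>?B\<^esub> y" "y \<sqsubseteq>\<^bsub>?B\<^esub> x" "x \<in> carrier ?B" "y \<in> carrier ?B"
      then have "sep u x = sep u y" by (auto simp: car le simp del: mem_sep)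
      then show "x .=\<^bsub>?B\<^esub> y" by (simp add: car)
    next
      fix x y z
      assume "x \<sqsubseteq>\<^bsub>?B\<^esub> y" "y \<sqsubseteq>\<^bsub>?B\<^esub> z" "x \<in> carrier ?B" "y \<in> carrier ?B" "z \<in> carrier ?B"
      then show "x \<sqsubseteq>\<^bsub>?B\<^esub> z" by (auto simp: car le simp del: mem_sep)
    next
      fix x y z w
      assume "x .=\<^bsub>?B\<^esub> y" "z .=\<^bsub>?B\<^esub> w"
      then show "x \<sqsubseteq>\<^bsub>?B\<^esub> z \<longleftrightarrow> y \<sqsubseteq>\<^bsub>?B\<^esub> w" by (simp add: car)
    next
      fix x y z
      show "x \<in> carrier ?B \<Longrightarrow> x .=\<^bsub>?B\<^esub> x" "x \<in> carrier ?B \<Longrightarrow> x \<sqsubseteq>\<^bsub>?B\<^esub> x"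
        by (simp_all add: car le)
      show "x .=\<^bsub>?B\<^esub> y \<Longrightarrow> y .=\<^bsub>?B\<^esub> x" by (simp add: car(2))
      show "x .=\<^bsub>?B\<^esub> y \<Longrightarrow> y .=\<^bsub>?B\<^esub> z \<Longrightarrow> x .=\<^bsub>?B\<^esub> z" by (simp add: car(2))
    qed
    have gr: "greatest ?B m (Lower ?B {x, y}) \<longleftrightarrow> m \<in> T \<and> sep u m \<subseteq> sep u x \<inter> sep u y \<and>
        (\<forall>t\<in>T. sep u t \<subseteq> sep u x \<inter> sep u y \<longrightarrow> sep u t \<subseteq> sep u m)" if "x \<in> T" "y \<in> T" for m x y
    proof -
      have "Lower ?B {x, y} = {l \<in> T. sep u l \<subseteq> sep u x \<inter> sep u y}" (is "_ = ?L")
        using that le by (auto simp: Lower_def car simp del: mem_sep)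
      moreover have "greatest ?B m ?L \<longleftrightarrow> m \<in> ?L \<and> (\<forall>t\<in>?L. sep u t \<subseteq> sep u m)"
      proof -
        have "(\<forall>t\<in>?L. t \<sqsubseteq>\<^bsub>?B\<^esub> m) \<longleftrightarrow> (\<forall>t\<in>?L. sep u t \<subseteq> sep u m)" if "m \<in> ?L"
          using that le by (intro ball_cong) auto
        moreover have "?L \<subseteq> T" by blast
        ultimately show ?thesis unfolding greatest_def car by meson
      qed
      ultimately show ?thesis by (simp add: Ball_def conj_assoc imp_conjL del: mem_sep)
    qed
    show ?thesis
    proof
      assume "lower_semilattice ?B"
      then interpret lower_semilattice ?B .
      show ?R using inf_of_two_exists gr unfolding car by metis
    next
      assume R: ?R
      interpret partial_order ?B by (rule po)
      show "lower_semilattice ?B"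
        using R gr by unfold_locales (metis car(1))
    qed
  qed
  then show ?thesis
    by (simp add: apiculate_def has_meets_def)
qed

end

section \<open>Faces when all base point orders are lattices\<close>

locale simplicial_family = antipodal_family +
  assumes meets: has_meets
begin

lemma meet_exists:
  assumes "v \<in> T" "x \<in> T" "y \<in> T"
  obtains m where "m \<in> T" "sep v m \<subseteq> sep v x" "sep v m \<subseteq> sep v y"
    "\<And>t. t \<in> T \<Longrightarrow> sep v t \<subseteq> sep v x \<Longrightarrow> sep v t \<subseteq> sep v y \<Longrightarrow> sep v t \<subseteq> sep v m"
  using meets assms unfolding has_meets_def by (metis le_inf_iff)

text \<open>Taking antipodes reverses the order based at \<open>v\<close>, so joins exist as well.\<close>

lemma join_exists:
  assumes v: "v \<in> T" and X: "finite X" "X \<subseteq> T"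
  shows "\<exists>j\<in>T. (\<forall>x\<in>X. sep v x \<subseteq> sep v j) \<and> (\<forall>t\<in>T. (\<forall>x\<in>X. sep v x \<subseteq> sep v t) \<longrightarrow> sep v j \<subseteq> sep v t)"
  using X
proof (induction X rule: finite_induct)
  case empty
  then show ?case using v by (intro bexI[of _ v]) auto
next
  case (insert x X)
  then obtain j where j: "j \<in> T" "\<And>y. y \<in> X \<Longrightarrow> sep v y \<subseteq> sep v j"
    and j_least: "\<And>t. t \<in> T \<Longrightarrow> (\<And>y. y \<in> X \<Longrightarrow> sep v y \<subseteq> sep v t) \<Longrightarrow> sep v j \<subseteq> sep v t"
    by (metis insert_subset)
  have x: "x \<in> T" using insert by auto
  have anti: "sep v (sep t W) = W - sep v t" "sep v t \<subseteq> W" if "t \<in> T" for t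
    using that v sep_antipode sep_subset by blast+
  obtain m where m: "m \<in> T" "sep v m \<subseteq> sep v (sep j W)" "sep v m \<subseteq> sep v (sep x W)"
    and m_max: "\<And>t. t \<in> T \<Longrightarrow> sep v t \<subseteq> sep v (sep j W) \<Longrightarrow> sep v t \<subseteq> sep v (sep x W) \<Longrightarrow> sep v t \<subseteq> sep v m"
    using meet_exists[OF v, of "sep j W" "sep x W"] antipode j x by metis
  let ?k = "sep m W"
  have k: "?k \<in> T" "sep v ?k = W - sep v m" using m antipode anti by auto
  have upper: "sep v j \<subseteq> sep v ?k" "sep v x \<subseteq> sep v ?k"
    using m anti[OF j(1)] anti[OF x] unfolding k(2) by blast+
  have "sep v ?k \<subseteq> sep v t" if t: "t \<in> T" "sep v j \<subseteq> sep v t" "sep v x \<subseteq> sep v t" for t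
  proof -
    have "sep v (sep t W) \<subseteq> sep v m"
      using m_max[OF antipode[OF t(1)]] t anti[OF t(1)] anti[OF j(1)] anti[OF x] by blast
    then show ?thesis using anti[OF t(1)] unfolding k(2) by blast
  qed
  then show ?case
    using k(1) upper j(2) j_least by (intro bexI[of _ ?k]) (simp_all del: mem_sep, blast)
qed

text \<open>The zero set of the face of \<open>v\<close> spanned by the neighbours in the directions \<open>A\<close>.\<close>

definition span :: "'a set \<Rightarrow> 'a set \<Rightarrow> 'a set" where
  "span v A = W \<inter> \<Inter> (sep v ` {t \<in> T. A \<subseteq> sep v t})"

lemma span_subset_ground: "span v A \<subseteq> W"
  by (auto simp: span_def)

lemma subset_span: "A \<subseteq> nbr v \<Longrightarrow> v \<in> T \<Longrightarrow> A \<subseteq> span v A"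
  using nbr_subset[of v] unfolding span_def by blast

lemma span_least: "t \<in> T \<Longrightarrow> A \<subseteq> sep v t \<Longrightarrow> span v A \<subseteq> sep v t"
  unfolding span_def by blast

lemma span_mono: "A \<subseteq> B \<Longrightarrow> span v A \<subseteq> span v B"
  unfolding span_def by blast

text \<open>The intersection defining \<open>span\<close> is attained: it equals
  \<open>sep v j\<close> for the join \<open>j\<close> of the vertices \<open>sep v {a}\<close> with
  \<open>a\<close> in \<open>A\<close>.\<close>

lemma span_in:
  assumes v: "v \<in> T" and A: "A \<subseteq> nbr v"
  shows "sep v (span v A) \<in> T"
proof -
  have "finite ((\<lambda>a. sep v {a}) ` A)" "(\<lambda>a. sep v {a}) ` A \<subseteq> T"
    using finite_subset[OF A finite_nbr[OF v]] A by (auto simp: mem_nbr)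
  from join_exists[OF v this] obtain j where j: "j \<in> T"
    "\<forall>x\<in>(\<lambda>a. sep v {a}) ` A. sep v x \<subseteq> sep v j"
    "\<forall>t\<in>T. (\<forall>x\<in>(\<lambda>a. sep v {a}) ` A. sep v x \<subseteq> sep v t) \<longrightarrow> sep v j \<subseteq> sep v t"
    by (elim bexE conjE)
  have upper: "(\<forall>x\<in>(\<lambda>a. sep v {a}) ` A. sep v x \<subseteq> sep v t) \<longleftrightarrow> A \<subseteq> sep v t" for t
    by (auto simp del: mem_sep)
  have "A \<subseteq> sep v j" and least: "\<And>t. t \<in> T \<Longrightarrow> A \<subseteq> sep v t \<Longrightarrow> sep v j \<subseteq> sep v t"
    using j(2,3) unfolding upper by simp_all
  then have "span v A = sep v j"
    using j(1) least sep_subset[OF v j(1)] unfolding span_def by blast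
  then show ?thesis using j by simp
qed

text \<open>Every upper bound, in the order based at the neighbour \<open>sep v {h}\<close>, of \<open>v\<close> itself stays on
  the side of \<open>v\<close> with respect to \<open>h\<close>; hence the atoms of the order based at \<open>v\<close> are join prime.\<close>

lemma span_Int_nbr:
  assumes v: "v \<in> T" and A: "A \<subseteq> nbr v"
  shows "span v A \<inter> nbr v = A"
proof -
  have "h \<notin> span v A" if h: "h \<in> nbr v" "h \<notin> A" for h
  proof -
    \<comment> \<open>Seen from \<open>sep v {h}\<close>, the vertex \<open>v\<close> contributes
      \<open>{h}\<close> and each \<open>sep v {a}\<close> contributes
      \<open>{a, h}\<close>.\<close>
    let ?v = "sep v {h}" and ?X = "insert v ((\<lambda>a. sep v {a}) ` A)"
    have hv: "?v \<in> T" using h by (simp add: mem_nbr)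
    have "finite ?X" "?X \<subseteq> T"
      using finite_nbr[OF v] A finite_subset v by (auto simp: mem_nbr)
    from join_exists[OF hv this] obtain j where j: "j \<in> T" "\<And>x. x \<in> ?X \<Longrightarrow> sep ?v x \<subseteq> sep ?v j"
      by blast
    have "sep ?v v \<subseteq> sep ?v j" using j by blast
    then have "h \<notin> sep v j" by auto
    moreover have "A \<subseteq> sep v j"
    proof
      fix a assume a: "a \<in> A"
      then have "sep ?v (sep v {a}) \<subseteq> sep ?v j" using j by blast
      then show "a \<in> sep v j" using a h(2) by (auto dest!: subsetD[of _ _ a])
    qed
    ultimately show ?thesis using span_least[OF j(1)] by blast
  qed
  then show ?thesis using subset_span[OF A v] A by blast
qed

text \<open>The antipode of \<open>t\<close> is separated from \<open>v\<close> on all of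
  \<open>A\<close>, hence on all of \<open>span v A\<close>; take complements.\<close>

lemma sep_disjoint_span:
  assumes "v \<in> T" "t \<in> T" "A \<subseteq> nbr v" "sep v t \<inter> A = {}"
  shows "sep v t \<inter> span v A = {}"
proof -
  have "sep v (sep t W) = W - sep v t"
    using sep_antipode assms by blast
  moreover have "A \<subseteq> W" using nbr_subset assms by blast
  ultimately have "span v A \<subseteq> W - sep v t"
    using span_least[OF antipode[OF assms(2)], of A v] assms by blast
  then show ?thesis by blast
qed

text \<open>This provides the antipode of \<open>sep v {a}\<close> inside the face. A step from the
  top of the face towards the top of the smaller face on \<open>A - {a}\<close> must flip
  \<open>a\<close>: flipping another \<open>g\<close> would leave an upper bound of \<open>A\<close>
  whose set \<open>span v A - {g}\<close> is too small.\<close>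

lemma span_flip_in:
  assumes v: "v \<in> T" and A: "A \<subseteq> nbr v" and a: "a \<in> A"
  shows "sep (sep v (span v A)) {a} \<in> T"
proof -
  let ?F = "span v A" and ?G = "span v (A - {a})"
  have Aa: "A - {a} \<subseteq> nbr v" using A by blast
  have "?G \<subseteq> ?F" by (intro span_mono) blast
  moreover have "a \<notin> ?G" using span_Int_nbr[OF v Aa] A a by blast
  ultimately have G: "sep v ?G \<in> T" "?G \<subseteq> ?F" "A - {a} \<subseteq> ?G" "a \<notin> ?G"
    using span_in[OF v Aa] subset_span[OF Aa v] by simp_all
  have aF: "a \<in> ?F" using subset_span A a v by blast
  have "sep v ?F \<noteq> sep v ?G" using aF G(4) by auto
  then obtain g where g: "g \<in> sep (sep v ?F) (sep v ?G)" "sep (sep v ?F) {g} \<in> T"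
    using step[OF span_in[OF v A] G(1)] by blast
  have gF: "g \<in> ?F" "g \<notin> ?G" using g(1) G(2) by auto
  have e: "sep v (sep (sep v ?F) {g}) = ?F - {g}" using gF by auto
  have "g = a"
  proof (rule ccontr)
    assume "g \<noteq> a"
    then have "A \<subseteq> ?F - {g}" using G gF aF by blast
    then have "?F \<subseteq> ?F - {g}" using span_least[OF g(2), of A v] unfolding e by blast
    then show False using gF by blast
  qed
  then show ?thesis using g by simp
qed

text \<open>The direction \<open>g\<close> is any step from \<open>sep v {a}\<close> towards the top
  of the face. By \<open>span_flip_in\<close> the new span is contained in the old one. Conversely,
  a step from \<open>v\<close> towards the top of the new face has a direction in the old span other
  than \<open>a\<close>, and by \<open>span_Int_nbr\<close> this can only be
  \<open>b\<close>.\<close>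

lemma span_pair_flip:
  assumes v: "v \<in> T" and ab: "a \<in> nbr v" "b \<in> nbr v" "a \<noteq> b"
  shows "\<exists>g. g \<noteq> a \<and> g \<in> nbr (sep v {a}) \<and> span (sep v {a}) {a, g} = span v {a, b}"
proof -
  let ?F = "span v {a, b}" and ?v = "sep v {a}"
  have v': "?v \<in> T" using ab by (simp add: mem_nbr)
  have ab_F: "a \<in> ?F" "b \<in> ?F" and ab_N: "{a, b} \<subseteq> nbr v"
    using subset_span[of "{a, b}" v] ab v by auto
  have F: "sep v ?F \<in> T" using span_in ab_N v by blast
  have "?v \<noteq> sep v ?F" using ab_F ab(3) by auto
  then obtain g where g: "g \<in> sep ?v (sep v ?F)" "sep ?v {g} \<in> T"
    using step[OF v' F] by blast
  have gF: "g \<in> ?F" "g \<noteq> a" using g(1) ab_F by auto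
  have N': "{a, g} \<subseteq> nbr ?v" using g nbr_back[OF v] by (simp add: mem_nbr)
  let ?G = "span ?v {a, g}"
  have ag_G: "a \<in> ?G" "g \<in> ?G" using subset_span[OF N' v'] by auto
  have "sep ?v (sep (sep v ?F) {a}) = ?F" using ab_F by auto
  then have G_F: "?G \<subseteq> ?F"
    using span_least[OF span_flip_in[OF v ab_N, of a], of "{a, g}" ?v] ab_F gF by auto
  have sG: "sep v (sep ?v ?G) = ?G - {a}" using ag_G by auto
  have "sep ?v ?G \<noteq> v" using ag_G gF sG by auto
  then obtain h where h: "h \<in> sep v (sep ?v ?G)" "h \<in> nbr v"
    using step_nbr[OF v span_in[OF v' N']] by metis
  then have "h \<in> ?G" "h \<in> ?F" "h \<noteq> a" using sG G_F by blast+
  then have "b \<in> ?G" using h(2) span_Int_nbr[OF v ab_N] by blast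
  moreover have "sep (sep ?v ?G) {a} \<in> T" "sep v (sep (sep ?v ?G) {a}) = ?G"
    using span_flip_in[OF v' N', of a] by auto
  ultimately have "?F \<subseteq> ?G" using span_least[of "sep (sep ?v ?G) {a}" "{a, b}" v] ag_G by auto
  then show ?thesis using G_F gF N' by blast
qed

text \<open>Each pair \<open>{a, b}\<close> with \<open>b\<close> in \<open>A\<close> is transported
  by \<open>span_pair_flip\<close>, which puts \<open>b\<close> into the span at the new base
  vertex. The antipodes from \<open>span_flip_in\<close> then allow minimality of either span to be
  used from the other end of the edge.\<close>

lemma span_flip:
  assumes v: "v \<in> T" and A: "A \<subseteq> nbr v" and a: "a \<in> A"
  shows "span (sep v {a}) (nbr (sep v {a}) \<inter> span v A) = span v A"
proof -
  let ?F = "span v A" and ?v = "sep v {a}"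
  let ?B = "nbr ?v \<inter> ?F"
  let ?G = "span ?v ?B"
  have v': "?v \<in> T" using A a by (auto simp: mem_nbr)
  have aF: "a \<in> ?F" using subset_span A a v by blast
  have aB: "a \<in> ?B" using aF nbr_back v by blast
  have B: "?B \<subseteq> nbr ?v" "?B \<subseteq> ?G" using subset_span[of ?B ?v] v' by blast+
  have "sep ?v (sep (sep v ?F) {a}) = ?F" using aF by auto
  then have "?G \<subseteq> ?F" using span_least[OF span_flip_in[OF v A a], of ?B ?v] by auto
  moreover have "A \<subseteq> ?G"
  proof
    fix b assume b: "b \<in> A"
    show "b \<in> ?G"
    proof (cases "b = a")
      case True
      then show ?thesis using aB B by blast
    next
      case False
      then obtain g where g: "g \<in> nbr ?v" "span ?v {a, g} = span v {a, b}"
        using span_pair_flip[OF v, of a b] A a b by blast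
      have sub: "{a, b} \<subseteq> nbr v" "{a, g} \<subseteq> nbr ?v" using A a b g nbr_back[OF v] by auto
      have "{a, b} \<subseteq> span v {a, b}" "{a, g} \<subseteq> span v {a, b}"
        using subset_span[OF sub(1) v] subset_span[OF sub(2) v'] g by auto
      moreover have "span v {a, b} \<subseteq> ?F" using a b by (intro span_mono) auto
      ultimately have "{a, g} \<subseteq> ?B" "b \<in> span ?v {a, g}" using g sub by auto
      then show ?thesis using span_mono by blast
    qed
  qed
  moreover have "sep (sep ?v ?G) {a} \<in> T" "sep v (sep (sep ?v ?G) {a}) = ?G"
    using span_flip_in[OF v' B(1) aB] by auto
  ultimately show ?thesis using span_least[of "sep (sep ?v ?G) {a}" A v] by auto
qed

lemma span_at_face:
  assumes v: "v \<in> T" and A: "A \<subseteq> nbr v" and y: "y \<in> T" "sep v y \<subseteq> span v A"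
  shows "span y (nbr y \<inter> span v A) = span v A"
  using y(1) v y(2)
proof (induction rule: face_induct)
  case base
  then show ?case using span_Int_nbr[OF v A] by (simp add: Int_commute)
next
  case (step y a)
  then have "span (sep y {a}) (nbr (sep y {a}) \<inter> span y (nbr y \<inter> span v A)) = span y (nbr y \<inter> span v A)"
    by (intro span_flip) auto
  then show ?case using step by simp
qed

lemma face_antipode:
  assumes v: "v \<in> T" and A: "A \<subseteq> nbr v" and y: "y \<in> T" "sep v y \<subseteq> span v A"
  shows "sep y (span v A) \<in> T"
  using span_in[OF y(1), of "nbr y \<inter> span v A"] span_at_face[OF assms] by simp

text \<open>The gate of \<open>t\<close> in a face is the composition of the covector of that face with \<open>t\<close>.\<close>

lemma span_gated:
  assumes v: "v \<in> T" and A: "A \<subseteq> nbr v" and t: "t \<in> T"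
  shows "(v - span v A) \<union> (t \<inter> span v A) \<in> T"
proof -
  let ?F = "span v A"
  obtain y where y: "y \<in> T" "sep v y \<subseteq> sep v (sep v ?F)" "sep v y \<subseteq> sep v t"
    and y_max: "\<And>s. s \<in> T \<Longrightarrow> sep v s \<subseteq> sep v (sep v ?F) \<Longrightarrow> sep v s \<subseteq> sep v t \<Longrightarrow> sep v s \<subseteq> sep v y"
    using meet_exists[OF v span_in[OF v A] t] by metis
  have yF: "sep v y \<subseteq> ?F" using y(2) by simp
  \<comment> \<open>A direction of the face at \<open>y\<close> that still separates
    \<open>y\<close> from \<open>t\<close> would give a larger common lower bound than
    \<open>y\<close>.\<close>
  have "sep y t \<inter> (nbr y \<inter> ?F) = {}"
  proof -
    have False if g: "g \<in> sep y t" "g \<in> nbr y" "g \<in> ?F" for g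
    proof -
      have "g \<notin> sep v y" "g \<in> sep v t" using g(1) y(3) by auto
      then have "sep v (sep y {g}) = insert g (sep v y)" by auto
      then have "sep v (sep y {g}) \<subseteq> sep v y"
        using y_max[of "sep y {g}"] g yF y(3) \<open>g \<in> sep v t\<close> by (simp add: mem_nbr)
      then show False using \<open>g \<notin> sep v y\<close> \<open>sep v (sep y {g}) = _\<close> by auto
    qed
    then show ?thesis by blast
  qed
  then have "sep y t \<inter> ?F = {}"
    using sep_disjoint_span[OF y(1) t, of "nbr y \<inter> ?F"] span_at_face[OF v A y(1) yF] by simp
  have "(v - ?F) \<union> (t \<inter> ?F) = y"
  proof (rule Set.set_eqI)
    fix e
    have "e \<in> sep v y \<longrightarrow> e \<in> ?F" "e \<in> ?F \<longrightarrow> e \<notin> sep y t"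
      using yF \<open>sep y t \<inter> ?F = {}\<close> by blast+
    then show "e \<in> (v - ?F) \<union> (t \<inter> ?F) \<longleftrightarrow> e \<in> y" by auto
  qed
  then show ?thesis using y by simp
qed

text \<open>The converse of \<open>span_gated\<close>. Let \<open>S\<close> be the span; composing
  with the antipode of \<open>sep v S\<close> yields a vertex that differs from \<open>v\<close>
  exactly on \<open>F - S\<close>. If this set were nonempty, the first step from \<open>v\<close>
  to that vertex would use a neighbour direction in \<open>F\<close> outside
  \<open>S\<close>.\<close>

lemma gated_imp_span:
  assumes v: "v \<in> T" and F: "F \<subseteq> W" and gated: "\<And>t. t \<in> T \<Longrightarrow> (v - F) \<union> (t \<inter> F) \<in> T"
  shows "span v (nbr v \<inter> F) = F"
proof -
  let ?S = "span v (nbr v \<inter> F)"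
  have v_W: "v \<subseteq> W" using members_subset v by blast
  have "(v - F) \<union> (sep v W \<inter> F) = sep v F" using F v_W by auto
  then have "sep v F \<in> T" using gated[OF antipode[OF v]] by simp
  then have SF: "?S \<subseteq> F" using span_least[of "sep v F" "nbr v \<inter> F" v] by auto
  let ?t = "(v - F) \<union> (sep (sep v ?S) W \<inter> F)"
  have S: "sep v ?S \<in> T" by (intro span_in v) auto
  have t: "?t \<in> T" using gated[OF antipode[OF S]] .
  have st: "sep v ?t = F - ?S" using F v_W SF by auto
  have "F - ?S = {}"
  proof (rule ccontr)
    assume "F - ?S \<noteq> {}"
    then have "v \<noteq> ?t" using st by auto
    then obtain h where "h \<in> F - ?S" "h \<in> nbr v" using step_nbr[OF v t] st by blast
    then show False using subset_span[of "nbr v \<inter> F" v] v by blast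
  qed
  then show ?thesis using SF by blast
qed

text \<open>A direction \<open>b\<close> other than \<open>a\<close> is sent to the second direction
  that the rank two face on \<open>a\<close> and \<open>b\<close> has at the other end of the edge.
  The face determines \<open>b\<close>, so the map is injective.\<close>

lemma card_nbr_flip_le:
  assumes v: "v \<in> T" and a: "a \<in> nbr v"
  shows "card (nbr v) \<le> card (nbr (sep v {a}))"
proof -
  let ?v = "sep v {a}"
  have v': "?v \<in> T" using a by (simp add: mem_nbr)
  define f where "f b = (if b = a then a else SOME g. g \<noteq> a \<and> g \<in> nbr ?v \<and> span ?v {a, g} = span v {a, b})" for b
  have f: "f b \<noteq> a" "f b \<in> nbr ?v" "span ?v {a, f b} = span v {a, b}" if "b \<in> nbr v" "b \<noteq> a" for b
    using someI_ex[OF span_pair_flip[OF v a that(1) that(2)[symmetric]]] that by (auto simp: f_def)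
  have fa: "f a = a" by (simp add: f_def)
  have "inj_on f (nbr v)"
  proof (rule inj_onI)
    fix b c assume bc: "b \<in> nbr v" "c \<in> nbr v" "f b = f c"
    show "b = c"
    proof (cases "b = a \<or> c = a")
      case True
      then show ?thesis using f(1) fa bc by metis
    next
      case False
      then have "span v {a, b} = span v {a, c}" using f(3) bc by metis
      then have "{a, b} = {a, c}" using span_Int_nbr[OF v] a bc by (metis empty_subsetI insert_subset)
      then show ?thesis using False by auto
    qed
  qed
  moreover have "f ` nbr v \<subseteq> nbr ?v" using f(2) fa nbr_back[OF v, of a] by (metis image_subsetI)
  ultimately show ?thesis using card_inj_on_le finite_nbr[OF v'] by blast
qed

lemma card_nbr_eq:
  assumes "v \<in> T" "y \<in> T"
  shows "card (nbr y) = card (nbr v)"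
  using assms(2,1) subset_UNIV[of "sep v y"]
proof (induction rule: face_induct)
  case base
  then show ?case by simp
next
  case (step y a)
  then show ?case
    using card_nbr_flip_le[of y a] card_nbr_flip_le[of "sep y {a}" a] nbr_back[of y a]
    by (simp add: mem_nbr)
qed

end

section \<open>Convex cycles\<close>

lemma cycle_pred:
  assumes "i < n"
  shows "\<exists>j<n. Suc j mod n = i"
  using assms by (intro exI[of _ "if i = 0 then n - 1 else i - 1"]) auto

lemma cycle_edge_cases:
  assumes "distinct c" "i < length c" "{c ! i, p} \<in> cycle_edges c"
  shows "p = c ! (Suc i mod length c) \<or> (\<exists>j<length c. Suc j mod length c = i \<and> p = c ! j)"
proof -
  obtain j where j: "j < length c" "{c ! i, p} = {c ! j, c ! (Suc j mod length c)}"
    using assms(3) by (auto simp: cycle_edges_def)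
  have lt: "Suc j mod length c < length c" using assms(2) by (intro mod_less_divisor) linarith
  have "c ! i = c ! j \<and> p = c ! (Suc j mod length c) \<or> c ! i = c ! (Suc j mod length c) \<and> p = c ! j"
    using j(2) by (simp add: doubleton_eq_iff)
  then show ?thesis
  proof
    assume p: "c ! i = c ! j \<and> p = c ! (Suc j mod length c)"
    then have "i = j" using nth_eq_iff_index_eq[OF assms(1,2) j(1)] by simp
    then show ?thesis using p by simp
  next
    assume p: "c ! i = c ! (Suc j mod length c) \<and> p = c ! j"
    then have "i = Suc j mod length c" using nth_eq_iff_index_eq[OF assms(1,2) lt] by simp
    then show ?thesis using j(1) p by (intro disjI2 exI[of _ j]) simp
  qed
qed

lemma cycle_edge_subset: "e \<in> cycle_edges c \<Longrightarrow> e \<subseteq> set c"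
proof -
  assume "e \<in> cycle_edges c"
  then obtain i where i: "i < length c" "e = {c ! i, c ! (Suc i mod length c)}"
    by (auto simp: cycle_edges_def)
  moreover have "Suc i mod length c < length c" using i by (intro mod_less_divisor) linarith
  ultimately show ?thesis by simp
qed

lemma cycle_edge_adjacent:
  assumes "cycle V E c" "sym E" "{p, q} \<in> cycle_edges c"
  shows "(p, q) \<in> E"
proof -
  obtain i where i: "i < length c" "{p, q} = {c ! i, c ! (Suc i mod length c)}"
    using assms(3) by (auto simp: cycle_edges_def)
  then have "(c ! i, c ! (Suc i mod length c)) \<in> E" using assms(1) by (simp add: cycle_def)
  moreover have "p = c ! i \<and> q = c ! (Suc i mod length c) \<or> p = c ! (Suc i mod length c) \<and> q = c ! i"
    using i(2) by (simp add: doubleton_eq_iff)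
  ultimately show ?thesis using assms(2) by (metis symD)
qed

lemma cycle_edgesI: "i < length c \<Longrightarrow> {c ! i, c ! (Suc i mod length c)} \<in> cycle_edges c"
  by (auto simp: cycle_edges_def)

lemma Union_cycle_edges: "\<Union> (cycle_edges c) = set c"
proof
  show "\<Union> (cycle_edges c) \<subseteq> set c" using cycle_edge_subset by blast
  show "set c \<subseteq> \<Union> (cycle_edges c)"
  proof
    fix s assume "s \<in> set c"
    then obtain i where "i < length c" "s = c ! i" by (auto simp: in_set_conv_nth)
    then show "s \<in> \<Union> (cycle_edges c)" using cycle_edgesI[of i c] by blast
  qed
qed

text \<open>Hence convex cycles with the same vertex set have the same edges.\<close>

lemma convex_cycle_edges:
  assumes "convex_cycle V E c" "sym E"
  shows "cycle_edges c = {{u, v} | u v. u \<in> set c \<and> v \<in> set c \<and> (u, v) \<in> E}"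
proof (intro Set.equalityI subsetI)
  fix e assume e: "e \<in> cycle_edges c"
  then obtain p q where "e = {p, q}" by (auto simp: cycle_edges_def)
  then show "e \<in> {{u, v} | u v. u \<in> set c \<and> v \<in> set c \<and> (u, v) \<in> E}"
    using cycle_edge_adjacent[of V E c p q] cycle_edge_subset[OF e] assms e
    unfolding convex_cycle_def by blast
next
  fix e assume "e \<in> {{u, v} | u v. u \<in> set c \<and> v \<in> set c \<and> (u, v) \<in> E}"
  then show "e \<in> cycle_edges c"
    using assms(1) unfolding convex_cycle_def by blast
qed

section \<open>Convex sets of maximum degree two\<close>

context isometric_family
begin

definition convex :: "'e set set \<Rightarrow> bool" where
  "convex S \<longleftrightarrow> S \<subseteq> T \<and> (\<forall>u\<in>S. \<forall>v\<in>S. \<forall>x\<in>T. sep u x \<subseteq> sep u v \<longrightarrow> x \<in> S)"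

lemma convexD: "convex S \<Longrightarrow> u \<in> S \<Longrightarrow> v \<in> S \<Longrightarrow> x \<in> T \<Longrightarrow> sep u x \<subseteq> sep u v \<Longrightarrow> x \<in> S"
  unfolding convex_def by blast

lemma convex_Int: "convex S \<Longrightarrow> convex R \<Longrightarrow> convex (S \<inter> R)"
  unfolding convex_def by blast

lemma convex_step:
  assumes "convex S" "u \<in> S" "v \<in> S" "u \<noteq> v"
  shows "\<exists>a\<in>sep u v. sep u {a} \<in> S"
proof -
  have "u \<in> T" "v \<in> T" using assms unfolding convex_def by blast+
  then obtain a where a: "a \<in> sep u v" "sep u {a} \<in> T" using step assms by blast
  then have "sep u (sep u {a}) \<subseteq> sep u v" by auto
  then show ?thesis using convexD[OF assms(1-3) a(2)] a(1) by blast
qed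

text \<open>The steps towards \<open>r\<close> from the two ends of the edge cannot both flip
  \<open>a\<close>, because \<open>a\<close> separates \<open>r\<close> from only one of the
  ends.\<close>

lemma convex_Int_two_flips:
  assumes S: "convex S" and p: "p \<in> S" "sep p {a} \<in> S" and r: "r \<in> S" "r \<noteq> p" "r \<noteq> sep p {a}"
  shows "\<exists>z a b. a \<noteq> b \<and> z \<in> S \<and> sep z {a} \<in> S \<and> sep z {b} \<in> S"
proof -
  obtain g where g: "g \<in> sep p r" "sep p {g} \<in> S" using convex_step[OF S p(1) r(1)] r by blast
  show ?thesis
  proof (cases "g = a")
    case False
    then show ?thesis using g p by blast
  next
    case True
    obtain h where h: "h \<in> sep (sep p {a}) r" "sep (sep p {a}) {h} \<in> S"
      using convex_step[OF S p(2) r(1)] r by blast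
    have "h \<noteq> a" using h(1) g(1) True by auto
    moreover have "sep (sep p {a}) {a} \<in> S" using p by simp
    ultimately show ?thesis using h p by metis
  qed
qed

text \<open>Convex, connected and of maximum degree two. This is all that is used of a convex cycle, and it
  avoids indexing the cycle.\<close>

definition thin :: "'e set set \<Rightarrow> bool" where
  "thin S \<longleftrightarrow> convex S \<and>
     (\<forall>s\<in>S. \<forall>g h k. sep s {g} \<in> S \<and> sep s {h} \<in> S \<and> sep s {k} \<in> S \<longrightarrow> g = h \<or> g = k \<or> h = k) \<and>
     (\<forall>R\<subseteq>S. R \<noteq> {} \<and> (\<forall>s\<in>R. \<forall>g. sep s {g} \<in> S \<longrightarrow> sep s {g} \<in> R) \<longrightarrow> R = S)"

lemma thin_flips: "thin S \<Longrightarrow> s \<in> S \<Longrightarrow> sep s {g} \<in> S \<Longrightarrow> sep s {h} \<in> S \<Longrightarrow> sep s {k} \<in> S \<Longrightarrow> g = h \<or> g = k \<or> h = k"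
  unfolding thin_def by blast

lemma thin_connected:
  "thin S \<Longrightarrow> R \<subseteq> S \<Longrightarrow> z \<in> R \<Longrightarrow> (\<And>s g. s \<in> R \<Longrightarrow> sep s {g} \<in> S \<Longrightarrow> sep s {g} \<in> R) \<Longrightarrow> R = S"
  unfolding thin_def by blast

text \<open>Above \<open>z\<close> the interval is two ascending paths; if \<open>w\<close> had only one lower cover in it, then
  descending from \<open>w\<close> would be deterministic and end in only one neighbour of \<open>z\<close>.\<close>

lemma thin_interval_top:
  assumes S: "thin S" and z: "z \<in> S" "sep z {a} \<in> S" "sep z {b} \<in> S" "a \<noteq> b"
    and w: "w \<in> S" "a \<in> sep z w" "b \<in> sep z w"
  shows "\<exists>g h. g \<noteq> h \<and> g \<in> sep z w \<and> h \<in> sep z w \<and> sep w {g} \<in> S \<and> sep w {h} \<in> S"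
proof (rule ccontr)
  assume "\<not> ?thesis"
  then have top: "g = h" if "g \<in> sep z w" "h \<in> sep z w" "sep w {g} \<in> S" "sep w {h} \<in> S" for g h
    using that by blast
  have conv: "convex S" using S unfolding thin_def by blast
  have fin: "finite s" if "s \<in> S" for s
    using that conv finite_members unfolding convex_def by blast
  \<comment> \<open>Induction on the distance \<open>n\<close> to \<open>w\<close>. Two vertices of
    one level have the same upper neighbour \<open>p\<close>. If the directions down from
    \<open>p\<close> differed, then \<open>p = w\<close> would contradict \<open>top\<close>, and
    any other \<open>p\<close> would have a third direction, up towards \<open>w\<close>.\<close>
  have level: "s = s'" if "s \<in> S" "s' \<in> S" "sep z s \<subseteq> sep z w" "sep z s' \<subseteq> sep z w" "s \<noteq> z" "s' \<noteq> z"
    "card (sep s w) = n" "card (sep s' w) = n" for n s s'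
    using that
  proof (induction n arbitrary: s s')
    case 0
    then show ?case using fin w by auto
  next
    case (Suc n)
    have up: "\<exists>g. g \<in> sep s w \<and> sep s {g} \<in> S \<and> sep z (sep s {g}) \<subseteq> sep z w \<and> g \<in> sep z (sep s {g}) \<and>
        card (sep (sep s {g}) w) = n" if s: "s \<in> S" "sep z s \<subseteq> sep z w" "card (sep s w) = Suc n" for s
    proof -
      have "s \<noteq> w" using s by auto
      then obtain g where g: "g \<in> sep s w" "sep s {g} \<in> S" using convex_step[OF conv s(1) w(1)] by blast
      then have gz: "g \<notin> sep z s" "g \<in> sep z w" using s(2) by auto
      then have "sep z (sep s {g}) = insert g (sep z s)" by auto
      then have "sep z (sep s {g}) \<subseteq> sep z w" "g \<in> sep z (sep s {g})" using gz(2) s(2) by simp_all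
      moreover have "card (sep (sep s {g}) w) = n"
        using card_sep_flip[OF fin[OF s(1)] fin[OF w(1)] g(1)] s(3) by simp
      ultimately show ?thesis using g by blast
    qed
    obtain g where g: "g \<in> sep s w" "sep s {g} \<in> S" "sep z (sep s {g}) \<subseteq> sep z w" "g \<in> sep z (sep s {g})"
      "card (sep (sep s {g}) w) = n" using up[of s] Suc.prems by auto
    obtain h where h: "h \<in> sep s' w" "sep s' {h} \<in> S" "sep z (sep s' {h}) \<subseteq> sep z w" "h \<in> sep z (sep s' {h})"
      "card (sep (sep s' {h}) w) = n" using up[of s'] Suc.prems by auto
    let ?p = "sep s {g}"
    have "?p \<noteq> z" "sep s' {h} \<noteq> z" using g(4) h(4) by (metis empty_iff sep_self)+
    then have p: "?p = sep s' {h}" using Suc.IH[OF g(2) h(2) g(3) h(3) _ _ g(5) h(5)] by blast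
    then have h': "s' = sep ?p {h}" by simp
    have g': "s = sep ?p {g}" by simp
    have hz: "h \<in> sep z ?p" using h(4) p by simp
    have "g = h"
    proof (cases "?p = w")
      case True
      then show ?thesis using top[of g h] g(4) hz h'[symmetric] g'[symmetric] Suc.prems by simp
    next
      case False
      then obtain k where k: "k \<in> sep ?p w" "sep ?p {k} \<in> S" using convex_step[OF conv g(2) w(1)] by blast
      have "k \<notin> sep z ?p" using k(1) g(3) by auto
      then have "k \<noteq> g" "k \<noteq> h" using g(4) hz by blast+
      then show ?thesis
        using thin_flips[OF S g(2), of g h k] h'[symmetric] g'[symmetric] Suc.prems(1,2) k(2) by simp
    qed
    then show ?case using h' g' by metis
  qed
  have "card (sep (sep z {b}) w) = card (sep (sep z {a}) w)"
    using card_sep_flip[OF fin[OF z(1)] fin[OF w(1)] w(2)] card_sep_flip[OF fin[OF z(1)] fin[OF w(1)] w(3)]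
    by simp
  moreover have "sep z (sep z {a}) \<subseteq> sep z w" "sep z (sep z {b}) \<subseteq> sep z w"
    using w(2,3) by simp_all
  ultimately have "sep z {a} = sep z {b}"
    using level[OF z(2,3) _ _ _ _ refl] by simp
  then show False using z by simp
qed

text \<open>By connectedness it suffices that no step in \<open>S\<close> leaves the interval. At an
  inner vertex the steps towards \<open>z\<close> and towards \<open>w\<close> already use up the
  degree two; at \<open>z\<close> the directions \<open>a\<close> and \<open>b\<close> do so, and at
  \<open>w\<close> those of \<open>thin_interval_top\<close>.\<close>

lemma thin_eq_interval:
  assumes S: "thin S" and z: "z \<in> S" "sep z {a} \<in> S" "sep z {b} \<in> S" "a \<noteq> b"
    and w: "w \<in> S" "a \<in> sep z w" "b \<in> sep z w"
  shows "S = {s \<in> T. sep z s \<subseteq> sep z w}"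
proof -
  have conv: "convex S" using S unfolding thin_def by blast
  let ?I = "{s \<in> T. sep z s \<subseteq> sep z w}"
  have IS: "?I \<subseteq> S" using convexD[OF conv z(1) w(1)] by blast
  have ST: "S \<subseteq> T" using conv unfolding convex_def by blast
  have zI: "z \<in> ?I" using z ST by auto
  have closed: "sep s {g} \<in> ?I" if s: "s \<in> ?I" "sep s {g} \<in> S" for s g
  proof -
    have sS: "s \<in> S" using s IS by blast
    have "g \<in> sep z w"
    proof (cases "s = w")
      case True
      then show ?thesis using thin_interval_top[OF assms] thin_flips[OF S sS, of g] s(2) by metis
    next
      case sw: False
      show ?thesis
      proof (cases "s = z")
        case True
        then show ?thesis using thin_flips[OF S z(1), of a b g] z w s by blast
      next
        case False
        obtain h where h: "h \<in> sep s z" "sep s {h} \<in> S" using convex_step[OF conv sS z(1)] False by blast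
        obtain k where k: "k \<in> sep s w" "sep s {k} \<in> S" using convex_step[OF conv sS w(1)] sw by blast
        have "h \<in> sep z s" "k \<notin> sep z s" "k \<in> sep z w" "h \<in> sep z w" using h k s by auto
        then show ?thesis using thin_flips[OF S sS, of g h k] h k s by blast
      qed
    qed
    then show ?thesis using s ST by (auto dest: subsetD)
  qed
  show ?thesis using thin_connected[OF S IS zI closed] by simp
qed

lemma convex_cycle_convex:
  assumes "convex_cycle T (cube_edges T) c"
  shows "convex (set c)"
proof -
  have c: "set c \<subseteq> T" "\<forall>u\<in>set c. \<forall>v\<in>set c. geod_interval T (cube_edges T) u v \<subseteq> set c"
    using assms by (simp_all add: convex_cycle_def cycle_def)
  have "x \<in> set c" if "u \<in> set c" "v \<in> set c" "x \<in> T" "sep u x \<subseteq> sep u v" for u v x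
    using c(2)[rule_format, OF that(1,2)] interval_eq[of u v] c(1) that by blast
  then show ?thesis unfolding convex_def using c(1) by blast
qed

lemma convex_cycle_thin:
  assumes c: "convex_cycle T (cube_edges T) c"
  shows "thin (set c)"
proof -
  let ?n = "length c"
  have cyc: "cycle T (cube_edges T) c" using c by (simp add: convex_cycle_def)
  then have dist: "distinct c" and n: "?n \<ge> 3" and cT: "set c \<subseteq> T" by (simp_all add: cycle_def)
  have chord: "{s, sep s {g}} \<in> cycle_edges c" if "s \<in> set c" "sep s {g} \<in> set c" for s g
  proof -
    have "(s, sep s {g}) \<in> cube_edges T" using that subsetD[OF cT] by (simp add: cube_edges_flip)
    then show ?thesis using c that unfolding convex_cycle_def by blast
  qed
  have flips: "g = h \<or> g = k \<or> h = k"
    if s: "s \<in> set c" "sep s {g} \<in> set c" "sep s {h} \<in> set c" "sep s {k} \<in> set c" for s g h k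
  proof -
    obtain i where i: "i < ?n" "s = c ! i" using s by (auto simp: in_set_conv_nth)
    obtain j where j: "j < ?n" "Suc j mod ?n = i" using cycle_pred[OF i(1)] by blast
    have "sep s {x} = c ! (Suc i mod ?n) \<or> sep s {x} = c ! j" if x: "sep s {x} \<in> set c" for x
    proof -
      have "{c ! i, sep s {x}} \<in> cycle_edges c" using chord s(1) x i by simp
      moreover have "j' = j" if "j' < ?n" "Suc j' mod ?n = i" for j'
        using that j i(1) by (auto simp: mod_Suc split: if_splits)
      ultimately show ?thesis using cycle_edge_cases[OF dist i(1)] by blast
    qed
    then have "sep s {g} = sep s {h} \<or> sep s {g} = sep s {k} \<or> sep s {h} = sep s {k}"
      using s by metis
    then show ?thesis by simp
  qed
  have conn: "R = set c" if R: "R \<subseteq> set c" "R \<noteq> {}" "\<forall>s\<in>R. \<forall>g. sep s {g} \<in> set c \<longrightarrow> sep s {g} \<in> R" for R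
  proof -
    obtain i where i: "i < ?n" "c ! i \<in> R" using R(1,2) by (metis ex_in_conv in_set_conv_nth subsetD)
    have "c ! ((i + m) mod ?n) \<in> R" for m
    proof (induction m)
      case 0
      then show ?case using i by simp
    next
      case (Suc m)
      let ?k = "(i + m) mod ?n"
      have k: "?k < ?n" "Suc ?k mod ?n < ?n" using n by (auto intro: mod_less_divisor)
      then have "(c ! ?k, c ! (Suc ?k mod ?n)) \<in> cube_edges T" using cyc unfolding cycle_def by blast
      then obtain g where "c ! (Suc ?k mod ?n) = sep (c ! ?k) {g}" by (auto simp: cube_edges_iff)
      then have "c ! (Suc ?k mod ?n) \<in> R" using R(3) Suc k(2) nth_mem by metis
      moreover have "Suc ?k mod ?n = (i + Suc m) mod ?n" by (simp add: mod_Suc_eq)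
      ultimately show ?case by simp
    qed
    moreover have "\<exists>m. j = (i + m) mod ?n" if "j < ?n" for j
      using that i by (intro exI[of _ "?n - i + j"]) simp
    ultimately have "set c \<subseteq> R" by (metis in_set_conv_nth subsetI)
    then show ?thesis using R(1) by blast
  qed
  show ?thesis
    unfolding thin_def
  proof (intro conjI ballI allI impI)
    show "convex (set c)" by (rule convex_cycle_convex[OF c])
  next
    fix s g h k assume "s \<in> set c" "sep s {g} \<in> set c \<and> sep s {h} \<in> set c \<and> sep s {k} \<in> set c"
    then show "g = h \<or> g = k \<or> h = k" using flips[of s g h k] by simp
  next
    fix R assume "R \<subseteq> set c" "R \<noteq> {} \<and> (\<forall>s\<in>R. \<forall>g. sep s {g} \<in> set c \<longrightarrow> sep s {g} \<in> R)"
    then show "R = set c" using conn[of R] by simp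
  qed
qed

lemma cycle_two_flips:
  assumes c: "cycle T (cube_edges T) c" and i: "i < length c"
  shows "\<exists>g h. g \<noteq> h \<and> sep (c ! i) {g} \<in> set c \<and> sep (c ! i) {h} \<in> set c \<and>
    {c ! i, sep (c ! i) {g}} \<in> cycle_edges c \<and> {c ! i, sep (c ! i) {h}} \<in> cycle_edges c"
proof -
  let ?n = "length c"
  have n: "?n \<ge> 3" and dist: "distinct c" using c by (simp_all add: cycle_def)
  obtain j where j: "j < ?n" "Suc j mod ?n = i" using cycle_pred[OF i] by blast
  have k: "Suc i mod ?n < ?n" using n by (intro mod_less_divisor) linarith
  have "Suc i mod ?n \<noteq> j" using j i n by (auto simp: mod_Suc split: if_splits)
  then have ne: "c ! (Suc i mod ?n) \<noteq> c ! j" using dist k j by (simp add: nth_eq_iff_index_eq)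
  have e: "{c ! i, c ! (Suc i mod ?n)} \<in> cycle_edges c" "{c ! i, c ! j} \<in> cycle_edges c"
    using cycle_edgesI[OF i] cycle_edgesI[OF j(1)] j(2) by (simp_all add: insert_commute)
  then have "(c ! i, c ! (Suc i mod ?n)) \<in> cube_edges T" "(c ! i, c ! j) \<in> cube_edges T"
    using cycle_edge_adjacent[OF c sym_cube_edges] by blast+
  then obtain g h where "c ! (Suc i mod ?n) = sep (c ! i) {g}" "c ! j = sep (c ! i) {h}"
    by (auto simp: cube_edges_iff)
  moreover have "c ! (Suc i mod ?n) \<in> set c" "c ! j \<in> set c" using k j by simp_all
  ultimately show ?thesis using e ne by metis
qed

text \<open>A second common edge has an end off the first one, and the intersection is convex, so
  \<open>convex_Int_two_flips\<close> yields two common edges at a single vertex.\<close>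

lemma two_edges_flips:
  assumes c: "cycle T (cube_edges T) c" "cycle T (cube_edges T) c'" and conv: "convex (set c)" "convex (set c')"
    and card: "\<not> card (cycle_edges c \<inter> cycle_edges c') \<le> 1"
  shows "\<exists>z a b. a \<noteq> b \<and> z \<in> set c \<inter> set c' \<and> sep z {a} \<in> set c \<inter> set c' \<and> sep z {b} \<in> set c \<inter> set c'"
proof -
  let ?I = "cycle_edges c \<inter> cycle_edges c'"
  have "card ?I \<noteq> 0" "card ?I \<noteq> 1" using card by linarith+
  then obtain e where e: "e \<in> ?I" by (metis card.empty ex_in_conv)
  obtain e' where e': "e' \<in> ?I" "e' \<noteq> e" using \<open>card ?I \<noteq> 1\<close> e
    by (metis One_nat_def card.empty card.insert ex_in_conv finite.emptyI insert_absorb is_singletonI' is_singleton_altdef)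
  have edge: "\<exists>p a. f = {p, sep p {a}} \<and> f \<subseteq> set c \<inter> set c'" if "f \<in> ?I" for f
  proof -
    have "f \<in> cycle_edges c" using that by blast
    then obtain p q where "f = {p, q}" by (auto simp: cycle_edges_def)
    moreover have "(p, q) \<in> cube_edges T"
      using cycle_edge_adjacent[OF c(1) sym_cube_edges] that \<open>f = {p, q}\<close> by blast
    ultimately show ?thesis using cycle_edge_subset[of f] that by (auto simp: cube_edges_iff)
  qed
  obtain p a where p: "e = {p, sep p {a}}" "e \<subseteq> set c \<inter> set c'" using edge[OF e] by blast
  obtain q b where q: "e' = {q, sep q {b}}" "e' \<subseteq> set c \<inter> set c'" using edge[OF e'(1)] by blast
  have "\<not> e' \<subseteq> e"
  proof
    assume "e' \<subseteq> e"
    moreover have "q \<noteq> sep q {b}" by auto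
    ultimately have "e' = e" using p(1) q(1) by auto
    then show False using e' by blast
  qed
  then obtain r where "r \<in> set c \<inter> set c'" "r \<noteq> p" "r \<noteq> sep p {a}" using p q by blast
  then show ?thesis
    using convex_Int_two_flips[OF convex_Int[OF conv], of p a r] p by blast
qed

end

section \<open>Local joins in mediangle families\<close>

context antipodal_family
begin

text \<open>For each upper bound \<open>t\<close> of the two atoms, the first mediangle condition
  with base vertex \<open>t\<close> gives a convex cycle whose vertex opposite to \<open>z\<close>
  is an upper bound below \<open>t\<close>. All these cycles share two edges at \<open>z\<close>, so
  the second condition makes them equal. Since the cycle is the interval from \<open>z\<close> to
  each of these opposite vertices, one of them is below every \<open>t\<close>.\<close>

lemma mediangle_imp_local_joins:
  assumes med: "mediangle T (cube_edges T)"
  shows has_local_joins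
  unfolding has_local_joins_def
proof (intro ballI impI)
  fix z a b assume z: "z \<in> T" and ab: "a \<in> nbr z" "b \<in> nbr z" "a \<noteq> b"
  let ?x = "sep z {a}" and ?y = "sep z {b}"
  have xy: "?x \<in> T" "?y \<in> T" using ab by (simp_all add: mem_nbr)
  have ex: "\<exists>c w. convex_cycle T (cube_edges T) c \<and> {z, ?x} \<in> cycle_edges c \<and> {z, ?y} \<in> cycle_edges c \<and>
      w \<in> set c \<and> a \<in> sep z w \<and> b \<in> sep z w \<and> sep z w \<subseteq> sep z t"
    if t: "t \<in> T" "a \<in> sep z t" "b \<in> sep z t" for t
  proof -
    have "sep t z = insert a (sep t ?x)" "sep t z = insert b (sep t ?y)" "a \<notin> sep t ?x" "b \<notin> sep t ?y"
      using t by auto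
    then have "card (sep t z) = Suc (card (sep t ?x))" "card (sep t z) = Suc (card (sep t ?y))"
      using finite_members t xy by (metis card_insert_disjoint finite_sep)+
    then have "gdist (cube_edges T) t ?x = gdist (cube_edges T) t ?y"
      "gdist (cube_edges T) t z = gdist (cube_edges T) t ?x + 1"
      "gdist (cube_edges T) ?x z = 1" "gdist (cube_edges T) ?y z = 1"
      using t z xy by (simp_all add: gdist_eq sep_commute[of _ z])
    moreover have "?x \<noteq> ?y" using ab by simp
    ultimately obtain c w where c: "convex_cycle T (cube_edges T) c" "{z, ?x} \<in> cycle_edges c" "{z, ?y} \<in> cycle_edges c"
      "opposite c z w" "w \<in> geod_interval T (cube_edges T) t ?x \<inter> geod_interval T (cube_edges T) t ?y"
      using med[unfolded mediangle_def, THEN conjunct1, rule_format, OF t(1) xy z] by blast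
    have w: "sep t w \<subseteq> sep t ?x" "sep t w \<subseteq> sep t ?y"
      using c(5) t xy by (simp_all add: interval_eq)
    have "w \<in> set c" using c(4) unfolding opposite_def by (auto intro!: nth_mem mod_less_divisor)
    moreover have "a \<in> sep z w \<and> b \<in> sep z w"
      using w t \<open>a \<notin> sep t ?x\<close> \<open>b \<notin> sep t ?y\<close> by auto
    moreover have "sep z w \<subseteq> sep z t"
      using w(1) \<open>sep t z = insert a (sep t ?x)\<close> t(2) by (auto dest: subsetD)
    ultimately show ?thesis using c by blast
  qed
  \<comment> \<open>The antipode of \<open>z\<close> is above both atoms; its cycle serves as the
    reference for all other \<open>t\<close>.\<close>
  have "a \<in> sep z (sep z W)" "b \<in> sep z (sep z W)" using nbr_subset[OF z] ab by auto
  then obtain c w where c: "convex_cycle T (cube_edges T) c" "{z, ?x} \<in> cycle_edges c" "{z, ?y} \<in> cycle_edges c"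
      "w \<in> set c" "a \<in> sep z w" "b \<in> sep z w"
    using ex[OF antipode[OF z]] by blast
  have c_xy: "z \<in> set c" "?x \<in> set c" "?y \<in> set c" using cycle_edge_subset c by blast+
  have "sep z w \<subseteq> sep z t" if t: "t \<in> T" "a \<in> sep z t" "b \<in> sep z t" for t
  proof -
    obtain c' w' where c': "convex_cycle T (cube_edges T) c'" "{z, ?x} \<in> cycle_edges c'" "{z, ?y} \<in> cycle_edges c'"
      "w' \<in> set c'" "a \<in> sep z w'" "b \<in> sep z w'" "sep z w' \<subseteq> sep z t"
      using ex[OF t] by blast
    have "finite (cycle_edges c \<inter> cycle_edges c')" by (simp add: cycle_edges_def)
    then have "card {{z, ?x}, {z, ?y}} \<le> card (cycle_edges c \<inter> cycle_edges c')"
      using c(2,3) c'(2,3) by (intro card_mono) auto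
    moreover have "{z, ?x} \<noteq> {z, ?y}" using ab(3) sep_eq_self_iff[of z "{a}"] by (auto simp: doubleton_eq_iff)
    ultimately have "\<not> card (cycle_edges c \<inter> cycle_edges c') \<le> 1" by simp
    then have "cycle_edges c = cycle_edges c'"
      using med c(1) c'(1) unfolding mediangle_def by blast
    then have "set c = set c'" using Union_cycle_edges by metis
    then have "w \<in> {s \<in> T. sep z s \<subseteq> sep z w'}"
      using thin_eq_interval[OF convex_cycle_thin[OF c'(1)], of z a b w'] c_xy ab(3) c' c(4) by blast
    then show ?thesis using c'(7) by blast
  qed
  then show "\<exists>w\<in>T. a \<in> sep z w \<and> b \<in> sep z w \<and> (\<forall>t\<in>T. a \<in> sep z t \<and> b \<in> sep z t \<longrightarrow> sep z w \<subseteq> sep z t)"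
    using c unfolding convex_cycle_def cycle_def by blast
qed

end

section \<open>Apiculate antipodal families are mediangle\<close>

context simplicial_family
begin

text \<open>A vertex \<open>m\<close> of \<open>S\<close> farthest from \<open>z\<close> has two
  lower neighbours in \<open>S\<close>. Their meet \<open>t\<close> lies in \<open>S\<close> by
  convexity and has two different upward steps there, hence no downward step, so
  \<open>t = z\<close>. Thus \<open>m\<close> is above both atoms, and \<open>S\<close> contains the
  top of the face that they span.\<close>

lemma thin_eq_face:
  assumes S: "thin S" and two: "\<And>s. s \<in> S \<Longrightarrow> \<exists>g h. g \<noteq> h \<and> sep s {g} \<in> S \<and> sep s {h} \<in> S"
    and z: "z \<in> S" "sep z {a} \<in> S" "sep z {b} \<in> S" "a \<noteq> b"
  shows "S = {s \<in> T. sep z s \<subseteq> span z {a, b}}"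
proof -
  have conv: "convex S" using S unfolding thin_def by blast
  then have ST: "S \<subseteq> T" unfolding convex_def by blast
  then have zT: "z \<in> T" using z by blast
  have finS: "finite S" using ST members_subset finite_ground
    by (intro finite_subset[of S "Pow W"]) auto
  let ?d = "\<lambda>s. card (sep z s)"
  have "Max (?d ` S) \<in> ?d ` S" using finS z(1) by (intro Max_in) auto
  then obtain m where m: "Max (?d ` S) = ?d m" and "m \<in> S" by (rule imageE)
  have m_max: "card (sep z s) \<le> card (sep z m)" if "s \<in> S" for s
    unfolding m[symmetric] using finS that by (intro Max_ge) auto
  have mT: "m \<in> T" using \<open>m \<in> S\<close> ST by blast
  have down: "g \<in> sep z m" if g: "sep m {g} \<in> S" for g
  proof (rule ccontr)
    assume gz: "g \<notin> sep z m"
    then have "sep z (sep m {g}) = insert g (sep z m)" by auto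
    then have "card (sep z (sep m {g})) = Suc (card (sep z m))"
      using gz mT zT finite_members by simp
    then show False using m_max[OF g] by simp
  qed
  obtain g h where gh: "g \<noteq> h" "sep m {g} \<in> S" "sep m {h} \<in> S" using two[OF \<open>m \<in> S\<close>] by blast
  let ?p = "sep m {g}" and ?q = "sep m {h}"
  have gz: "g \<in> sep z m" "h \<in> sep z m" using down gh by blast+
  have pq: "sep z ?p = sep z m - {g}" "sep z ?q = sep z m - {h}" using gz by auto
  have pqT: "?p \<in> T" "?q \<in> T" using gh ST by blast+
  obtain t where t: "t \<in> T" "sep z t \<subseteq> sep z ?p" "sep z t \<subseteq> sep z ?q"
    and t_max: "\<And>s. s \<in> T \<Longrightarrow> sep z s \<subseteq> sep z ?p \<Longrightarrow> sep z s \<subseteq> sep z ?q \<Longrightarrow> sep z s \<subseteq> sep z t"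
    by (rule meet_exists[OF zT pqT]) blast
  have "sep z t \<subseteq> sep z m" using t(2) unfolding pq(1) by blast
  then have tS: "t \<in> S" using convexD[OF conv z(1) \<open>m \<in> S\<close> t(1)] by simp
  have "h \<in> sep z ?p" "g \<in> sep z ?q" unfolding pq using gz gh(1) by blast+
  moreover have "h \<notin> sep z t" "g \<notin> sep z t" using t(2,3) unfolding pq by blast+
  ultimately have "t \<noteq> ?p" "t \<noteq> ?q" by metis+
  obtain k where k: "k \<in> sep t ?p" "sep t {k} \<in> S"
    using convex_step[OF conv tS gh(2) \<open>t \<noteq> ?p\<close>] by blast
  obtain l where l: "l \<in> sep t ?q" "sep t {l} \<in> S"
    using convex_step[OF conv tS gh(3) \<open>t \<noteq> ?q\<close>] by blast
  have kz: "k \<notin> sep z t" "k \<in> sep z ?p" using k(1) t(2) by auto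
  have lz: "l \<notin> sep z t" "l \<in> sep z ?q" using l(1) t(3) by auto
  have "k \<noteq> l"
  proof
    assume "k = l"
    have "sep z (sep t {k}) = insert k (sep z t)" using kz by auto
    then have "sep z (sep t {k}) \<subseteq> sep z t"
      using t_max[of "sep t {k}"] k(2) ST t(2,3) kz lz \<open>k = l\<close> by (simp add: subsetD del: mem_sep)
    then show False using kz \<open>sep z (sep t {k}) = _\<close> by blast
  qed
  have "t = z"
  proof (rule ccontr)
    assume "t \<noteq> z"
    then obtain i where "i \<in> sep t z" "sep t {i} \<in> S" using convex_step[OF conv tS z(1)] by blast
    moreover have "i \<noteq> k" "i \<noteq> l" using kz lz \<open>i \<in> sep t z\<close> by auto
    ultimately show False using thin_flips[OF S tS k(2) l(2), of i] \<open>k \<noteq> l\<close> by blast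
  qed
  then have kl: "k \<in> sep z m" "l \<in> sep z m" "sep z {k} \<in> S" "sep z {l} \<in> S"
    using kz lz pq k l by blast+
  have "a = k \<or> a = l" "b = k \<or> b = l"
    using thin_flips[OF S z(1) z(2) kl(3,4)] thin_flips[OF S z(1) z(3) kl(3,4)] \<open>k \<noteq> l\<close> by blast+
  then have ab: "{a, b} \<subseteq> sep z m" using kl by blast
  have N: "{a, b} \<subseteq> nbr z" using z ST by (auto simp: mem_nbr)
  let ?F = "span z {a, b}"
  have "sep z (sep z ?F) \<subseteq> sep z m" using span_least[OF mT ab] by simp
  then have "sep z ?F \<in> S" using convexD[OF conv z(1) \<open>m \<in> S\<close> span_in[OF zT N]] by blast
  moreover have "a \<in> ?F" "b \<in> ?F" using subset_span[OF N zT] by blast+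
  ultimately have "S = {s \<in> T. sep z s \<subseteq> sep z (sep z ?F)}"
    using z by (intro thin_eq_interval[OF S z]) simp_all
  then show ?thesis by simp
qed

lemma convex_cycles_meet:
  assumes c: "convex_cycle T (cube_edges T) c" "convex_cycle T (cube_edges T) c'"
    and card: "\<not> card (cycle_edges c \<inter> cycle_edges c') \<le> 1"
  shows "cycle_edges c = cycle_edges c'"
proof -
  have cyc: "cycle T (cube_edges T) c" "cycle T (cube_edges T) c'"
    using c by (simp_all add: convex_cycle_def)
  obtain z a b where z: "a \<noteq> b" "z \<in> set c \<inter> set c'" "sep z {a} \<in> set c \<inter> set c'" "sep z {b} \<in> set c \<inter> set c'"
    using two_edges_flips[OF cyc convex_cycle_convex[OF c(1)] convex_cycle_convex[OF c(2)] card] by blast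
  have two: "\<exists>g h. g \<noteq> h \<and> sep s {g} \<in> set d \<and> sep s {h} \<in> set d"
    if d: "cycle T (cube_edges T) d" "s \<in> set d" for d s
    using cycle_two_flips[OF d(1)] d(2) by (metis in_set_conv_nth)
  have "set c = {s \<in> T. sep z s \<subseteq> span z {a, b}}" "set c' = {s \<in> T. sep z s \<subseteq> span z {a, b}}"
    using z by (intro thin_eq_face convex_cycle_thin c two[OF cyc(1)] two[OF cyc(2)]; blast)+
  then show ?thesis
    using convex_cycle_edges[OF c(1) sym_cube_edges]
      convex_cycle_edges[OF c(2) sym_cube_edges] by simp
qed

text \<open>Crossing an edge of direction \<open>c\<close> inside the face keeps \<open>c\<close> as
  a direction, \<open>span_pair_flip\<close> supplies a second one, and \<open>span_Int_nbr\<close>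
  excludes a third.\<close>

lemma rank_two_face_nbrs:
  assumes z: "z \<in> T" and ab: "a \<in> nbr z" "b \<in> nbr z" "a \<noteq> b"
    and y: "y \<in> T" "sep z y \<subseteq> span z {a, b}"
  shows "\<exists>g h. g \<noteq> h \<and> nbr y \<inter> span z {a, b} = {g, h}"
  using y(1) z y(2)
proof (induction rule: face_induct)
  case base
  then show ?case using span_Int_nbr[OF z, of "{a, b}"] ab by (metis Int_commute empty_subsetI insert_subset)
next
  case (step y c)
  let ?F = "span z {a, b}"
  from step.IH obtain g h where gh: "g \<noteq> h" "nbr y \<inter> ?F = {g, h}" by blast
  moreover have "c \<in> nbr y \<inter> ?F" using step by blast
  ultimately obtain d where d: "c \<noteq> d" "nbr y \<inter> ?F = {c, d}" by (metis insertE insert_commute singletonD)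
  have "span y {c, d} = ?F"
    using span_at_face[OF z _ step.hyps(1) step.hyps(5)] ab d(2) by simp
  then obtain e where e: "e \<noteq> c" "e \<in> nbr (sep y {c})" "span (sep y {c}) {c, e} = ?F"
    using span_pair_flip[OF step.hyps(1), of c d] d by blast
  have "?F \<inter> nbr (sep y {c}) = {c, e}"
    using span_Int_nbr[of "sep y {c}" "{c, e}"] e nbr_back[OF step.hyps(1)] step.hyps(2)
    by (simp add: mem_nbr)
  then show ?case using e(1) by blast
qed

lemma geodesic_exists:
  assumes "y \<in> T" "u \<in> T"
  shows "\<exists>p. p 0 = u \<and> p (card (sep u y)) = y \<and>
    (\<forall>i\<le>card (sep u y). p i \<in> T \<and> sep u (p i) \<subseteq> sep u y \<and> card (sep u (p i)) = i) \<and>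
    (\<forall>i<card (sep u y). (p i, p (Suc i)) \<in> cube_edges T)"
  using assms subset_UNIV[of "sep u y"]
proof (induction rule: face_induct)
  case base
  then show ?case using assms by (intro exI[of _ "\<lambda>_. u"]) simp
next
  case (step y a)
  let ?d = "card (sep u y)"
  obtain p where p: "p 0 = u" "p ?d = y"
    "\<forall>i\<le>?d. p i \<in> T \<and> sep u (p i) \<subseteq> sep u y \<and> card (sep u (p i)) = i"
    "\<forall>i<?d. (p i, p (Suc i)) \<in> cube_edges T"
    using step.IH by blast
  have e: "sep u (sep y {a}) = insert a (sep u y)" using step.hyps(3) by auto
  have d: "card (sep u (sep y {a})) = Suc ?d"
    unfolding e using step.hyps(1,3) assms(2) finite_members by simp
  have ya: "sep y {a} \<in> T" using step.hyps(2) by (simp add: mem_nbr)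
  have "(y, sep y {a}) \<in> cube_edges T" using ya step.hyps(1) by (simp add: cube_edges_flip)
  then show ?case
    unfolding d using p ya e d
    by (intro exI[of _ "p(Suc ?d := sep y {a})"]) (auto simp: le_Suc_eq less_Suc_eq simp del: mem_sep)
qed

text \<open>The cycle follows a geodesic from \<open>z\<close> through \<open>sep z {a}\<close> to
  the top of the face and returns along the antipodal image of this geodesic in the face. Its length
  is twice the size of the zero set.\<close>

lemma rank_two_cycle:
  assumes z: "z \<in> T" and ab: "a \<in> nbr z" "b \<in> nbr z" "a \<noteq> b"
  shows "\<exists>c. convex_cycle T (cube_edges T) c \<and> {z, sep z {a}} \<in> cycle_edges c \<and>
    {z, sep z {b}} \<in> cycle_edges c \<and> opposite c z (sep z (span z {a, b}))"
proof -
  let ?F = "span z {a, b}" and ?x = "sep z {a}"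
  define k where "k = card ?F"
  have N: "{a, b} \<subseteq> nbr z" using ab by simp
  have abF: "a \<in> ?F" "b \<in> ?F" using subset_span[OF N z] by blast+
  have xT: "?x \<in> T" using ab by (simp add: mem_nbr)
  have finF: "finite ?F" using span_subset_ground finite_ground finite_subset by blast
  have k2: "k \<ge> 2"
    unfolding k_def using card_mono[OF finF, of "{a, b}"] abF ab(3) by simp
  have xJ: "sep ?x (sep z ?F) = ?F - {a}" using abF by auto
  have ck: "card (?F - {a}) = k - 1" using abF finF by (simp add: k_def)
  obtain p where p: "p 0 = ?x" "p (k - 1) = sep z ?F"
    "\<And>i. i \<le> k - 1 \<Longrightarrow> p i \<in> T \<and> sep ?x (p i) \<subseteq> ?F - {a} \<and> card (sep ?x (p i)) = i"
    "\<And>i. i < k - 1 \<Longrightarrow> (p i, p (Suc i)) \<in> cube_edges T"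
    using geodesic_exists[OF span_in[OF z N] xT] unfolding xJ ck by metis
  define r where "r i = (case i of 0 \<Rightarrow> z | Suc j \<Rightarrow> p j)" for i
  have r0: "r 0 = z" by (simp add: r_def)
  have "r k = p (k - 1)" using k2 by (cases k) (simp_all add: r_def)
  then have rk: "r k = sep z ?F" using p(2) by simp
  have r_edge: "(r i, r (Suc i)) \<in> cube_edges T" if "i < k" for i
  proof (cases i)
    case 0
    then show ?thesis using p(1) z xT by (simp add: r_def cube_edges_flip)
  next
    case (Suc j)
    then show ?thesis using p(4)[of j] that by (simp add: r_def)
  qed
  have r: "r i \<in> T" "sep z (r i) \<subseteq> ?F" "card (sep z (r i)) = i" "a \<in> sep z (r i) \<longleftrightarrow> i \<noteq> 0" if "i \<le> k" for i
  proof -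
    have "r i \<in> T \<and> sep z (r i) \<subseteq> ?F \<and> card (sep z (r i)) = i \<and> (a \<in> sep z (r i) \<longleftrightarrow> i \<noteq> 0)"
    proof (cases i)
      case 0
      then show ?thesis using z by (simp add: r_def)
    next
      case (Suc j)
      then have j: "p j \<in> T" "sep ?x (p j) \<subseteq> ?F - {a}" "card (sep ?x (p j)) = j"
        using p(3)[of j] that by auto
      then have "a \<notin> sep ?x (p j)" by blast
      then have e: "sep z (p j) = insert a (sep ?x (p j))" by auto
      have "card (sep z (p j)) = Suc j"
        unfolding e using \<open>a \<notin> sep ?x (p j)\<close> j xT finite_members by simp
      moreover have "sep z (p j) \<subseteq> ?F" "a \<in> sep z (p j)" unfolding e using j(2) abF by blast+
      ultimately show ?thesis using Suc j(1) by (simp add: r_def)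
    qed
    then show "r i \<in> T" "sep z (r i) \<subseteq> ?F" "card (sep z (r i)) = i" "a \<in> sep z (r i) \<longleftrightarrow> i \<noteq> 0"
      by blast+
  qed
  define q where "q i = (if i < k then r i else sep (r (i - k)) ?F)" for i
  have q_face: "q i \<in> T" "sep z (q i) \<subseteq> ?F" if "i < 2 * k" for i
  proof -
    have "q i \<in> T \<and> sep z (q i) \<subseteq> ?F"
    proof (cases "i < k")
      case True
      then show ?thesis using r[of i] by (simp add: q_def)
    next
      case False
      then have "r (i - k) \<in> T" "sep z (r (i - k)) \<subseteq> ?F" using r(1,2)[of "i - k"] that by simp_all
      moreover from this have "sep (r (i - k)) ?F \<in> T" using face_antipode[OF z N] by blast
      moreover have "sep z (sep (r (i - k)) ?F) = ?F - sep z (r (i - k))"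
        using \<open>sep z (r (i - k)) \<subseteq> ?F\<close> by auto
      ultimately show ?thesis using False by (simp add: q_def del: mem_sep)
    qed
    then show "q i \<in> T" "sep z (q i) \<subseteq> ?F" by blast+
  qed
  have q_edge: "(q i, q (Suc i mod (2 * k))) \<in> cube_edges T" if i: "i < 2 * k" for i
  proof -
    consider "Suc i < k" | "Suc i = k" | "k \<le> i" "Suc i < 2 * k" | "Suc i = 2 * k"
      using i by linarith
    then show ?thesis
    proof cases
      case 1
      then show ?thesis using r_edge[of i] by (simp add: q_def)
    next
      case 2
      then have "Suc i mod (2 * k) = k" "i < k" using k2 by auto
      then show ?thesis using r_edge[of i] 2 r0 rk by (simp add: q_def)
    next
      case 3
      then have "(r (i - k), r (Suc (i - k))) \<in> cube_edges T" using r_edge[of "i - k"] by simp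
      then have "card (sep (r (i - k)) (r (Suc (i - k)))) = 1" by (simp add: cube_edges_def)
      moreover have "q (Suc i) = sep (r (Suc (i - k))) ?F" "q i = sep (r (i - k)) ?F"
        using 3 by (simp_all add: q_def Suc_diff_le)
      ultimately show ?thesis
        using q_face(1)[OF i] q_face(1)[OF 3(2)] 3 by (simp add: cube_edges_def sep_sep_cancel)
    next
      case 4
      \<comment> \<open>The edge closing the cycle is the antipodal image of the last edge of the
        geodesic.\<close>
      then have ik: "i - k = k - 1" "\<not> i < k" "0 < k" using k2 by auto
      then have "(r (k - 1), r k) \<in> cube_edges T" using r_edge[of "k - 1"] by simp
      then have "card (sep (r (k - 1)) (sep z ?F)) = 1" using rk by (simp add: cube_edges_def)
      then have "card (sep (sep (r (k - 1)) ?F) z) = 1" 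
        by (metis sep_assoc sep_commute)
      moreover have "q i = sep (r (k - 1)) ?F" "q 0 = z" using ik r0 by (simp_all add: q_def)
      ultimately show ?thesis
        using q_face(1)[OF i] z 4 by (simp add: cube_edges_def)
    qed
  qed
  \<comment> \<open>The index can be read off the vertex: \<open>a\<close> is flipped exactly at the
    indices from \<open>1\<close> to \<open>k\<close>, where the index is the distance from
    \<open>z\<close>. On the way back the distance is \<open>2 * k\<close> minus the index. The
    start gets the value \<open>2 * k\<close>, which no other vertex has.\<close>
  define pos where "pos s = (if a \<in> sep z s then card (sep z s) else 2 * k - card (sep z s))" for s
  have pos: "pos (q i) = (if i = 0 then 2 * k else i)" if "i < 2 * k" for i
  proof (cases "i < k")
    case True
    then show ?thesis using r(3,4)[of i] r0 unfolding pos_def by (simp add: q_def del: mem_sep)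
  next
    case False
    let ?j = "i - k"
    have j: "?j \<le> k" "?j < k" using that False by linarith+
    have e: "sep z (q i) = ?F - sep z (r ?j)"
      using False r(2)[OF j(1)] by (auto simp: q_def)
    have "card (sep z (q i)) = k - ?j"
      unfolding e using r(2,3)[OF j(1)] finF by (simp add: card_Diff_subset finite_subset k_def del: mem_sep)
    moreover have "a \<in> sep z (q i) \<longleftrightarrow> ?j = 0" unfolding e using abF r(4)[OF j(1)] by blast
    ultimately show ?thesis using False j k2 that unfolding pos_def by (auto simp del: mem_sep)
  qed
  have "inj_on q {..<2 * k}"
  proof (rule inj_onI)
    fix i j assume ij: "i \<in> {..<2 * k}" "j \<in> {..<2 * k}" "q i = q j"
    then have "(if i = 0 then 2 * k else i) = (if j = 0 then 2 * k else j)"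
      using pos[of i] pos[of j] by simp
    moreover have "i < 2 * k" "j < 2 * k" using ij by simp_all
    ultimately show "i = j" by presburger
  qed
  define c where "c = map q [0..<2 * k]"
  have len: "length c = 2 * k" by (simp add: c_def)
  have nth: "c ! i = q i" if "i < 2 * k" for i using that by (simp add: c_def)
  have cyc: "cycle T (cube_edges T) c"
    unfolding cycle_def len
  proof (intro conjI allI impI)
    show "3 \<le> 2 * k" using k2 by simp
    show "distinct c" using \<open>inj_on q {..<2 * k}\<close> by (simp add: c_def distinct_map atLeast0LessThan)
    show "set c \<subseteq> T" using q_face(1) by (auto simp: c_def)
    fix i assume i: "i < 2 * k"
    moreover have "Suc i mod (2 * k) < 2 * k" using k2 by (intro mod_less_divisor) linarith
    ultimately show "(c ! i, c ! (Suc i mod (2 * k))) \<in> cube_edges T" using q_edge[OF i] by (simp add: nth)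
  qed
  have sub: "sep z s \<subseteq> ?F" "s \<in> T" if "s \<in> set c" for s
  proof -
    obtain i where "i < 2 * k" "s = q i" using \<open>s \<in> set c\<close> by (auto simp: c_def)
    then show "sep z s \<subseteq> ?F" "s \<in> T" using q_face[of i] by simp_all
  qed
  \<comment> \<open>The cycle uses two directions at \<open>s\<close> and the face offers only two,
    so every edge of the face at \<open>s\<close> is an edge of the cycle. Hence there are no
    chords, and the cycle exhausts the face.\<close>
  have edge: "{s, sep s {g}} \<in> cycle_edges c" if s: "s \<in> set c" and g: "g \<in> nbr s" "g \<in> ?F" for s g
  proof -
    obtain i where "i < length c" "s = c ! i" using s by (auto simp: in_set_conv_nth)
    then obtain h l where hl: "h \<noteq> l" "sep s {h} \<in> set c" "sep s {l} \<in> set c"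
      "{s, sep s {h}} \<in> cycle_edges c" "{s, sep s {l}} \<in> cycle_edges c"
      using cycle_two_flips[OF cyc, of i] by metis
    have "d \<in> nbr s \<inter> ?F" if d: "sep s {d} \<in> set c" for d
    proof -
      have "d \<in> ?F"
        using sub(1)[OF d, THEN subsetD, of d] sub(1)[OF s, THEN subsetD, of d] by auto
      then show ?thesis using sub(2)[OF d] by (simp add: mem_nbr)
    qed
    then have "h \<in> nbr s \<inter> ?F" "l \<in> nbr s \<inter> ?F" "g \<in> nbr s \<inter> ?F" using hl g by blast+
    moreover obtain u v where "nbr s \<inter> ?F = {u, v}"
      using rank_two_face_nbrs[OF z ab sub(2)[OF s] sub(1)[OF s]] by blast
    ultimately have "g = h \<or> g = l" using hl(1) by (metis insertE singletonD)
    then show ?thesis using hl by blast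
  qed
  have z_c: "z \<in> set c" "c ! 0 = z" using k2 r0 by (auto simp: c_def q_def intro!: image_eqI[of _ _ 0])
  have all: "s \<in> set c" if s: "s \<in> T" "sep z s \<subseteq> ?F" for s
    using s(1) z s(2)
  proof (induction rule: face_induct)
    case base
    show ?case by (rule z_c)
  next
    case (step y g)
    then show ?case using edge[of y g] cycle_edge_subset by blast
  qed
  have "convex_cycle T (cube_edges T) c"
    unfolding convex_cycle_def
  proof (intro conjI ballI impI)
    show "cycle T (cube_edges T) c" by (rule cyc)
  next
    fix u v assume uv: "u \<in> set c" "v \<in> set c"
    show "geod_interval T (cube_edges T) u v \<subseteq> set c"
    proof
      fix x assume "x \<in> geod_interval T (cube_edges T) u v"
      then have x: "x \<in> T" "sep u x \<subseteq> sep u v" using uv sub(2) by (simp_all add: interval_eq)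
      have "sep z x \<subseteq> ?F"
      proof
        fix e assume "e \<in> sep z x"
        then show "e \<in> ?F"
          using x(2)[THEN subsetD, of e] sub(1)[OF uv(1), THEN subsetD, of e] sub(1)[OF uv(2), THEN subsetD, of e]
          by auto
      qed
      then show "x \<in> set c" using all x(1) by blast
    qed
  next
    fix u v assume uv: "u \<in> set c" "v \<in> set c" "(u, v) \<in> cube_edges T"
    then obtain g where g: "v = sep u {g}" "g \<in> nbr u" by (auto simp: cube_edges_iff mem_nbr)
    have "g \<in> ?F"
      using g(1) sub(1)[OF uv(1), THEN subsetD, of g] sub(1)[OF uv(2), THEN subsetD, of g] by auto
    then show "{u, v} \<in> cycle_edges c" using edge[OF uv(1) g(2)] g(1) by blast
  qed
  moreover have "opposite c z (sep z ?F)"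
    unfolding opposite_def len
    using k2 z_c(2) r0 by (intro conjI exI[of _ 0]) (simp_all add: nth q_def)
  ultimately show ?thesis using edge[OF z_c(1)] ab abF by blast
qed

text \<open>Both \<open>a\<close> and \<open>b\<close> separate \<open>z\<close> from
  \<open>u\<close>, hence so does all of their span. The vertex opposite to \<open>z\<close> in the
  cycle of this face therefore lies between \<open>u\<close> and either of the two
  neighbours.\<close>

lemma mediangle_cube_edges: "mediangle T (cube_edges T)"
  unfolding mediangle_def
proof (intro conjI ballI allI impI)
  fix c c'
  assume "convex_cycle T (cube_edges T) c \<and> convex_cycle T (cube_edges T) c' \<and> cycle_edges c \<noteq> cycle_edges c'"
  then show "card (cycle_edges c \<inter> cycle_edges c') \<le> 1" using convex_cycles_meet[of c c'] by blast
next
  fix u x y z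
  assume T: "u \<in> T" "x \<in> T" "y \<in> T" "z \<in> T"
    and d: "x \<noteq> y \<and> gdist (cube_edges T) u x = gdist (cube_edges T) u y \<and>
      gdist (cube_edges T) u z = gdist (cube_edges T) u x + 1 \<and>
      gdist (cube_edges T) x z = 1 \<and> gdist (cube_edges T) y z = 1"
  have "card (sep x z) = 1" "card (sep y z) = 1" using T d gdist_eq by metis+
  then have "(z, x) \<in> cube_edges T" "(z, y) \<in> cube_edges T"
    using T by (simp_all add: cube_edges_def sep_commute[of z])
  then obtain a b where ab: "x = sep z {a}" "y = sep z {b}" by (auto simp: cube_edges_iff)
  have N: "a \<in> nbr z" "b \<in> nbr z" "a \<noteq> b" using ab T d by (auto simp: mem_nbr)
  have up: "a \<in> sep z u" if x: "x = sep z {a}" "x \<in> T" "card (sep u z) = card (sep u x) + 1" for x a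
  proof (rule ccontr)
    assume "a \<notin> sep z u"
    then have "sep u x = insert a (sep u z)" "a \<notin> sep u z" using x(1) by auto
    then show False using x(3) T finite_members by simp
  qed
  have "card (sep u z) = card (sep u x) + 1" "card (sep u z) = card (sep u y) + 1"
    using d T by (simp_all add: gdist_eq)
  then have ab_u: "{a, b} \<subseteq> sep z u" using up[OF ab(1) T(2)] up[OF ab(2) T(3)] by blast
  let ?w = "sep z (span z {a, b})"
  have N': "{a, b} \<subseteq> nbr z" using N by simp
  have F: "span z {a, b} \<subseteq> sep z u" by (rule span_least[OF T(1) ab_u])
  have abF: "a \<in> span z {a, b}" "b \<in> span z {a, b}" using subset_span[OF N' T(4)] by blast+
  have "sep u ?w = sep u z - span z {a, b}" using F by auto
  moreover have "sep u x = sep u z - {a}" "sep u y = sep u z - {b}" using ab ab_u by auto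
  ultimately have "sep u ?w \<subseteq> sep u x" "sep u ?w \<subseteq> sep u y" using abF by blast+
  then have "?w \<in> geod_interval T (cube_edges T) u x \<inter> geod_interval T (cube_edges T) u y"
    using T span_in[OF T(4) N'] by (simp add: interval_eq)
  then show "\<exists>c w. convex_cycle T (cube_edges T) c \<and> {z, x} \<in> cycle_edges c \<and> {z, y} \<in> cycle_edges c \<and>
           opposite c z w \<and> w \<in> geod_interval T (cube_edges T) u x \<inter> geod_interval T (cube_edges T) u y"
    using rank_two_cycle[OF T(4) N] unfolding ab by blast
qed

end

section \<open>Covectors of an antipodal family\<close>

lemma sign_vectors_cases:
  assumes "X \<in> sign_vectors U"
  obtains "X e = 0" | "e \<in> U" "X e = 1" | "e \<in> U" "X e = -1"
  using assms unfolding sign_vectors_def by (cases "e \<in> U") auto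

lemma finite_sign_vectors: "finite U \<Longrightarrow> finite (sign_vectors U)"
  using finite_set_of_finite_funs[of U "{-1, 0, 1 :: int}" 0]
  by (rule rev_finite_subset) (auto simp: sign_vectors_def)

lemma sv_comp_in_sign_vectors: "X \<in> sign_vectors U \<Longrightarrow> Y \<in> sign_vectors U \<Longrightarrow> sv_comp X Y \<in> sign_vectors U"
  by (auto simp: sign_vectors_def sv_comp_def)

lemma uminus_in_sign_vectors: "X \<in> sign_vectors U \<Longrightarrow> - X \<in> sign_vectors U"
  by (auto simp: sign_vectors_def)

lemma om_rank_attained:
  assumes "finite L"
  shows "\<exists>C\<subseteq>L. Complete_Partial_Order.chain sv_le C \<and> card C - 1 = om_rank L"
    and "C \<subseteq> L \<Longrightarrow> Complete_Partial_Order.chain sv_le C \<Longrightarrow> card C - 1 \<le> om_rank L"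
proof -
  let ?R = "{card C - 1 | C. C \<subseteq> L \<and> Complete_Partial_Order.chain sv_le C}"
  have "finite ((\<lambda>C. card C - 1) ` Pow L)" using assms by simp
  then have fin: "finite ?R" by (rule rev_finite_subset) auto
  \<comment> \<open>Subtraction is truncated, so the empty chain contributes the number
    \<open>0\<close>.\<close>
  have "{} \<subseteq> L \<and> Complete_Partial_Order.chain sv_le ({} :: ('a \<Rightarrow> int) set)" by (simp add: chain_empty)
  then have "?R \<noteq> {}" by blast
  then have "Max ?R \<in> ?R" using fin by (rule Max_in[rotated])
  then show "\<exists>C\<subseteq>L. Complete_Partial_Order.chain sv_le C \<and> card C - 1 = om_rank L"
    unfolding om_rank_def[of L] by (smt (verit) mem_Collect_eq)
  show "C \<subseteq> L \<Longrightarrow> Complete_Partial_Order.chain sv_le C \<Longrightarrow> card C - 1 \<le> om_rank L"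
    unfolding om_rank_def[of L] using fin by (intro Max_ge) blast+
qed

section \<open>Chains in finite power sets\<close>

lemma set_chain_card_le:
  assumes "finite N" "\<C> \<subseteq> Pow N" "\<And>A B. A \<in> \<C> \<Longrightarrow> B \<in> \<C> \<Longrightarrow> A \<subseteq> B \<or> B \<subseteq> A"
  shows "inj_on card \<C>" "card ` \<C> \<subseteq> {..card N}" "card \<C> \<le> Suc (card N)"
proof -
  show inj: "inj_on card \<C>"
  proof (rule inj_onI)
    fix A B assume AB: "A \<in> \<C>" "B \<in> \<C>" "card A = card B"
    then have "finite A" "finite B" using assms(1,2) by (blast intro: finite_subset)+
    then show "A = B" using assms(3)[OF AB(1,2)] AB(3) card_subset_eq by metis
  qed
  show im: "card ` \<C> \<subseteq> {..card N}" using assms(1,2) card_mono by blast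
  show "card \<C> \<le> Suc (card N)"
    using card_inj_on_le[OF inj im] by simp
qed

lemma set_chain_exists:
  assumes "finite D" "D \<inter> M = {}"
  shows "\<exists>\<C>. finite \<C> \<and> card \<C> = Suc (card D) \<and> (\<forall>B\<in>\<C>. M \<subseteq> B \<and> B \<subseteq> M \<union> D) \<and>
    (\<forall>A\<in>\<C>. \<forall>B\<in>\<C>. A \<subseteq> B \<or> B \<subseteq> A)"
  using assms
proof (induction D rule: finite_induct)
  case empty
  show ?case by (intro exI[of _ "{M}"]) simp
next
  case (insert x D)
  have "D \<inter> M = {}" using insert.prems by blast
  from insert.IH[OF this] obtain \<C> where C: "finite \<C>" "card \<C> = Suc (card D)"
    "\<forall>B\<in>\<C>. M \<subseteq> B \<and> B \<subseteq> M \<union> D" "\<forall>A\<in>\<C>. \<forall>B\<in>\<C>. A \<subseteq> B \<or> B \<subseteq> A"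
    by (elim exE conjE)
  let ?N = "M \<union> insert x D"
  have "x \<notin> M \<union> D" using insert.hyps insert.prems by blast
  then have "\<not> ?N \<subseteq> M \<union> D" by blast
  then have "?N \<notin> \<C>" using C(3) by meson
  then have "card (insert ?N \<C>) = Suc (card (insert x D))" using C(1,2) insert.hyps by simp
  moreover have "\<forall>B\<in>insert ?N \<C>. M \<subseteq> B \<and> B \<subseteq> ?N" using C(3) by blast
  moreover have "\<forall>B\<in>insert ?N \<C>. B \<subseteq> ?N" using C(3) by blast
  then have "\<forall>A\<in>insert ?N \<C>. \<forall>B\<in>insert ?N \<C>. A \<subseteq> B \<or> B \<subseteq> A" using C(4) by (metis insert_iff)
  ultimately show ?case using C(1) by (intro exI[of _ "insert ?N \<C>"]) simp
qed

section \<open>Sign vectors acting on the encoded topes\<close>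

context antipodal_family
begin

definition sgnv :: "'e set \<Rightarrow> 'e \<Rightarrow> int" where
  "sgnv t = (\<lambda>e. if e \<in> W then if e \<in> t then 1 else -1 else 0)"

definition zeros :: "('e \<Rightarrow> int) \<Rightarrow> 'e set" where
  "zeros X = {e \<in> W. X e = 0}"

text \<open>Topes are encoded by their sets of positive elements; \<open>act X t\<close> encodes the composition of \<open>X\<close>
  with the tope of \<open>t\<close>.\<close>

definition act :: "('e \<Rightarrow> int) \<Rightarrow> 'e set \<Rightarrow> 'e set" where
  "act X t = {e \<in> W. X e = 1 \<or> X e = 0 \<and> e \<in> t}"

text \<open>The largest candidate: composition with a covector takes topes to topes, so an oriented
  matroid with these topes is contained in this set, as \<open>L_subset_covectors\<close>
  shows.\<close>

definition covectors :: "('e \<Rightarrow> int) set" where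
  "covectors = {X \<in> sign_vectors W. \<forall>t\<in>T. act X t \<in> T}"

lemma covectors_sign: "X \<in> covectors \<Longrightarrow> X \<in> sign_vectors W"
  by (simp add: covectors_def)

lemma act_in: "X \<in> covectors \<Longrightarrow> t \<in> T \<Longrightarrow> act X t \<in> T"
  by (simp add: covectors_def)

lemma sgnv_in_sign_vectors: "sgnv t \<in> sign_vectors W"
  by (simp add: sgnv_def sign_vectors_def)

lemma act_comp: "act (sv_comp X Y) t = act X (act Y t)"
  by (auto simp: act_def sv_comp_def)

lemma act_uminus:
  assumes "X \<in> sign_vectors W"
  shows "act (- X) t = sep (act X (sep t W)) W"
proof (rule Set.set_eqI)
  fix e
  show "e \<in> act (- X) t \<longleftrightarrow> e \<in> sep (act X (sep t W)) W"
    using assms by (cases rule: sign_vectors_cases[of X W e]) (auto simp: act_def)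
qed

lemma act_sgnv: "s \<in> T \<Longrightarrow> act (sgnv s) t = s"
  using members_subset[of s] by (auto simp: act_def sgnv_def)

lemma act_zero: "t \<in> T \<Longrightarrow> act (\<lambda>_. 0) t = t"
  using members_subset[of t] by (auto simp: act_def)

lemma sgnv_in_covectors: "t \<in> T \<Longrightarrow> sgnv t \<in> covectors"
  by (simp add: covectors_def sgnv_in_sign_vectors act_sgnv)

lemma zero_in_covectors: "(\<lambda>_. 0) \<in> covectors"
  by (simp add: covectors_def act_zero) (simp add: sign_vectors_def)

lemma comp_in_covectors: "X \<in> covectors \<Longrightarrow> Y \<in> covectors \<Longrightarrow> sv_comp X Y \<in> covectors"
  by (simp add: covectors_def sv_comp_in_sign_vectors act_comp)

lemma uminus_in_covectors: "X \<in> covectors \<Longrightarrow> - X \<in> covectors"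
  by (simp add: covectors_def uminus_in_sign_vectors act_uminus antipode)

lemma sgnv_inj: "s \<in> T \<Longrightarrow> t \<in> T \<Longrightarrow> sgnv s = sgnv t \<longleftrightarrow> s = t"
  using act_sgnv by metis

lemma act_act: "act X (act X t) = act X t"
  by (auto simp: act_def)

lemma act_eq_iff:
  assumes X: "X \<in> sign_vectors W" and v: "v \<in> T"
  shows "act X v = v \<longleftrightarrow> (\<forall>e\<in>W. X e = 0 \<or> X e = sgnv v e)"
proof -
  have "(e \<in> act X v \<longleftrightarrow> e \<in> v) \<longleftrightarrow> (e \<in> W \<longrightarrow> X e = 0 \<or> X e = sgnv v e)" for e
    using X members_subset[OF v]
    by (cases rule: sign_vectors_cases[of X W e]) (auto simp: act_def sgnv_def)
  then show ?thesis by (auto simp: set_eq_iff)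
qed

text \<open>Below a common tope all nonzero signs are those of \<open>v\<close>, so only the zero
  sets are left to compare.\<close>

lemma sv_le_iff:
  assumes X: "X \<in> sign_vectors W" "act X v = v" and Y: "Y \<in> sign_vectors W" "act Y v = v" and v: "v \<in> T"
  shows "sv_le X Y \<longleftrightarrow> zeros Y \<subseteq> zeros X"
proof -
  have "X e = 0 \<or> X e = sgnv v e" "Y e = 0 \<or> Y e = sgnv v e" if "e \<in> W" for e
    using act_eq_iff[OF X(1) v] act_eq_iff[OF Y(1) v] X(2) Y(2) that by blast+
  moreover have "X e = 0" "Y e = 0" if "e \<notin> W" for e
    using X(1) Y(1) that by (simp_all add: sign_vectors_def)
  moreover have "sgnv v e \<noteq> 0" if "e \<in> W" for e using that by (simp add: sgnv_def)
  ultimately show ?thesis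
    unfolding sv_le_def zeros_def by (smt (verit) mem_Collect_eq subset_iff)
qed

lemma sep_act:
  assumes X: "X \<in> sign_vectors W" "act X v = v" and v: "v \<in> T" and t: "t \<in> T"
  shows "sep v (act X t) = zeros X \<inter> sep v t"
proof (rule Set.set_eqI)
  fix e
  have *: "e \<in> W \<longrightarrow> X e = 0 \<or> X e = sgnv v e" using act_eq_iff[OF X(1) v] X(2) by blast
  then show "e \<in> sep v (act X t) \<longleftrightarrow> e \<in> zeros X \<inter> sep v t"
    using members_subset[OF v] members_subset[OF t]
    by (auto simp: act_def zeros_def sgnv_def split: if_splits)
qed

lemma sep_act_antipode:
  assumes X: "X \<in> sign_vectors W" "act X v = v" and v: "v \<in> T" and t: "t \<in> T"
  shows "sep v (act X (sep t W)) = zeros X - sep v t"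
  using sep_act[OF X v antipode[OF t]] sep_antipode[OF v t] by (auto simp: zeros_def)

text \<open>A covector below \<open>v\<close> is determined by the neighbours of \<open>v\<close> in its zero set, because the tope
  that differs from \<open>v\<close> exactly on \<open>zeros X - zeros Y\<close> is a composition of \<open>X\<close>, \<open>Y\<close> and \<open>v\<close>.\<close>

lemma zeros_subset_iff:
  assumes X: "X \<in> covectors" "act X v = v" and Y: "Y \<in> covectors" "act Y v = v" and v: "v \<in> T"
  shows "zeros X \<subseteq> zeros Y \<longleftrightarrow> nbr v \<inter> zeros X \<subseteq> nbr v \<inter> zeros Y"
proof
  assume sub: "nbr v \<inter> zeros X \<subseteq> nbr v \<inter> zeros Y"
  let ?s = "act Y (sep v W)"
  let ?t = "act X (sep ?s W)"
  have s: "?s \<in> T" "sep v ?s = zeros Y"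
    using act_in[OF Y(1) antipode[OF v]] sep_act_antipode[OF covectors_sign[OF Y(1)] Y(2) v v] by simp_all
  then have t: "?t \<in> T" "sep v ?t = zeros X - zeros Y"
    using act_in[OF X(1) antipode[OF s(1)]] sep_act_antipode[OF covectors_sign[OF X(1)] X(2) v s(1)] by simp_all
  have "v = ?t"
  proof (rule ccontr)
    assume "v \<noteq> ?t"
    then obtain a where "a \<in> zeros X - zeros Y" "a \<in> nbr v" using step_nbr[OF v t(1)] t(2) by auto
    then show False using sub by blast
  qed
  then have "sep v ?t = {}" by simp
  then show "zeros X \<subseteq> zeros Y" unfolding t(2) by blast
qed blast

lemma covector_eqI:
  assumes X: "X \<in> covectors" "act X v = v" and Y: "Y \<in> covectors" "act Y v = v" and v: "v \<in> T"
    and eq: "nbr v \<inter> zeros X = nbr v \<inter> zeros Y"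
  shows "X = Y"
proof
  fix e
  have "zeros X = zeros Y" using zeros_subset_iff[OF X Y v] zeros_subset_iff[OF Y X v] eq by blast
  then have "e \<in> W \<longrightarrow> (X e = 0 \<longleftrightarrow> Y e = 0)" unfolding zeros_def by blast
  moreover have "e \<in> W \<longrightarrow> (X e = 0 \<or> X e = sgnv v e) \<and> (Y e = 0 \<or> Y e = sgnv v e)"
    using act_eq_iff[OF covectors_sign v] X Y by blast
  moreover have "e \<notin> W \<longrightarrow> X e = 0 \<and> Y e = 0"
    using covectors_sign[OF X(1)] covectors_sign[OF Y(1)] by (simp add: sign_vectors_def)
  ultimately show "X e = Y e" by metis
qed

text \<open>A member with the fewest zeros is the greatest of the chain, and composing it with any
  tope gives a tope above all members.\<close>

lemma covector_chain_top:
  assumes C: "C \<subseteq> covectors" "Complete_Partial_Order.chain sv_le C" "C \<noteq> {}"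
  shows "\<exists>v\<in>T. \<forall>X\<in>C. act X v = v"
proof -
  obtain X where X: "X \<in> C" and X_min: "\<And>Y. Y \<in> C \<Longrightarrow> card (zeros X) \<le> card (zeros Y)"
    using ex_has_least_nat[of "\<lambda>X. X \<in> C" _ "\<lambda>X. card (zeros X)"] C(3) by blast
  obtain t where t: "t \<in> T" using nonempty by blast
  let ?v = "act X t"
  have Xc: "X \<in> covectors" using X C by blast
  have v: "?v \<in> T" using act_in[OF Xc t] .
  have "act Y ?v = ?v" if Y: "Y \<in> C" for Y
  proof -
    have "sv_le Y X"
    proof (rule ccontr)
      assume n: "\<not> sv_le Y X"
      then have XY: "sv_le X Y" using chainD[OF C(2) X Y] by blast
      then have "zeros Y \<subseteq> zeros X" by (auto simp: sv_le_def zeros_def)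
      moreover have fin: "finite (zeros X)" using finite_ground by (simp add: zeros_def)
      ultimately have eq: "zeros Y = zeros X" using X_min[OF Y] card_seteq by blast
      have "sv_le Y X"
        unfolding sv_le_def
      proof
        fix e
        show "Y e = 0 \<or> Y e = X e"
        proof (cases "e \<in> W")
          case True
          then show ?thesis using eq XY unfolding zeros_def sv_le_def by auto
        next
          case False
          then show ?thesis using covectors_sign[of Y] Y C(1) by (auto simp: sign_vectors_def)
        qed
      qed
      then show False using n by blast
    qed
    have "\<forall>e\<in>W. X e = 0 \<or> X e = sgnv ?v e"
      using act_eq_iff[OF covectors_sign[OF Xc] v] act_act by simp
    then have "\<forall>e\<in>W. Y e = 0 \<or> Y e = sgnv ?v e" using \<open>sv_le Y X\<close> unfolding sv_le_def by metis
    then show ?thesis using act_eq_iff[OF covectors_sign v, of Y] Y C(1) by blast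
  qed
  then show ?thesis using v by blast
qed

lemma covector_chain_image:
  assumes C: "C \<subseteq> covectors" "Complete_Partial_Order.chain sv_le C" and v: "v \<in> T" "\<And>X. X \<in> C \<Longrightarrow> act X v = v"
  shows "inj_on (\<lambda>X. nbr v \<inter> zeros X) C"
    and "A \<in> (\<lambda>X. nbr v \<inter> zeros X) ` C \<Longrightarrow> B \<in> (\<lambda>X. nbr v \<inter> zeros X) ` C \<Longrightarrow> A \<subseteq> B \<or> B \<subseteq> A"
proof -
  show "inj_on (\<lambda>X. nbr v \<inter> zeros X) C"
  proof (rule inj_onI)
    fix X Y assume "X \<in> C" "Y \<in> C" "nbr v \<inter> zeros X = nbr v \<inter> zeros Y"
    then show "X = Y" using covector_eqI[OF _ v(2) _ v(2) v(1), of X Y] C(1) by blast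
  qed
  have "zeros Y \<subseteq> zeros X \<or> zeros X \<subseteq> zeros Y" if "X \<in> C" "Y \<in> C" for X Y
    using chainD[OF C(2) that] by (auto simp: sv_le_def zeros_def)
  then show "A \<in> (\<lambda>X. nbr v \<inter> zeros X) ` C \<Longrightarrow> B \<in> (\<lambda>X. nbr v \<inter> zeros X) ` C \<Longrightarrow> A \<subseteq> B \<or> B \<subseteq> A"
    by blast
qed

lemma covector_chain_card_le:
  assumes C: "C \<subseteq> covectors" "Complete_Partial_Order.chain sv_le C" and v: "v \<in> T" "\<And>X. X \<in> C \<Longrightarrow> act X v = v"
  shows "card C \<le> Suc (card (nbr v))"
proof -
  note im = covector_chain_image[OF C v]
  have "card C = card ((\<lambda>X. nbr v \<inter> zeros X) ` C)" using card_image[OF im(1)] by simp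
  also have "\<dots> \<le> Suc (card (nbr v))"
    using im(2) by (intro set_chain_card_le(3) finite_nbr v) auto
  finally show ?thesis .
qed

lemma sgnv_differ: "{e \<in> W. sgnv s e \<noteq> sgnv t e} = sep s t \<inter> W"
  by (auto simp: sgnv_def)

lemma tope_edges_iff:
  assumes "topes L = sgnv ` T" "s \<in> T" "t \<in> T"
  shows "(sgnv s, sgnv t) \<in> tope_edges W L \<longleftrightarrow> (s, t) \<in> cube_edges T"
proof -
  have "{e \<in> W. sgnv s e \<noteq> sgnv t e} = sep s t" using sgnv_differ sep_subset[OF assms(2,3)] by blast
  then show ?thesis using assms by (auto simp: tope_edges_def cube_edges_def)
qed

lemma degree_tope_edges:
  assumes L: "topes L = sgnv ` T" and v: "v \<in> T"
  shows "degree (tope_edges W L) (sgnv v) = card (nbr v)"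
proof -
  have "{X. (sgnv v, X) \<in> tope_edges W L} = (\<lambda>a. sgnv (sep v {a})) ` nbr v"
  proof (intro Set.equalityI subsetI)
    fix X assume "X \<in> {X. (sgnv v, X) \<in> tope_edges W L}"
    then have X: "(sgnv v, X) \<in> tope_edges W L" by simp
    then obtain t where t: "t \<in> T" "X = sgnv t" by (auto simp: tope_edges_def L)
    then have "(v, t) \<in> cube_edges T" using X tope_edges_iff[OF L v] by blast
    then obtain a where "t = sep v {a}" by (auto simp: cube_edges_iff)
    then show "X \<in> (\<lambda>a. sgnv (sep v {a})) ` nbr v" using t by (auto simp: mem_nbr)
  next
    fix X assume "X \<in> (\<lambda>a. sgnv (sep v {a})) ` nbr v"
    then obtain a where "a \<in> nbr v" "X = sgnv (sep v {a})" by blast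
    then show "X \<in> {X. (sgnv v, X) \<in> tope_edges W L}"
      using tope_edges_iff[OF L v, of "sep v {a}"] v by (simp add: mem_nbr cube_edges_flip)
  qed
  moreover have "inj_on (\<lambda>a. sgnv (sep v {a})) (nbr v)"
    by (rule inj_onI) (simp add: sgnv_inj mem_nbr)
  ultimately show ?thesis unfolding degree_def by (simp add: card_image)
qed

lemma graph_isomorphic_topes:
  assumes "topes L = sgnv ` T"
  shows "graph_isomorphic T (cube_edges T) (topes L) (tope_edges W L)"
  unfolding graph_isomorphic_def
proof (intro exI conjI ballI)
  show "bij_betw sgnv T (topes L)"
    unfolding assms by (intro inj_on_imp_bij_betw inj_onI) (simp add: sgnv_inj)
qed (simp add: tope_edges_iff[OF assms])

end

section \<open>The simplicial oriented matroid of a family with meets\<close>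

context simplicial_family
begin

definition cov :: "'a set \<Rightarrow> 'a set \<Rightarrow> 'a \<Rightarrow> int" where
  "cov v F = (\<lambda>e. if e \<in> F then 0 else sgnv v e)"

lemma zeros_cov: "F \<subseteq> W \<Longrightarrow> zeros (cov v F) = F"
  by (auto simp: zeros_def cov_def sgnv_def)

lemma act_cov:
  assumes "v \<in> T" "t \<in> T" "F \<subseteq> W"
  shows "act (cov v F) t = (v - F) \<union> (t \<inter> F)"
  using members_subset[OF assms(1)] members_subset[OF assms(2)] assms(3)
  by (auto simp: act_def cov_def sgnv_def)

lemma cov_span_in:
  assumes "v \<in> T" "A \<subseteq> nbr v"
  shows "cov v (span v A) \<in> covectors" "act (cov v (span v A)) v = v"
  using span_gated[OF assms] act_cov[OF assms(1) _ span_subset_ground] assms(1)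
  by (auto simp: covectors_def) (auto simp: sign_vectors_def cov_def sgnv_def)

lemma span_zeros:
  assumes X: "X \<in> covectors" "act X v = v" and v: "v \<in> T"
  shows "span v (nbr v \<inter> zeros X) = zeros X"
proof (rule gated_imp_span[OF v])
  show "zeros X \<subseteq> W" by (auto simp: zeros_def)
  fix t assume t: "t \<in> T"
  have "sep v (act X t) = zeros X \<inter> sep v t" by (rule sep_act[OF covectors_sign[OF X(1)] X(2) v t])
  then have "(v - zeros X) \<union> (t \<inter> zeros X) = act X t"
    using sep_sep(1)[of v "act X t"] by auto
  then show "(v - zeros X) \<union> (t \<inter> zeros X) \<in> T" using act_in[OF X(1) t] by simp
qed

text \<open>Move from \<open>X\<close> towards \<open>Y\<close> through parallel faces: the face spanned by the directions of \<open>X\<close>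
  together with one further direction \<open>b\<close> separating \<open>X\<close> from \<open>Y\<close> either lies in \<open>e = 0\<close> or
  leads to a face with the zero set of \<open>X\<close> that is closer to \<open>Y\<close>.\<close>

lemma eliminate_parallel:
  assumes "X \<in> covectors" "Y \<in> covectors" "zeros X = zeros Y" "e \<in> W" "X e * Y e = -1"
  shows "\<exists>Z\<in>covectors. Z e = 0 \<and> (\<forall>f\<in>W. X f * Y f \<noteq> -1 \<longrightarrow> Z f = X f)"
  using assms
proof (induction "card {f \<in> W. X f * Y f = -1}" arbitrary: X rule: less_induct)
  case less
  note X = less.prems(1) and Y = less.prems(2) and XY = less.prems(3) and e = less.prems(4,5)
  let ?D = "{f \<in> W. X f * Y f = -1}" and ?F = "zeros X"
  have Xs: "X \<in> sign_vectors W" and Ys: "Y \<in> sign_vectors W" using X Y covectors_sign by blast+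
  obtain t where t: "t \<in> T" using nonempty by blast
  define v where "v = act X t"
  have v: "v \<in> T" "act X v = v" using act_in[OF X t] act_act by (simp_all add: v_def)
  have Xv: "X f = 0 \<or> X f = sgnv v f" if "f \<in> W" for f using act_eq_iff[OF Xs v(1)] v(2) that by blast
  have opp: "Y f = 0 \<and> X f = 0 \<or> Y f \<noteq> 0 \<and> X f = sgnv v f \<and> (Y f = X f \<and> f \<notin> ?D \<or> Y f = - X f \<and> f \<in> ?D)" if f: "f \<in> W" for f
  proof -
    have "Y f = 0 \<longleftrightarrow> X f = 0" using XY f unfolding zeros_def by blast
    then show ?thesis
      using Xv[OF f] f by (cases rule: sign_vectors_cases[OF Ys, of f]) (auto simp: sgnv_def split: if_splits)
  qed
  have DF: "?D \<inter> ?F = {}" by (auto simp: zeros_def)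
  have sY: "sep v (act Y s) = ?D \<union> (?F \<inter> sep v s)" if "s \<in> T" for s
  proof (rule Set.set_eqI)
    fix f
    show "f \<in> sep v (act Y s) \<longleftrightarrow> f \<in> ?D \<union> (?F \<inter> sep v s)"
    proof (cases "f \<in> W")
      case True
      from opp[OF True] consider "Y f = 0" "X f = 0" | "X f = sgnv v f" "Y f = X f"
        | "X f = sgnv v f" "Y f = - X f" "f \<in> ?D"
        by blast
      then show ?thesis
        by cases (use True in \<open>simp_all add: act_def zeros_def sgnv_def split: if_splits\<close>)
    next
      case False
      then show ?thesis using members_subset[OF v(1)] by (auto simp: act_def zeros_def)
    qed
  qed
  have "sep v (act Y v) = ?D" using sY[OF v(1)] by simp
  moreover have "e \<in> ?D" using e by simp
  ultimately have "v \<noteq> act Y v" by auto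
  then obtain b where b: "b \<in> ?D" "b \<in> nbr v"
    using step_nbr[OF v(1) act_in[OF Y v(1)]] \<open>sep v (act Y v) = ?D\<close> by metis
  define B where "B = insert b (nbr v \<inter> ?F)"
  let ?G = "span v B"
  have B: "B \<subseteq> nbr v" using b by (auto simp: B_def)
  \<comment> \<open>This vertex is an upper bound of \<open>B\<close>, so the new face vanishes only
    where \<open>X\<close> does or where \<open>X\<close> and \<open>Y\<close> have opposite
    signs.\<close>
  have u: "sep v (act Y (sep v W)) = ?D \<union> ?F"
    using sY[OF antipode[OF v(1)]] sep_antipode[OF v(1) v(1)] by (auto simp: zeros_def)
  have GDF: "?G \<subseteq> ?D \<union> ?F"
    using span_least[OF act_in[OF Y antipode[OF v(1)]], of B v] b unfolding u B_def by blast
  have "?F = span v (nbr v \<inter> ?F)" using span_zeros[OF X v(2,1)] by simp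
  also have "\<dots> \<subseteq> ?G" by (rule span_mono) (auto simp: B_def)
  finally have FG: "?F \<subseteq> ?G" .
  have bG: "b \<in> ?G" using subset_span[OF B v(1)] by (auto simp: B_def)
  define Z where "Z = cov v ?G"
  have Z: "Z \<in> covectors" using cov_span_in[OF v(1) B] by (simp add: Z_def)
  have Z0: "Z f = 0" if "f \<in> ?G" for f using that by (simp add: Z_def cov_def)
  have ZX: "Z f = X f" if "f \<in> W" "f \<notin> ?G" for f
  proof -
    have "X f \<noteq> 0" using that FG by (auto simp: zeros_def)
    then show ?thesis using Xv[OF that(1)] that(2) by (simp add: Z_def cov_def)
  qed
  show ?case
  proof (cases "e \<in> ?G")
    case True
    have "Z f = X f" if "f \<in> W" "X f * Y f \<noteq> -1" for f
    proof (cases "f \<in> ?G")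
      case True
      then have "f \<in> ?F" using that GDF by blast
      then show ?thesis using Z0[OF True] by (simp add: zeros_def)
    qed (rule ZX[OF that(1)])
    then show ?thesis using Z Z0[OF True] by blast
  next
    case False
    \<comment> \<open>Crossing the face: this covector equals \<open>Y\<close> on the new span and
      \<open>X\<close> elsewhere. It has the zero set of \<open>Y\<close>, and it no longer
      disagrees with \<open>Y\<close> in the direction \<open>b\<close>, so the induction hypothesis
      applies.\<close>
    let ?X = "sv_comp Z Y"
    have X': "?X \<in> covectors" using comp_in_covectors[OF Z Y] .
    have in_G: "?X f = Y f" if "f \<in> ?G" for f using Z0[OF that] by (simp add: sv_comp_def)
    have out_G: "?X f = X f" if "f \<in> W" "f \<notin> ?G" for f
    proof -
      have "X f \<noteq> 0" using that FG by (auto simp: zeros_def)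
      then show ?thesis using ZX[OF that] by (simp add: sv_comp_def)
    qed
    have "?X f = 0 \<longleftrightarrow> Y f = 0" if "f \<in> W" for f
      using in_G[of f] out_G[OF that] opp[OF that] by (cases "f \<in> ?G") (auto simp: sgnv_def split: if_splits)
    then have zX': "zeros ?X = zeros Y" unfolding zeros_def by blast
    have sq: "x * x \<noteq> -1" for x :: int by (smt (verit) zero_le_square)
    have "?X f * Y f = -1 \<longleftrightarrow> X f * Y f = -1 \<and> f \<notin> ?G" if "f \<in> W" for f
      using in_G[of f] out_G[OF that] sq[of "Y f"] by (cases "f \<in> ?G") simp_all
    then have D': "{f \<in> W. ?X f * Y f = -1} = ?D - ?G" by auto
    then have "{f \<in> W. ?X f * Y f = -1} \<subset> ?D" using b(1) bG by blast
    then have lt: "card {f \<in> W. ?X f * Y f = -1} < card ?D" using finite_ground by (intro psubset_card_mono) auto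
    obtain Z' where Z': "Z' \<in> covectors" "Z' e = 0" "\<forall>f\<in>W. ?X f * Y f \<noteq> -1 \<longrightarrow> Z' f = ?X f"
      using less.hyps[OF lt X' Y zX' e(1)] out_G[OF e(1) False] e(2) by auto
    have "Z' f = X f" if f: "f \<in> W" "X f * Y f \<noteq> -1" for f
    proof -
      have "f \<notin> {f \<in> W. ?X f * Y f = -1}" using f unfolding D' by blast
      then have Z'f: "Z' f = ?X f" using Z'(3) f(1) by blast
      show ?thesis
      proof (cases "f \<in> ?G")
        case True
        then have "f \<in> ?F" using f GDF by blast
        then show ?thesis using Z'f in_G[OF True] XY by (auto simp: zeros_def)
      next
        case False
        then show ?thesis using Z'f out_G[OF f(1)] by simp
      qed
    qed
    then show ?thesis using Z' by blast
  qed
qed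

lemma oriented_matroid_covectors: "oriented_matroid W covectors"
  unfolding oriented_matroid_def
proof (intro conjI)
  show "finite W" by (rule finite_ground)
  show "covectors \<subseteq> sign_vectors W" using covectors_sign by blast
  show "(\<lambda>_. 0) \<in> covectors" by (rule zero_in_covectors)
  show "face_symmetry covectors"
    unfolding face_symmetry_def using comp_in_covectors uminus_in_covectors by blast
  show "simple_system W covectors"
    unfolding simple_system_def
  proof
    fix e assume e: "e \<in> W"
    obtain t where t: "t \<in> T" using nonempty by blast
    have "sgnv t e \<in> (\<lambda>X. X e) ` covectors" "(- sgnv t) e \<in> (\<lambda>X. X e) ` covectors" "0 \<in> (\<lambda>X. X e) ` covectors"
      using sgnv_in_covectors[OF t] uminus_in_covectors[OF sgnv_in_covectors[OF t]] zero_in_covectors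
      by (blast intro: imageI, blast intro: imageI, force)
    then have "{-1, 0, 1} \<subseteq> (\<lambda>X. X e) ` covectors" using e by (auto simp: sgnv_def split: if_splits)
    moreover have "(\<lambda>X. X e) ` covectors \<subseteq> {-1, 0, 1}"
      using covectors_sign e by (auto simp: sign_vectors_def)
    ultimately show "(\<lambda>X. X e) ` covectors = {-1, 0, 1}" by blast
  qed
  show "strong_elimination W covectors"
    unfolding strong_elimination_def
  proof (intro ballI impI)
    fix X Y e assume X: "X \<in> covectors" and Y: "Y \<in> covectors" and e: "e \<in> W" "X e * Y e = -1"
    \<comment> \<open>The two compositions have the same zero set and opposite signs exactly where
      \<open>X\<close> and \<open>Y\<close> do, which reduces the claim to parallel faces.\<close>
    let ?X = "sv_comp X Y" and ?Y = "sv_comp Y X"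
    have "?X e * ?Y e = -1" using e by (auto simp: sv_comp_def)
    moreover have "zeros ?X = zeros ?Y" by (auto simp: zeros_def sv_comp_def)
    ultimately obtain Z where Z: "Z \<in> covectors" "Z e = 0" "\<forall>f\<in>W. ?X f * ?Y f \<noteq> -1 \<longrightarrow> Z f = ?X f"
      using eliminate_parallel[OF comp_in_covectors[OF X Y] comp_in_covectors[OF Y X] _ e(1)] by blast
    have sq: "x * x \<noteq> -1" for x :: int by (smt (verit) zero_le_square)
    have "?X f * ?Y f \<noteq> -1" if "X f * Y f \<noteq> -1" for f
      using that sq by (auto simp: sv_comp_def)
    then show "\<exists>Z\<in>covectors. Z e = 0 \<and> (\<forall>f\<in>W. X f * Y f \<noteq> -1 \<longrightarrow> Z f = sv_comp X Y f)"
      using Z by blast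
  qed
qed

lemma topes_covectors: "topes covectors = sgnv ` T"
proof (intro Set.equalityI subsetI)
  fix X assume X: "X \<in> topes covectors"
  then have Xc: "X \<in> covectors" by (simp add: topes_def)
  obtain t where t: "t \<in> T" using nonempty by blast
  let ?v = "act X t"
  have v: "?v \<in> T" using act_in[OF Xc t] .
  have "\<forall>e\<in>W. X e = 0 \<or> X e = sgnv ?v e"
    using act_eq_iff[OF covectors_sign[OF Xc] v] act_act by simp
  moreover have "\<forall>e. e \<notin> W \<longrightarrow> X e = 0" using covectors_sign[OF Xc] by (simp add: sign_vectors_def)
  ultimately have "sv_le X (sgnv ?v)" unfolding sv_le_def by blast
  then have "sgnv ?v = X" using X sgnv_in_covectors[OF v] by (simp add: topes_def)
  then show "X \<in> sgnv ` T" using imageI[OF v, of sgnv] by simp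
next
  fix X assume "X \<in> sgnv ` T"
  then obtain t where t: "t \<in> T" "X = sgnv t" by blast
  have "Y = sgnv t" if Y: "Y \<in> covectors" "sv_le (sgnv t) Y" for Y
  proof
    fix e show "Y e = sgnv t e"
      using Y covectors_sign[OF Y(1)]
      by (cases "e \<in> W") (auto simp: sv_le_def sgnv_def sign_vectors_def dest: spec[of _ e])
  qed
  then show "X \<in> topes covectors" using t sgnv_in_covectors by (simp add: topes_def)
qed

text \<open>A chain of covectors lies below one tope \<open>u\<close>, where its zero sets trace a
  chain of subsets of \<open>nbr u\<close>; conversely a maximal chain of subsets of
  \<open>nbr v\<close> spans a chain of faces. Since \<open>card (nbr u)\<close> is the same for all
  \<open>u\<close>, the two bounds agree.\<close>

lemma om_rank_covectors:
  assumes v: "v \<in> T"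
  shows "om_rank covectors = card (nbr v)"
proof (rule antisym)
  have fin: "finite covectors"
    by (rule finite_subset[OF _ finite_sign_vectors[OF finite_ground]]) (use covectors_sign in blast)
  obtain C where C: "C \<subseteq> covectors" "Complete_Partial_Order.chain sv_le C" "card C - 1 = om_rank covectors"
    using om_rank_attained(1)[OF fin] by (elim exE conjE)
  show "om_rank covectors \<le> card (nbr v)"
  proof (cases "C = {}")
    case True
    then show ?thesis using C(3) by simp
  next
    case False
    then obtain u where u: "u \<in> T" "\<And>X. X \<in> C \<Longrightarrow> act X u = u" using covector_chain_top[OF C(1,2) False] by metis
    have "card C \<le> Suc (card (nbr u))" by (rule covector_chain_card_le[OF C(1,2) u])
    then show ?thesis using C(3) card_nbr_eq[OF v u(1)] by simp
  qed
  obtain \<C> where cs: "finite \<C>" "card \<C> = Suc (card (nbr v))" "\<forall>B\<in>\<C>. B \<subseteq> nbr v"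
    "\<forall>A\<in>\<C>. \<forall>B\<in>\<C>. A \<subseteq> B \<or> B \<subseteq> A"
    using set_chain_exists[OF finite_nbr[OF v], of "{}"] by auto
  let ?f = "\<lambda>B. cov v (span v B)"
  have zf: "nbr v \<inter> zeros (?f B) = B" if "B \<in> \<C>" for B
    using zeros_cov[OF span_subset_ground] span_Int_nbr[OF v, of B] cs(3) that by (metis Int_commute)
  have "inj_on ?f \<C>"
  proof (rule inj_onI)
    fix A B assume AB: "A \<in> \<C>" "B \<in> \<C>" "?f A = ?f B"
    show "A = B" using arg_cong[OF AB(3), of "\<lambda>X. nbr v \<inter> zeros X"] unfolding zf[OF AB(1)] zf[OF AB(2)] .
  qed
  then have "card (?f ` \<C>) = Suc (card (nbr v))" using card_image cs(2) by metis
  moreover have "?f ` \<C> \<subseteq> covectors" using cov_span_in(1)[OF v] cs(3) by blast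
  moreover have "Complete_Partial_Order.chain sv_le (?f ` \<C>)"
  proof (rule chainI)
    fix X Y assume "X \<in> ?f ` \<C>" "Y \<in> ?f ` \<C>"
    then obtain A B where AB: "A \<in> \<C>" "B \<in> \<C>" "X = ?f A" "Y = ?f B" by blast
    then have "span v A \<subseteq> span v B \<or> span v B \<subseteq> span v A" using cs(4) span_mono by meson
    then show "sv_le X Y \<or> sv_le Y X" unfolding AB by (auto simp: sv_le_def cov_def)
  qed
  ultimately show "card (nbr v) \<le> om_rank covectors" using om_rank_attained(2)[OF fin, of "?f ` \<C>"] by simp
qed

lemma simplicial_oriented_matroid_covectors: "simplicial_oriented_matroid W covectors"
  unfolding simplicial_oriented_matroid_def simplicial_tope_def
  using oriented_matroid_covectors degree_tope_edges[OF topes_covectors] om_rank_covectors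
  by (auto simp: topes_covectors)

end

section \<open>Simplicial oriented matroids have local joins\<close>

text \<open>Induction on \<open>N\<close>. The flag has a member \<open>M\<close> with
  \<open>N = insert x M\<close>, and its remaining members form a flag of \<open>M\<close>, so all
  subsets of \<open>M\<close> are reached. Sets containing \<open>x\<close> follow downwards from
  \<open>N\<close>: the diamond property turns \<open>D\<close>, \<open>insert i D\<close> and
  \<open>insert x (insert i D)\<close> into \<open>insert x D\<close>.\<close>

lemma all_subsets_of_flag:
  assumes "finite N" "\<C> \<subseteq> \<A>" "\<C> \<subseteq> Pow N" "\<And>A B. A \<in> \<C> \<Longrightarrow> B \<in> \<C> \<Longrightarrow> A \<subseteq> B \<or> B \<subseteq> A"
    and "card \<C> = Suc (card N)"
    and diamond: "\<And>C i j. C \<in> \<A> \<Longrightarrow> insert i C \<in> \<A> \<Longrightarrow> insert j (insert i C) \<in> \<A> \<Longrightarrow>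
      i \<notin> C \<Longrightarrow> j \<notin> C \<Longrightarrow> i \<noteq> j \<Longrightarrow> insert j C \<in> \<A>"
  shows "B \<subseteq> N \<Longrightarrow> B \<in> \<A>"
  using assms(1-5)
proof (induction "card N" arbitrary: N \<C> B)
  case 0
  then have "N = {}" by simp
  have "\<C> \<noteq> {}" using 0 by auto
  then obtain A where "A \<in> \<C>" by blast
  moreover have "A = B" using \<open>A \<in> \<C>\<close> 0 \<open>N = {}\<close> by blast
  ultimately show ?case using 0 by blast
next
  case (Suc n)
  note fin = Suc.prems(2) and CA = Suc.prems(3) and CN = Suc.prems(4) and chain = Suc.prems(5) and card = Suc.prems(6)
  have inj: "inj_on card \<C>" and im: "card ` \<C> \<subseteq> {..card N}"
    using set_chain_card_le(1,2)[OF fin CN chain] by blast+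
  \<comment> \<open>Cardinality is injective on a chain, and there are as many members as possible
    sizes, so every size occurs.\<close>
  have "card ` \<C> = {..card N}"
    using card_image[OF inj] im card by (intro card_subset_eq) auto
  then have "card N \<in> card ` \<C>" "n \<in> card ` \<C>" using Suc.hyps(2) by auto
  then obtain N' M where N': "N' \<in> \<C>" "card N' = card N" and M: "M \<in> \<C>" "card M = n"
    by (metis imageE)
  have "N' \<subseteq> N" "M \<subseteq> N" using N' M CN by blast+
  then have "N' = N" "finite M" using N'(2) fin card_subset_eq finite_subset by blast+
  then have NC: "N \<in> \<C>" using N' by simp
  have "card (N - M) = 1" using \<open>M \<subseteq> N\<close> \<open>finite M\<close> M(2) Suc.hyps(2) by (simp add: card_Diff_subset)
  then obtain x where "N - M = {x}" by (auto simp: card_1_singleton_iff)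
  then have x: "N = insert x M" "x \<notin> M" using \<open>M \<subseteq> N\<close> by blast+
  have sub: "A \<subseteq> M" if A: "A \<in> \<C> - {N}" for A
  proof -
    have "A \<subseteq> N" using A CN by blast
    moreover have "A \<subseteq> M \<or> M \<subseteq> A" using chain[of A M] A M by blast
    ultimately show ?thesis using A x by blast
  qed
  have finC: "finite \<C>" using CN fin by (meson finite_Pow_iff finite_subset)
  have IH: "A \<in> \<A>" if "A \<subseteq> M" for A
  proof (rule Suc.hyps(1)[OF _ that \<open>finite M\<close>])
    show "n = card M" using M by simp
    show "\<C> - {N} \<subseteq> \<A>" "\<C> - {N} \<subseteq> Pow M" using CA sub by blast+
    show "card (\<C> - {N}) = Suc (card M)" using NC finC card Suc.hyps(2) M by simp
    show "A \<subseteq> B \<or> B \<subseteq> A" if "A \<in> \<C> - {N}" "B \<in> \<C> - {N}" for A B using chain that by blast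
  qed
  have "insert x D \<in> \<A>" if "D \<subseteq> M" for D
    using that
  proof (induction "card (M - D)" arbitrary: D)
    case 0
    then have "M - D = {}" using \<open>finite M\<close> by simp
    then have "D = M" using 0 by blast
    then show ?case using NC CA x by blast
  next
    case (Suc k)
    have fMD: "finite (M - D)" using \<open>finite M\<close> by simp
    have "M - D \<noteq> {}" using Suc.hyps(2) by (metis card.empty nat.distinct(1))
    then obtain i where i: "i \<in> M" "i \<notin> D" by blast
    have "M - D = insert i (M - insert i D)" using i by blast
    then have "card (M - D) = Suc (card (M - insert i D))"
      using fMD by (metis Diff_iff card_insert_disjoint finite_insert insertI1)
    then have "insert x (insert i D) \<in> \<A>" using Suc.hyps(1)[of "insert i D"] Suc.hyps(2) Suc.prems i by auto
    moreover have "D \<in> \<A>" "insert i D \<in> \<A>" using IH Suc.prems i by auto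
    moreover have "x \<notin> D" "x \<noteq> i" using x Suc.prems i by blast+
    ultimately show ?case using diamond[of D i x] i by blast
  qed
  then have ins: "insert x D \<in> \<A>" if "D \<subseteq> M" for D using that by blast
  show ?case
  proof (cases "x \<in> B")
    case True
    then have "B = insert x (B - {x})" "B - {x} \<subseteq> M" using Suc.prems(1) x by blast+
    then show ?thesis using ins by metis
  next
    case False
    then show ?thesis using IH Suc.prems(1) x by blast
  qed
qed

text \<open>Simpliciality enters through \<open>regular\<close> and \<open>flag\<close>: all degrees
  equal \<open>r\<close>, and some chain realizes \<open>r\<close> as the rank. \<open>L\<close> is
  kept apart from \<open>covectors\<close>, of which it is only known to be a subset.\<close>

locale om_family = antipodal_family +
  fixes L :: "('a \<Rightarrow> int) set" and r :: nat
  assumes L_subset: "L \<subseteq> covectors"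
    and elim: "strong_elimination W L" and face_sym: "face_symmetry L"
    and sgnv_in: "t \<in> T \<Longrightarrow> sgnv t \<in> L"
    and regular: "v \<in> T \<Longrightarrow> card (nbr v) = r"
    and flag: "\<exists>C\<subseteq>L. Complete_Partial_Order.chain sv_le C \<and> card C - 1 = r"
begin

text \<open>By \<open>covector_eqI\<close> a covector below \<open>v\<close> is determined by this
  trace, so \<open>faces v\<close> is a copy of the part of \<open>L\<close> below
  \<open>v\<close>.\<close>

definition faces :: "'a set \<Rightarrow> 'a set set" where
  "faces v = (\<lambda>X. nbr v \<inter> zeros X) ` {X \<in> L. act X v = v}"

lemma facesE:
  assumes "A \<in> faces v"
  obtains X where "X \<in> L" "X \<in> covectors" "act X v = v" "nbr v \<inter> zeros X = A"
  using assms L_subset unfolding faces_def by auto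

text \<open>On the neighbours of \<open>v\<close>, the covector \<open>sv_comp X (- Y)\<close>
  vanishes on \<open>insert i C\<close>, is opposite to \<open>v\<close> at \<open>j\<close> and
  agrees with \<open>v\<close> elsewhere. Eliminating \<open>j\<close> between \<open>P\<close> and
  this covector keeps the sign of \<open>P\<close> at \<open>i\<close>, so that the zeros become
  \<open>insert j C\<close>.\<close>

lemma faces_diamond:
  assumes v: "v \<in> T" and C: "C \<in> faces v" and iC: "insert i C \<in> faces v" and jiC: "insert j (insert i C) \<in> faces v"
    and ij: "i \<notin> C" "j \<notin> C" "i \<noteq> j"
  shows "insert j C \<in> faces v"
proof -
  obtain P where P: "P \<in> L" "P \<in> covectors" "act P v = v" "nbr v \<inter> zeros P = C"
    using C by (rule facesE)
  obtain Y where Y: "Y \<in> L" "Y \<in> covectors" "act Y v = v" "nbr v \<inter> zeros Y = insert i C"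
    using iC by (rule facesE)
  obtain X where X: "X \<in> L" "X \<in> covectors" "act X v = v" "nbr v \<inter> zeros X = insert j (insert i C)"
    using jiC by (rule facesE)
  let ?Y = "sv_comp X (- Y)"
  have Y': "?Y \<in> L" using face_sym X(1) Y(1) by (simp add: face_symmetry_def)
  have n: "n \<in> W" if "n \<in> nbr v" for n using nbr_subset[OF v] that by blast
  have val: "Q k = (if k \<in> A then 0 else sgnv v k)"
    if "Q \<in> covectors" "act Q v = v" "nbr v \<inter> zeros Q = A" "k \<in> nbr v" for Q A k
  proof -
    have "k \<in> W" using n that(4) .
    then have "Q k = 0 \<or> Q k = sgnv v k" using act_eq_iff[OF covectors_sign[OF that(1)] v] that(2) by blast
    moreover have "Q k = 0 \<longleftrightarrow> k \<in> A" using that(3,4) \<open>k \<in> W\<close> by (auto simp: zeros_def)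
    ultimately show ?thesis by auto
  qed
  note valP = val[OF P(2-4)] and valX = val[OF X(2-4)] and valY = val[OF Y(2-4)]
  have sg: "sgnv v k * sgnv v k = 1" "sgnv v k \<noteq> 0" if "k \<in> W" for k using that by (auto simp: sgnv_def)
  have j: "j \<in> nbr v" "j \<in> W" using X(4) n by blast+
  have "P j * ?Y j = -1"
    using valP[OF j(1)] valX[OF j(1)] valY[OF j(1)] ij sg[OF j(2)] by (simp add: sv_comp_def)
  then obtain Z where Z: "Z \<in> L" "Z j = 0" "\<forall>f\<in>W. P f * ?Y f \<noteq> -1 \<longrightarrow> Z f = sv_comp P ?Y f"
    using elim P(1) Y' j(2) unfolding strong_elimination_def by metis
  have Zc: "Z \<in> covectors" using Z(1) L_subset by blast
  have valZ: "Z k = (if k \<in> insert j C then 0 else sgnv v k)" if k: "k \<in> nbr v" for k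
  proof (cases "k = j")
    case True
    then show ?thesis using Z(2) by simp
  next
    case False
    have kW: "k \<in> W" using n k .
    have "P k * ?Y k \<noteq> -1 \<and> sv_comp P ?Y k = (if k \<in> C then 0 else sgnv v k)"
      using valP[OF k] valX[OF k] valY[OF k] sg[OF kW] False ij by (auto simp: sv_comp_def)
    then show ?thesis using Z(3) kW False by simp
  qed
  \<comment> \<open>Elimination controls \<open>Z\<close> only on \<open>nbr v\<close>. This
    suffices, since a first step from \<open>v\<close> to a different vertex \<open>act Z v\<close>
    would have its direction in \<open>nbr v\<close>.\<close>
  have "v = act Z v"
  proof (rule ccontr)
    assume "v \<noteq> act Z v"
    then obtain k where k: "k \<in> sep v (act Z v)" "k \<in> nbr v" using step_nbr[OF v act_in[OF Zc v]] by blast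
    then have "Z k = 0 \<or> Z k = sgnv v k" "k \<in> W" using valZ[OF k(2)] n by simp_all
    then have "k \<in> act Z v \<longleftrightarrow> k \<in> v" by (auto simp: act_def sgnv_def split: if_splits)
    then show False using k(1) by simp
  qed
  moreover have "nbr v \<inter> zeros Z = insert j C"
  proof -
    have "k \<in> zeros Z \<longleftrightarrow> k \<in> insert j C" if "k \<in> nbr v" for k
      using valZ[OF that] sg(2)[OF n[OF that]] n[OF that] by (simp add: zeros_def)
    moreover have "insert j C \<subseteq> nbr v" using X(4) by blast
    ultimately show ?thesis by blast
  qed
  ultimately show ?thesis using Z(1) unfolding faces_def by (intro image_eqI[of _ _ Z]) simp_all
qed

definition flagged :: "'a set \<Rightarrow> bool" where
  "flagged v \<longleftrightarrow> (\<exists>C\<subseteq>L. Complete_Partial_Order.chain sv_le C \<and> (\<forall>X\<in>C. act X v = v) \<and> card C = Suc r)"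

lemma flagged_faces:
  assumes v: "v \<in> T" and f: "flagged v" and B: "B \<subseteq> nbr v"
  shows "B \<in> faces v"
proof -
  obtain C where C: "C \<subseteq> L" "Complete_Partial_Order.chain sv_le C" "\<forall>X\<in>C. act X v = v" "card C = Suc r"
    using f unfolding flagged_def by (elim exE conjE)
  have Cc: "C \<subseteq> covectors" using C(1) L_subset by blast
  let ?f = "\<lambda>X. nbr v \<inter> zeros X"
  note im = covector_chain_image[OF Cc C(2) v bspec[OF C(3)]]
  show ?thesis
  proof (rule all_subsets_of_flag[OF finite_nbr[OF v] _ _ im(2) _ faces_diamond[OF v] B])
    show "?f ` C \<subseteq> faces v" using C(1,3) unfolding faces_def by blast
    show "?f ` C \<subseteq> Pow (nbr v)" by blast
    show "card (?f ` C) = Suc (card (nbr v))" using card_image[OF im(1)] C(4) regular[OF v] by simp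
  qed
qed

text \<open>A maximal chain of subsets of \<open>nbr v\<close> that all contain \<open>a\<close> has
  \<open>r\<close> members. The corresponding covectors vanish at \<open>a\<close>, so they lie
  below \<open>sep v {a}\<close> as well, and the tope of that vertex is the missing member.\<close>

lemma flagged_flip:
  assumes v: "v \<in> T" and f: "flagged v" and a: "a \<in> nbr v"
  shows "flagged (sep v {a})"
proof -
  let ?v = "sep v {a}"
  have v': "?v \<in> T" using a by (simp add: mem_nbr)
  have "finite (nbr v - {a})" "(nbr v - {a}) \<inter> {a} = {}" using finite_nbr[OF v] by blast+
  from set_chain_exists[OF this] obtain \<C> where cs: "card \<C> = Suc (card (nbr v - {a}))"
    "\<forall>B\<in>\<C>. {a} \<subseteq> B \<and> B \<subseteq> {a} \<union> (nbr v - {a})" "\<forall>A\<in>\<C>. \<forall>B\<in>\<C>. A \<subseteq> B \<or> B \<subseteq> A"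
    by (elim exE conjE)
  have B: "a \<in> B" "B \<subseteq> nbr v" if "B \<in> \<C>" for B using cs(2) a that by blast+
  have cardC: "card \<C> = r" using cs(1) finite_nbr[OF v] a regular[OF v] by (metis card_Suc_Diff1)
  define X where "X B = (SOME X. X \<in> L \<and> act X v = v \<and> nbr v \<inter> zeros X = B)" for B
  have X: "X B \<in> L \<and> act (X B) v = v \<and> nbr v \<inter> zeros (X B) = B" if "B \<in> \<C>" for B
  proof -
    have "B \<in> faces v" by (rule flagged_faces[OF v f B(2)[OF that]])
    then have "\<exists>X. X \<in> L \<and> act X v = v \<and> nbr v \<inter> zeros X = B" by (metis facesE)
    then show ?thesis unfolding X_def by (rule someI_ex)
  qed
  have Xc: "X B \<in> covectors" if "B \<in> \<C>" for B using X[OF that] L_subset by blast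
  have az: "a \<in> zeros (X B)" if "B \<in> \<C>" for B using X[OF that] B(1)[OF that] by blast
  have below: "act (X B) ?v = ?v" if "B \<in> \<C>" for B
  proof -
    have "\<forall>e\<in>W. X B e = 0 \<or> X B e = sgnv v e"
      using act_eq_iff[OF covectors_sign[OF Xc[OF that]] v] X[OF that] by blast
    moreover have "X B a = 0" using az[OF that] by (simp add: zeros_def)
    moreover have "sgnv ?v e = sgnv v e" if "e \<noteq> a" for e using that by (simp add: sgnv_def)
    ultimately have "\<forall>e\<in>W. X B e = 0 \<or> X B e = sgnv ?v e" by metis
    then show ?thesis using act_eq_iff[OF covectors_sign[OF Xc[OF that]] v'] by blast
  qed
  have z0: "zeros (sgnv ?v) = {}" by (auto simp: zeros_def sgnv_def)
  let ?C = "insert (sgnv ?v) (X ` \<C>)"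
  have inj: "inj_on X \<C>"
  proof (rule inj_onI)
    fix A B assume AB: "A \<in> \<C>" "B \<in> \<C>" "X A = X B"
    have "A = nbr v \<inter> zeros (X A)" using X[OF AB(1)] by simp
    also have "\<dots> = B" using X[OF AB(2)] AB(3) by simp
    finally show "A = B" .
  qed
  have fin: "finite \<C>" using cs(1) card.infinite by fastforce
  have new: "sgnv ?v \<notin> X ` \<C>" using az z0 by force
  have "card ?C = Suc r" using new fin card_image[OF inj] cardC by simp
  moreover have "?C \<subseteq> L" using X sgnv_in[OF v'] by blast
  moreover have bl: "\<forall>Y\<in>?C. act Y ?v = ?v" using below act_sgnv[OF v'] by simp
  moreover have "Complete_Partial_Order.chain sv_le ?C"
  proof (rule chainI)
    fix P Q assume PQ: "P \<in> ?C" "Q \<in> ?C"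
    have PQc: "P \<in> sign_vectors W" "Q \<in> sign_vectors W"
      using PQ Xc covectors_sign sgnv_in_sign_vectors by blast+
    have "zeros P \<subseteq> zeros Q \<or> zeros Q \<subseteq> zeros P"
    proof (cases "P = sgnv ?v \<or> Q = sgnv ?v")
      case True
      then show ?thesis using z0 by blast
    next
      case False
      then obtain A B where AB: "A \<in> \<C>" "B \<in> \<C>" "P = X A" "Q = X B" using PQ by blast
      then have "A \<subseteq> B \<or> B \<subseteq> A" using cs(3) by blast
      then show ?thesis
        using zeros_subset_iff[OF Xc[OF AB(1)] _ Xc[OF AB(2)] _ v] zeros_subset_iff[OF Xc[OF AB(2)] _ Xc[OF AB(1)] _ v]
          X[OF AB(1)] X[OF AB(2)] AB(3,4) by simp
    qed
    then show "sv_le P Q \<or> sv_le Q P"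
      using sv_le_iff[OF PQc(1) _ PQc(2) _ v'] sv_le_iff[OF PQc(2) _ PQc(1) _ v'] bspec[OF bl PQ(1)] bspec[OF bl PQ(2)]
      by blast
  qed
  ultimately show ?thesis unfolding flagged_def by (intro exI[of _ ?C] conjI)
qed

lemma flagged_tope:
  assumes r: "r \<noteq> 0" and v: "v \<in> T"
  shows "flagged v"
proof -
  obtain C where C: "C \<subseteq> L" "Complete_Partial_Order.chain sv_le C" "card C - 1 = r"
    using flag by (elim exE conjE)
  \<comment> \<open>For \<open>r = 0\<close> truncated subtraction would admit the empty
    chain.\<close>
  have cC: "card C = Suc r" using C(3) r by linarith
  then have "C \<noteq> {}" by auto
  have "C \<subseteq> covectors" using C(1) L_subset by blast
  then obtain u where u: "u \<in> T" "\<forall>X\<in>C. act X u = u"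
    using covector_chain_top[OF _ C(2) \<open>C \<noteq> {}\<close>] by blast
  have "flagged u" unfolding flagged_def using C u(2) cC by (intro exI[of _ C] conjI)
  with v u(1) subset_UNIV[of "sep u v"] show ?thesis
    by (induction rule: face_induct) (auto intro: flagged_flip)
qed

text \<open>Let \<open>X\<close> be the covector whose zeros among the neighbours of
  \<open>v\<close> are \<open>a\<close> and \<open>b\<close>; the join is the tope opposite to
  \<open>v\<close> in its face. For an upper bound \<open>t\<close>, composing \<open>X\<close> with
  the antipode of \<open>t\<close> gives a vertex that differs from \<open>v\<close> exactly on
  \<open>zeros X - sep v t\<close>. A first step to it would flip \<open>a\<close> or
  \<open>b\<close>, which lie in \<open>sep v t\<close>, so the vertex is \<open>v\<close>
  itself.\<close>

lemma local_joins: has_local_joins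
  unfolding has_local_joins_def
proof (intro ballI impI)
  fix v a b assume v: "v \<in> T" and ab: "a \<in> nbr v" "b \<in> nbr v" "a \<noteq> b"
  have "r \<noteq> 0" using regular[OF v] ab(1) finite_nbr[OF v] by (metis card_0_eq empty_iff)
  then have "{a, b} \<in> faces v" using flagged_faces[OF v flagged_tope[OF _ v]] ab by simp
  then obtain X where X: "X \<in> covectors" "act X v = v" "nbr v \<inter> zeros X = {a, b}" by (rule facesE)
  let ?w = "act X (sep v W)"
  have w: "?w \<in> T" "sep v ?w = zeros X"
    using act_in[OF X(1) antipode[OF v]] sep_act_antipode[OF covectors_sign[OF X(1)] X(2) v v] by simp_all
  have "zeros X \<subseteq> sep v t" if t: "t \<in> T" "a \<in> sep v t" "b \<in> sep v t" for t
  proof (rule ccontr)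
    let ?s = "act X (sep t W)"
    have s: "?s \<in> T" "sep v ?s = zeros X - sep v t"
      using act_in[OF X(1) antipode[OF t(1)]] sep_act_antipode[OF covectors_sign[OF X(1)] X(2) v t(1)] by simp_all
    assume "\<not> zeros X \<subseteq> sep v t"
    then have "sep v ?s \<noteq> {}" unfolding s(2) by blast
    then have "v \<noteq> ?s" by (metis sep_self)
    then obtain k where "k \<in> zeros X - sep v t" "k \<in> nbr v" using step_nbr[OF v s(1)] s(2) by metis
    then have "k \<in> {a, b}" "k \<notin> sep v t" using X(3) by blast+
    then show False using t(2,3) by (metis empty_iff insert_iff)
  qed
  moreover have "a \<in> zeros X" "b \<in> zeros X" using X(3) by blast+
  ultimately show "\<exists>w\<in>T. a \<in> sep v w \<and> b \<in> sep v w \<and> (\<forall>t\<in>T. a \<in> sep v t \<and> b \<in> sep v t \<longrightarrow> sep v w \<subseteq> sep v t)"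
    using w by (intro bexI[of _ ?w]) (simp_all del: mem_sep)
qed

end

section \<open>From oriented matroids and partial cubes to families of sets\<close>

locale simplicial_om =
  fixes F :: "'e set" and L :: "('e \<Rightarrow> int) set"
  assumes simplicial: "simplicial_oriented_matroid F L"
    and topes_nonempty: "topes L \<noteq> {}"
    and connected: "S \<in> topes L \<Longrightarrow> R \<in> topes L \<Longrightarrow> (S, R) \<in> (tope_edges F L)\<^sup>*"
begin

lemma om: "oriented_matroid F L"
  using simplicial by (simp add: simplicial_oriented_matroid_def)

lemma finite_F: "finite F" and signs: "X \<in> L \<Longrightarrow> X \<in> sign_vectors F" and zero_in: "(\<lambda>_. 0) \<in> L"
  and elim: "strong_elimination F L" and face_sym: "face_symmetry L" and simple: "simple_system F L"
  using om by (auto simp: oriented_matroid_def)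

lemma uminus_in: "X \<in> L \<Longrightarrow> - X \<in> L"
proof -
  assume "X \<in> L"
  then have "sv_comp (\<lambda>_. 0) (- X) \<in> L" using face_sym zero_in by (simp add: face_symmetry_def)
  then show ?thesis by (simp add: sv_comp_def fun_Compl_def)
qed

lemma comp_in: "X \<in> L \<Longrightarrow> Y \<in> L \<Longrightarrow> sv_comp X Y \<in> L"
proof -
  assume "X \<in> L" "Y \<in> L"
  then have "sv_comp X (- (- Y)) \<in> L" using face_sym uminus_in[of Y] by (simp add: face_symmetry_def)
  moreover have "- (- Y) = Y" by (simp add: fun_Compl_def)
  ultimately show ?thesis by simp
qed

lemma outside: "X \<in> L \<Longrightarrow> e \<notin> F \<Longrightarrow> X e = 0"
  using signs by (simp add: sign_vectors_def)

lemma tope_in: "S \<in> topes L \<Longrightarrow> S \<in> L"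
  by (simp add: topes_def)

lemma tope_nonzero:
  assumes S: "S \<in> topes L" and e: "e \<in> F"
  shows "S e \<noteq> 0"
proof
  assume Se: "S e = 0"
  have "1 \<in> (\<lambda>X. X e) ` L" using simple e unfolding simple_system_def by blast
  then obtain X where X: "X \<in> L" "X e = 1" by (metis imageE)
  have "sv_le S (sv_comp S X)" by (simp add: sv_le_def sv_comp_def)
  then have "sv_comp S X = S" using S comp_in[OF tope_in[OF S] X(1)] by (simp add: topes_def)
  then have "sv_comp S X e = S e" by simp
  then show False using Se X(2) by (simp add: sv_comp_def)
qed

lemma topeI:
  assumes "X \<in> L" "\<And>e. e \<in> F \<Longrightarrow> X e \<noteq> 0"
  shows "X \<in> topes L"
proof -
  have "Y = X" if Y: "Y \<in> L" "sv_le X Y" for Y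
  proof
    fix e show "Y e = X e"
      using Y assms outside[of X e] outside[of Y e] unfolding sv_le_def by metis
  qed
  then show ?thesis using assms(1) by (simp add: topes_def)
qed

lemma comp_tope: "X \<in> L \<Longrightarrow> S \<in> topes L \<Longrightarrow> sv_comp X S \<in> topes L"
  using comp_in tope_in tope_nonzero by (intro topeI) (auto simp: sv_comp_def)

lemma uminus_tope: "S \<in> topes L \<Longrightarrow> - S \<in> topes L"
  using uminus_in tope_in tope_nonzero by (intro topeI) auto

lemma tope_values: "S \<in> topes L \<Longrightarrow> e \<in> F \<Longrightarrow> S e = 1 \<or> S e = -1"
  using tope_nonzero[of S e] signs[OF tope_in, of S] by (auto simp: sign_vectors_def)

text \<open>A path in the tope graph from a tope to its negative has an edge at which the sign at
  \<open>e\<close> changes, and an edge changes only one coordinate.\<close>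

lemma edge_at:
  assumes e: "e \<in> F"
  shows "\<exists>P\<in>topes L. \<exists>Q\<in>topes L. {f \<in> F. P f \<noteq> Q f} = {e}"
proof -
  obtain S where S: "S \<in> topes L" using topes_nonempty by blast
  have ex: "\<exists>P Q. (P, Q) \<in> tope_edges F L \<and> P e \<noteq> Q e" if "(S, R) \<in> (tope_edges F L)\<^sup>*" "S e \<noteq> R e" for R
    using that
  proof (induction rule: rtrancl_induct)
    case (step P Q)
    then show ?case by (cases "S e = P e") (metis, metis)
  qed simp
  have "S e \<noteq> (- S) e" using tope_nonzero[OF S e] by simp
  then obtain P Q where PQ: "(P, Q) \<in> tope_edges F L" "P e \<noteq> Q e"
    using ex connected[OF S uminus_tope[OF S]] by blast
  then have PQT: "P \<in> topes L" "Q \<in> topes L" and "card {f \<in> F. P f \<noteq> Q f} = 1" by (auto simp: tope_edges_def)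
  then obtain g where "{f \<in> F. P f \<noteq> Q f} = {g}" by (auto simp: card_1_singleton_iff)
  moreover have "e \<in> {f \<in> F. P f \<noteq> Q f}" using PQ e by simp
  ultimately have "{f \<in> F. P f \<noteq> Q f} = {e}" by auto
  then show ?thesis using PQT by blast
qed

text \<open>If \<open>R\<close> is closest to \<open>S\<close> among the topes other than \<open>S\<close> that lie between \<open>S\<close> and a given tope,
  and \<open>Z\<close> eliminates \<open>e\<close> from \<open>S\<close> and \<open>R\<close>, then the two topes obtained by composing \<open>Z\<close> with the ends
  of an edge at \<open>e\<close> differ in \<open>e\<close> only, and one of them is \<open>S\<close>.\<close>

lemma tope_step:
  assumes S: "S \<in> topes L" and R: "R \<in> topes L" and SR: "S \<noteq> R"
  shows "\<exists>e\<in>F. S e \<noteq> R e \<and> S(e := - S e) \<in> topes L"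
proof -
  let ?D = "\<lambda>Q. {f \<in> F. S f \<noteq> Q f}"
  obtain Q where Q: "Q \<in> topes L \<and> Q \<noteq> S \<and> ?D Q \<subseteq> ?D R"
    and Q_min: "\<And>P. P \<in> topes L \<and> P \<noteq> S \<and> ?D P \<subseteq> ?D R \<Longrightarrow> card (?D Q) \<le> card (?D P)"
    using ex_has_least_nat[of "\<lambda>Q. Q \<in> topes L \<and> Q \<noteq> S \<and> ?D Q \<subseteq> ?D R" R "\<lambda>Q. card (?D Q)"] R SR by blast
  obtain e where "S e \<noteq> Q e" using Q by (metis ext)
  then have e: "e \<in> F" "S e \<noteq> Q e" using outside tope_in S Q by metis+
  have "S e * Q e = -1" using tope_values[OF S e(1)] tope_values[of Q e] Q e by auto
  then obtain Z where Z: "Z \<in> L" "Z e = 0" "\<forall>f\<in>F. S f * Q f \<noteq> -1 \<longrightarrow> Z f = sv_comp S Q f"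
    using elim tope_in[OF S] tope_in[of Q] Q e(1) unfolding strong_elimination_def by blast
  have Zf: "Z f = S f" if "f \<in> F" "S f = Q f" for f
  proof -
    have "S f * Q f \<noteq> -1" using tope_values[OF S that(1)] that(2) by auto
    then have "Z f = sv_comp S Q f" using Z(3) that(1) by blast
    then show ?thesis using tope_nonzero[OF S that(1)] by (simp add: sv_comp_def)
  qed
  obtain P P' where P: "P \<in> topes L" "P' \<in> topes L" "{f \<in> F. P f \<noteq> P' f} = {e}" using edge_at[OF e(1)] by blast
  have "\<exists>A\<in>topes L. \<exists>B\<in>topes L. {f \<in> F. A f \<noteq> B f} = {e} \<and> A e = S e"
  proof (cases "P e = S e")
    case False
    have "P e \<noteq> P' e" using P(3) by blast
    then have "P' e = S e" using False tope_values[OF _ e(1)] P(1,2) S by metis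
    moreover have "{f \<in> F. P' f \<noteq> P f} = {e}" unfolding P(3)[symmetric] by auto
    ultimately show ?thesis using P(1,2) by blast
  qed (use P in blast)
  then obtain A B where AB: "A \<in> topes L" "B \<in> topes L" "{f \<in> F. A f \<noteq> B f} = {e}" "A e = S e" by blast
  let ?A = "sv_comp Z A" and ?B = "sv_comp Z B"
  have ABt: "?A \<in> topes L" "?B \<in> topes L" using comp_tope Z(1) AB(1,2) by blast+
  have "?A f = S f" if "f \<in> F" "f \<notin> ?D Q" for f
    using Zf[of f] tope_nonzero[OF S that(1)] that by (simp add: sv_comp_def)
  moreover have "?A e = S e" using Z(2) AB(4) by (simp add: sv_comp_def)
  ultimately have "?D ?A \<subseteq> ?D Q - {e}" by auto
  moreover have "e \<in> ?D Q" using e by simp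
  ultimately have "?D ?A \<subset> ?D Q" by blast
  then have "card (?D ?A) < card (?D Q)" using finite_F by (intro psubset_card_mono) auto
  \<comment> \<open>The tope is strictly closer to \<open>S\<close> than \<open>Q\<close> is and
    still lies between \<open>S\<close> and \<open>R\<close>, so the choice of \<open>Q\<close>
    leaves only \<open>S\<close>.\<close>
  then have "?A = S" using Q_min[of ?A] ABt(1) Q \<open>?D ?A \<subset> ?D Q\<close> by fastforce
  have "?B = S(e := - S e)"
  proof
    fix f show "?B f = (S(e := - S e)) f"
    proof (cases "f = e")
      case True
      have "e \<in> {f \<in> F. A f \<noteq> B f}" unfolding AB(3) by simp
      then have "B e \<noteq> A e" by simp
      then have "B e = - S e" using tope_values[OF AB(2) e(1)] tope_values[OF S e(1)] AB(4) by auto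
      then show ?thesis using True Z(2) by (simp add: sv_comp_def)
    next
      case False
      have "A f = B f"
      proof (rule ccontr)
        assume "A f \<noteq> B f"
        moreover from this have "f \<in> F"
          using outside[OF tope_in[OF AB(1)]] outside[OF tope_in[OF AB(2)]] by metis
        ultimately have "f \<in> {f \<in> F. A f \<noteq> B f}" by simp
        then show False unfolding AB(3) using False by simp
      qed
      then have "?B f = ?A f" by (simp add: sv_comp_def)
      then show ?thesis using \<open>?A = S\<close> False by simp
    qed
  qed
  moreover have "S e \<noteq> R e" using e Q by blast
  ultimately show ?thesis using ABt(2) e(1) by (intro bexI[of _ e]) simp_all
qed

section \<open>Encoding topes by their positive elements\<close>

definition pos :: "('e \<Rightarrow> int) \<Rightarrow> 'e set" where
  "pos X = {e \<in> F. X e = 1}"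

lemma pos_differ:
  assumes "S \<in> topes L" "R \<in> topes L"
  shows "sep (pos S) (pos R) = {e \<in> F. S e \<noteq> R e}"
proof (rule Set.set_eqI)
  fix e
  show "e \<in> sep (pos S) (pos R) \<longleftrightarrow> e \<in> {e \<in> F. S e \<noteq> R e}"
    using tope_values[OF assms(1), of e] tope_values[OF assms(2), of e] by (auto simp: pos_def)
qed

lemma pos_flip:
  assumes S: "S \<in> topes L" and e: "e \<in> F"
  shows "pos (S(e := - S e)) = sep (pos S) {e}"
proof (rule Set.set_eqI)
  fix f
  show "f \<in> pos (S(e := - S e)) \<longleftrightarrow> f \<in> sep (pos S) {e}"
    using tope_values[OF S e] e by (cases "f = e") (auto simp: pos_def)
qed

lemma pos_uminus:
  assumes S: "S \<in> topes L"
  shows "pos (- S) = sep (pos S) F"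
proof (rule Set.set_eqI)
  fix f
  show "f \<in> pos (- S) \<longleftrightarrow> f \<in> sep (pos S) F"
    using tope_values[OF S, of f] by (auto simp: pos_def)
qed

lemma antipodal_family_pos: "antipodal_family (pos ` topes L) F"
proof
  fix u v assume u: "u \<in> pos ` topes L" and v: "v \<in> pos ` topes L" and "u \<noteq> v"
  then obtain S R where SR: "S \<in> topes L" "R \<in> topes L" "u = pos S" "v = pos R" by blast
  then have "S \<noteq> R" using \<open>u \<noteq> v\<close> by blast
  then obtain e where e: "e \<in> F" "S e \<noteq> R e" "S(e := - S e) \<in> topes L" using tope_step[OF SR(1,2)] by blast
  have "e \<in> sep u v" using pos_differ[OF SR(1,2)] e SR(3,4) by simp
  moreover have "sep u {e} \<in> pos ` topes L" using pos_flip[OF SR(1) e(1)] e(3) SR(3) by (metis imageI)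
  ultimately show "\<exists>a\<in>sep u v. sep u {a} \<in> pos ` topes L" by blast
next
  show "finite F" by (rule finite_F)
  show "pos ` topes L \<noteq> {}" using topes_nonempty by simp
  fix v assume "v \<in> pos ` topes L"
  then obtain S where S: "S \<in> topes L" "v = pos S" by blast
  show "v \<subseteq> F" using S by (auto simp: pos_def)
  then show "finite v" using finite_F finite_subset by blast
  show "sep v F \<in> pos ` topes L" using pos_uminus[OF S(1)] uminus_tope[OF S(1)] S(2) by (metis imageI)
qed

sublocale pos: antipodal_family "pos ` topes L" F
  by (rule antipodal_family_pos)

lemma sgnv_pos:
  assumes S: "S \<in> topes L"
  shows "pos.sgnv (pos S) = S"
proof
  fix e show "pos.sgnv (pos S) e = S e"
    using tope_values[OF S, of e] outside[OF tope_in[OF S], of e] by (auto simp: pos.sgnv_def pos_def)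
qed

lemma topes_eq: "topes L = pos.sgnv ` pos ` topes L"
  using sgnv_pos by (simp add: image_image)

lemma L_subset_covectors: "L \<subseteq> pos.covectors"
proof
  fix X assume X: "X \<in> L"
  have "pos.act X (pos S) = pos (sv_comp X S)" for S
    by (auto simp: pos.act_def pos_def sv_comp_def)
  then show "X \<in> pos.covectors"
    using signs[OF X] comp_tope[OF X] by (auto simp: pos.covectors_def)
qed

sublocale pos: om_family "pos ` topes L" F L "om_rank L"
proof
  show "L \<subseteq> pos.covectors" by (rule L_subset_covectors)
  show "strong_elimination F L" "face_symmetry L" by (rule elim face_sym)+
  show "pos.sgnv t \<in> L" if "t \<in> pos ` topes L" for t using that sgnv_pos tope_in by auto
  show "card (pos.nbr v) = om_rank L" if "v \<in> pos ` topes L" for v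
  proof -
    have "pos.sgnv v \<in> topes L" using that topes_eq by blast
    then have "degree (tope_edges F L) (pos.sgnv v) = om_rank L"
      using simplicial by (simp add: simplicial_oriented_matroid_def simplicial_tope_def)
    then show ?thesis using pos.degree_tope_edges[OF topes_eq that] by simp
  qed
  have "finite L" using finite_subset[OF _ finite_sign_vectors[OF finite_F]] signs by blast
  then show "\<exists>C\<subseteq>L. Complete_Partial_Order.chain sv_le C \<and> card C - 1 = om_rank L"
    by (rule om_rank_attained(1))
qed

end

section \<open>Invariance under graph isomorphism\<close>

locale graph_iso =
  fixes V :: "'a set" and E and V' :: "'b set" and E' and f
  assumes bij: "bij_betw f V V'" and edge: "u \<in> V \<Longrightarrow> v \<in> V \<Longrightarrow> (u, v) \<in> E \<longleftrightarrow> (f u, f v) \<in> E'"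
    and E_sub: "E \<subseteq> V \<times> V" and E'_sub: "E' \<subseteq> V' \<times> V'"
begin

lemma inj: "u \<in> V \<Longrightarrow> v \<in> V \<Longrightarrow> f u = f v \<longleftrightarrow> u = v"
  using bij by (auto simp: bij_betw_def inj_on_def)

lemma image: "f ` V = V'"
  using bij by (simp add: bij_betw_def)

lemma f_in: "u \<in> V \<Longrightarrow> f u \<in> V'"
  using image by blast

lemma surj: "u' \<in> V' \<Longrightarrow> \<exists>u\<in>V. f u = u'"
  using image by blast

lemma inverse: "graph_iso V' E' V E (inv_into V f)"
proof
  show "bij_betw (inv_into V f) V' V" using bij by (rule bij_betw_inv_into)
  fix u v assume "u \<in> V'" "v \<in> V'"
  then show "(u, v) \<in> E' \<longleftrightarrow> (inv_into V f u, inv_into V f v) \<in> E"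
    using edge[of "inv_into V f u" "inv_into V f v"] by (simp add: image[symmetric] inv_into_into f_inv_into_f)
qed (rule E'_sub E_sub)+

lemma relpow: "u \<in> V \<Longrightarrow> v \<in> V \<Longrightarrow> (u, v) \<in> E ^^ n \<longleftrightarrow> (f u, f v) \<in> E' ^^ n"
proof (induction n arbitrary: v)
  case 0
  then show ?case by (simp add: inj)
next
  case (Suc n)
  show ?case
  proof
    assume "(u, v) \<in> E ^^ Suc n"
    then obtain w where w: "(u, w) \<in> E ^^ n" "(w, v) \<in> E" by auto
    then have "w \<in> V" using E_sub by blast
    then show "(f u, f v) \<in> E' ^^ Suc n" using w Suc edge by auto
  next
    assume "(f u, f v) \<in> E' ^^ Suc n"
    then obtain w' where w': "(f u, w') \<in> E' ^^ n" "(w', f v) \<in> E'" by auto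
    then obtain w where "w \<in> V" "f w = w'" using E'_sub surj by blast
    then show "(u, v) \<in> E ^^ Suc n" using w' Suc edge by auto
  qed
qed

lemma gdist: "u \<in> V \<Longrightarrow> v \<in> V \<Longrightarrow> gdist E' (f u) (f v) = gdist E u v"
  by (simp add: gdist_def relpow)

lemma interval: "u \<in> V \<Longrightarrow> v \<in> V \<Longrightarrow> geod_interval V' E' (f u) (f v) = f ` geod_interval V E u v"
  by (auto simp: geod_interval_def gdist image[symmetric])

lemma interval_iff:
  "u \<in> V \<Longrightarrow> v \<in> V \<Longrightarrow> x \<in> V \<Longrightarrow> f x \<in> geod_interval V' E' (f u) (f v) \<longleftrightarrow> x \<in> geod_interval V E u v"
  by (simp add: geod_interval_def gdist f_in)

lemma antipodal: "antipodal V E \<Longrightarrow> antipodal V' E'"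
  unfolding antipodal_def
proof
  fix v' assume anti: "\<forall>v\<in>V. \<exists>u\<in>V. V = geod_interval V E v u" and "v' \<in> V'"
  then obtain v where v: "v \<in> V" "f v = v'" using surj by blast
  then obtain u where u: "u \<in> V" "V = geod_interval V E v u" using anti by blast
  then have "V' = geod_interval V' E' v' (f u)" using interval[OF v(1) u(1)] image v(2) by simp
  then show "\<exists>u\<in>V'. V' = geod_interval V' E' v' u" using f_in[OF u(1)] by blast
qed

lemma apiculate: "apiculate V E \<Longrightarrow> apiculate V' E'"
  unfolding apiculate_def
proof
  fix u' assume api: "\<forall>u\<in>V. lower_semilattice (base_point_order V E u)" and "u' \<in> V'"
  then obtain u where u: "u \<in> V" "f u = u'" using surj by blast
  let ?B = "base_point_order V E u" and ?B' = "base_point_order V' E' u'"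
  interpret B: lower_semilattice ?B using api u by blast
  have car: "carrier ?B = V" "carrier ?B' = V'" "\<And>x y. x .=\<^bsub>?B'\<^esub> y \<longleftrightarrow> x = y" "\<And>x y. x .=\<^bsub>?B\<^esub> y \<longleftrightarrow> x = y"
    by (simp_all add: base_point_order_def)
  have le: "f x \<sqsubseteq>\<^bsub>?B'\<^esub> f y \<longleftrightarrow> x \<sqsubseteq>\<^bsub>?B\<^esub> y" if "x \<in> V" "y \<in> V" for x y
    using interval_iff[OF u(1) that(2,1)] u(2) by (simp add: base_point_order_def)
  show "lower_semilattice ?B'"
  proof unfold_locales
    show "(.=\<^bsub>?B'\<^esub>) = (=)" by (simp add: base_point_order_def)
  next
    fix x' assume "x' \<in> carrier ?B'"
    then obtain x where "x \<in> V" "f x = x'" using car surj by metis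
    then show "x' \<sqsubseteq>\<^bsub>?B'\<^esub> x'" using le B.le_refl car by metis
  next
    fix x' y' assume xy: "x' \<sqsubseteq>\<^bsub>?B'\<^esub> y'" "y' \<sqsubseteq>\<^bsub>?B'\<^esub> x'" "x' \<in> carrier ?B'" "y' \<in> carrier ?B'"
    then obtain x y where "x \<in> V" "f x = x'" "y \<in> V" "f y = y'" using car surj by metis
    then show "x' .=\<^bsub>?B'\<^esub> y'" using le B.le_antisym car xy by metis
  next
    fix x' y' z' assume xy: "x' \<sqsubseteq>\<^bsub>?B'\<^esub> y'" "y' \<sqsubseteq>\<^bsub>?B'\<^esub> z'" "x' \<in> carrier ?B'" "y' \<in> carrier ?B'" "z' \<in> carrier ?B'"
    then obtain x y z where "x \<in> V" "f x = x'" "y \<in> V" "f y = y'" "z \<in> V" "f z = z'" using car surj by metis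
    then show "x' \<sqsubseteq>\<^bsub>?B'\<^esub> z'" using le B.le_trans car xy by metis
  next
    fix x' y' assume "x' \<in> carrier ?B'" "y' \<in> carrier ?B'"
    then obtain x y where xy: "x \<in> V" "f x = x'" "y \<in> V" "f y = y'" using car surj by metis
    obtain m where m: "greatest ?B m (Lower ?B {x, y})" using B.inf_of_two_exists xy car by metis
    then have mL: "m \<in> V" "m \<sqsubseteq>\<^bsub>?B\<^esub> x" "m \<sqsubseteq>\<^bsub>?B\<^esub> y"
      using xy unfolding greatest_def Lower_def car by blast+
    have mmax: "l \<sqsubseteq>\<^bsub>?B\<^esub> m" if "l \<in> V" "l \<sqsubseteq>\<^bsub>?B\<^esub> x" "l \<sqsubseteq>\<^bsub>?B\<^esub> y" for l
      using m that xy unfolding greatest_def Lower_def car by blast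
    have "greatest ?B' (f m) (Lower ?B' {x', y'})"
      unfolding greatest_def
    proof (intro conjI ballI)
      show "Lower ?B' {x', y'} \<subseteq> carrier ?B'" by (auto simp: Lower_def)
      show "f m \<in> Lower ?B' {x', y'}"
        using mL le xy f_in unfolding Lower_def car by auto
      fix l' assume "l' \<in> Lower ?B' {x', y'}"
      then have l': "l' \<in> V'" "l' \<sqsubseteq>\<^bsub>?B'\<^esub> x'" "l' \<sqsubseteq>\<^bsub>?B'\<^esub> y'"
        using xy f_in unfolding Lower_def car by blast+
      then obtain l where "l \<in> V" "f l = l'" using surj by blast
      then show "l' \<sqsubseteq>\<^bsub>?B'\<^esub> f m" using l' le mmax xy mL by metis
    qed
    then show "\<exists>s. greatest ?B' s (Lower ?B' {x', y'})" by blast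
  qed (simp_all add: car(3))
qed

lemma cycle_edges_map: "cycle_edges (map f c) = (`) f ` cycle_edges c"
proof -
  have edges: "cycle_edges d = (\<lambda>i. {d ! i, d ! (Suc i mod length d)}) ` {..<length d}" for d :: "'x list"
    by (auto simp: cycle_edges_def)
  have "{map f c ! i, map f c ! (Suc i mod length c)} = f ` {c ! i, c ! (Suc i mod length c)}"
    if "i < length c" for i
  proof -
    have "Suc i mod length c < length c" using that by (intro mod_less_divisor) linarith
    then show ?thesis using that by simp
  qed
  then show ?thesis unfolding edges image_image length_map by (intro image_cong refl) simp
qed

lemma convex_cycle_map:
  assumes c: "convex_cycle V E c"
  shows "convex_cycle V' E' (map f c)"
proof -
  have cyc: "3 \<le> length c" "distinct c" "set c \<subseteq> V" "\<forall>i<length c. (c ! i, c ! (Suc i mod length c)) \<in> E"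
    using c by (simp_all add: convex_cycle_def cycle_def)
  have int: "geod_interval V E u v \<subseteq> set c" if "u \<in> set c" "v \<in> set c" for u v
    using c that by (simp add: convex_cycle_def)
  have chord: "{u, v} \<in> cycle_edges c" if "u \<in> set c" "v \<in> set c" "(u, v) \<in> E" for u v
    using c that by (simp add: convex_cycle_def)
  have "(map f c ! i, map f c ! (Suc i mod length c)) \<in> E'" if i: "i < length c" for i
  proof -
    have "Suc i mod length c < length c" using i by (intro mod_less_divisor) linarith
    then show ?thesis using cyc(3,4) i edge by (metis nth_map nth_mem subsetD)
  qed
  moreover have "distinct (map f c)"
    using cyc(2,3) inj by (simp add: distinct_map inj_on_def subset_iff)
  ultimately have "cycle V' E' (map f c)"
    using cyc(1,3) f_in by (auto simp: cycle_def)
  moreover have "geod_interval V' E' u' v' \<subseteq> set (map f c)" if uv': "u' \<in> set (map f c)" "v' \<in> set (map f c)" for u' v'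
  proof -
    obtain u v where uv: "u \<in> set c" "v \<in> set c" "u' = f u" "v' = f v" using uv' by auto
    then have "geod_interval V' E' u' v' = f ` geod_interval V E u v" using interval cyc(3) by blast
    then show ?thesis using int[OF uv(1,2)] by auto
  qed
  moreover have "{u', v'} \<in> cycle_edges (map f c)"
    if uv': "u' \<in> set (map f c)" "v' \<in> set (map f c)" "(u', v') \<in> E'" for u' v'
  proof -
    obtain u v where uv: "u \<in> set c" "v \<in> set c" "u' = f u" "v' = f v" using uv' by auto
    then have "(u, v) \<in> E" using edge cyc(3) uv'(3) by blast
    then have "f ` {u, v} \<in> (`) f ` cycle_edges c" using chord uv by blast
    then show ?thesis unfolding cycle_edges_map using uv(3,4) by simp
  qed
  ultimately show ?thesis unfolding convex_cycle_def by blast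
qed

lemma opposite_map:
  assumes "opposite c z w"
  shows "opposite (map f c) (f z) (f w)"
proof -
  obtain i where i: "even (length c)" "i < length c" "c ! i = z" "c ! ((i + length c div 2) mod length c) = w"
    using assms by (auto simp: opposite_def)
  moreover have "(i + length c div 2) mod length c < length c" using i(2) by (intro mod_less_divisor) linarith
  ultimately show ?thesis unfolding opposite_def by (intro conjI exI[of _ i]) simp_all
qed

lemma mediangle:
  assumes med: "mediangle V E"
  shows "mediangle V' E'"
  unfolding mediangle_def
proof (intro conjI ballI allI impI)
  fix u' x' y' z'
  assume "u' \<in> V'" "x' \<in> V'" "y' \<in> V'" "z' \<in> V'"
    and d': "x' \<noteq> y' \<and> gdist E' u' x' = gdist E' u' y' \<and> gdist E' u' z' = gdist E' u' x' + 1 \<and>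
      gdist E' x' z' = 1 \<and> gdist E' y' z' = 1"
  then obtain u x y z where V: "u \<in> V" "x \<in> V" "y \<in> V" "z \<in> V"
    and f: "u' = f u" "x' = f x" "y' = f y" "z' = f z" using surj by metis
  have d: "x \<noteq> y \<and> gdist E u x = gdist E u y \<and> gdist E u z = gdist E u x + 1 \<and> gdist E x z = 1 \<and> gdist E y z = 1"
    using d' V unfolding f by (auto simp: gdist)
  obtain c w where c: "convex_cycle V E c" "{z, x} \<in> cycle_edges c" "{z, y} \<in> cycle_edges c" "opposite c z w"
      "w \<in> geod_interval V E u x \<inter> geod_interval V E u y"
    using med[unfolded mediangle_def, THEN conjunct1, rule_format, OF V d] by (elim exE conjE)
  have "f ` {z, x} \<in> cycle_edges (map f c)" "f ` {z, y} \<in> cycle_edges (map f c)"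
    unfolding cycle_edges_map using c(2,3) by blast+
  moreover have "f w \<in> geod_interval V' E' (f u) (f x) \<inter> geod_interval V' E' (f u) (f y)"
    using c(5) interval V by blast
  ultimately show "\<exists>c w. convex_cycle V' E' c \<and> {z', x'} \<in> cycle_edges c \<and> {z', y'} \<in> cycle_edges c \<and>
      opposite c z' w \<and> w \<in> geod_interval V' E' u' x' \<inter> geod_interval V' E' u' y'"
    unfolding f using convex_cycle_map[OF c(1)] opposite_map[OF c(4)]
    by (intro exI[of _ "map f c"] exI[of _ "f w"]) simp
next
  fix c c' assume cc: "convex_cycle V' E' c \<and> convex_cycle V' E' c' \<and> cycle_edges c \<noteq> cycle_edges c'"
  let ?g = "inv_into V f"
  interpret inv: graph_iso V' E' V E ?g by (rule inverse)
  have sub: "set c \<subseteq> V'" "set c' \<subseteq> V'" using cc by (simp_all add: convex_cycle_def cycle_def)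
  have "inj_on ?g V'" using inv.bij by (simp add: bij_betw_def)
  then have "inj_on ((`) ?g) (Pow V')" by (rule inj_on_image_Pow)
  moreover have "cycle_edges c \<union> cycle_edges c' \<subseteq> Pow V'" using cycle_edge_subset sub by blast
  ultimately have inj: "inj_on ((`) ?g) (cycle_edges c \<union> cycle_edges c')" by (rule inj_on_subset)
  \<comment> \<open>Taking images under an injection is injective on sets of vertices, hence also on
    sets of edges.\<close>
  have "cycle_edges (map ?g c) \<noteq> cycle_edges (map ?g c')"
    unfolding inv.cycle_edges_map using cc inj by (simp add: inj_on_Un_image_eq_iff)
  then have "card (cycle_edges (map ?g c) \<inter> cycle_edges (map ?g c')) \<le> 1"
    using med inv.convex_cycle_map cc unfolding mediangle_def by blast
  moreover have "cycle_edges (map ?g c) \<inter> cycle_edges (map ?g c') = (`) ?g ` (cycle_edges c \<inter> cycle_edges c')"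
    unfolding inv.cycle_edges_map using inj by (intro inj_on_image_Int[symmetric]) auto
  moreover have "card ((`) ?g ` (cycle_edges c \<inter> cycle_edges c')) = card (cycle_edges c \<inter> cycle_edges c')"
    using inj by (intro card_image) (auto intro: inj_on_subset)
  ultimately show "card (cycle_edges c \<inter> cycle_edges c') \<le> 1" by simp
qed

end

lemma graph_iso_invariant:
  assumes "graph_isomorphic V E V' E'" "E \<subseteq> V \<times> V" "E' \<subseteq> V' \<times> V'"
  shows "antipodal V E \<longleftrightarrow> antipodal V' E'" "apiculate V E \<longleftrightarrow> apiculate V' E'" "mediangle V E \<longleftrightarrow> mediangle V' E'"
proof -
  obtain f where "graph_iso V E V' E' f"
    using assms unfolding graph_isomorphic_def graph_iso_def by blast
  then interpret iso: graph_iso V E V' E' f .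
  interpret inv: graph_iso V' E' V E "inv_into V f" by (rule iso.inverse)
  show "antipodal V E \<longleftrightarrow> antipodal V' E'" "apiculate V E \<longleftrightarrow> apiculate V' E'" "mediangle V E \<longleftrightarrow> mediangle V' E'"
    using iso.antipodal inv.antipodal iso.apiculate inv.apiculate iso.mediangle inv.mediangle by blast+
qed

lemma graph_isomorphic_trans:
  assumes "graph_isomorphic V E V' E'" "graph_isomorphic V' E' V'' E''"
  shows "graph_isomorphic V E V'' E''"
proof -
  obtain f g where f: "bij_betw f V V'" "\<forall>u\<in>V. \<forall>v\<in>V. (u, v) \<in> E \<longleftrightarrow> (f u, f v) \<in> E'"
    and g: "bij_betw g V' V''" "\<forall>u\<in>V'. \<forall>v\<in>V'. (u, v) \<in> E' \<longleftrightarrow> (g u, g v) \<in> E''"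
    using assms unfolding graph_isomorphic_def by metis
  have "bij_betw (g \<circ> f) V V''" using f(1) g(1) by (rule bij_betw_trans)
  moreover have "(u, v) \<in> E \<longleftrightarrow> ((g \<circ> f) u, (g \<circ> f) v) \<in> E''" if "u \<in> V" "v \<in> V" for u v
    using that f g bij_betwE[OF f(1)] by simp
  ultimately show ?thesis unfolding graph_isomorphic_def by blast
qed

lemma graph_isomorphic_sym:
  assumes "graph_isomorphic V E V' E'"
  shows "graph_isomorphic V' E' V E"
proof -
  obtain f where f: "bij_betw f V V'" "\<forall>u\<in>V. \<forall>v\<in>V. (u, v) \<in> E \<longleftrightarrow> (f u, f v) \<in> E'"
    using assms unfolding graph_isomorphic_def by blast
  have "(u, v) \<in> E' \<longleftrightarrow> (inv_into V f u, inv_into V f v) \<in> E" if "u \<in> V'" "v \<in> V'" for u v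
    using that f by (metis bij_betw_def f_inv_into_f inv_into_into)
  then show ?thesis
    unfolding graph_isomorphic_def using bij_betw_inv_into[OF f(1)] by blast
qed

section \<open>Antipodal partial cubes and tope graphs as families over the natural numbers\<close>

lemma connected_gdist:
  assumes "connected_graph V E" "u \<in> V" "v \<in> V"
  shows "(u, v) \<in> E ^^ gdist E u v"
proof -
  have "(u, v) \<in> E\<^sup>*" using assms by (simp add: connected_graph_def)
  then obtain n where "(u, v) \<in> E ^^ n" by (auto simp: rtrancl_power)
  then show ?thesis unfolding gdist_def by (rule LeastI)
qed

lemma gdist_le: "(u, v) \<in> E ^^ n \<Longrightarrow> gdist E u v \<le> n"
  unfolding gdist_def by (rule Least_le)

text \<open>Translation by \<open>f a\<close> moves the vertex \<open>a\<close> to the empty set. As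
  every vertex lies between \<open>a\<close> and its antipode \<open>b\<close>, only the finitely
  many coordinates separating \<open>a\<close> from \<open>b\<close> occur, and they can be renamed
  to natural numbers.\<close>

lemma antipodal_partial_cube_family:
  fixes U :: "'u set" and V :: "'a set"
  assumes pc: "partial_cube_over U V E" and anti: "antipodal V E"
  shows "\<exists>(T :: nat set set) W. antipodal_family T W \<and> graph_isomorphic V E T (cube_edges T)"
proof -
  have conn: "connected_graph V E" using pc by (simp add: partial_cube_over_def)
  then have gr: "V \<noteq> {}" "E \<subseteq> V \<times> V" "irrefl E" by (simp_all add: connected_graph_def graph_def)
  obtain f where f: "f ` V \<subseteq> Fpow U" "\<forall>u\<in>V. \<forall>v\<in>V. gdist (hypercube_edges U) (f u) (f v) = gdist E u v"
    using pc by (auto simp: partial_cube_over_def)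
  have fU: "f v \<in> Fpow U" "finite (f v)" if "v \<in> V" for v
    using f(1) that by (auto simp: Fpow_def)
  have fd: "card (sep (f u) (f v)) = gdist E u v" if "u \<in> V" "v \<in> V" for u v
    using f(2) that gdist_hypercube[OF fU(1) fU(1)] by simp
  have between: "x \<in> geod_interval V E u v \<longleftrightarrow> sep (f u) (f x) \<subseteq> sep (f u) (f v)"
    if "u \<in> V" "v \<in> V" "x \<in> V" for u v x
    using that card_sep_additive_iff[OF fU(2) fU(2) fU(2), of u x v] by (simp add: geod_interval_def fd del: mem_sep)
  obtain a where a: "a \<in> V" using gr by blast
  obtain b where b: "b \<in> V" "V = geod_interval V E a b" using anti a unfolding antipodal_def by blast
  let ?W = "sep (f a) (f b)"
  have fin: "finite ?W" using fU a b by simp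
  obtain g :: "'u \<Rightarrow> nat" where g: "inj_on g ?W" using finite_imp_inj_to_nat_seg[OF fin] by blast
  have sub: "sep (f a) (f v) \<subseteq> ?W" if "v \<in> V" for v
    using between[OF a b(1) that] b(2) that by blast
  define h where "h v = g ` sep (f a) (f v)" for v
  have sep_h: "sep (h u) (h v) = g ` sep (f u) (f v)" "sep (f u) (f v) \<subseteq> ?W" if "u \<in> V" "v \<in> V" for u v
  proof -
    show "sep (f u) (f v) \<subseteq> ?W" by (rule sep_subset_trans[OF sub[OF that(1)] sub[OF that(2)]])
    have "sep (h u) (h v) = g ` sep (sep (f a) (f u)) (sep (f a) (f v))"
      unfolding h_def by (rule sep_image[OF g sub[OF that(1)] sub[OF that(2)]])
    also have "sep (sep (f a) (f u)) (sep (f a) (f v)) = sep (f u) (f v)" by auto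
    finally show "sep (h u) (h v) = g ` sep (f u) (f v)" .
  qed
  have hd: "card (sep (h u) (h v)) = gdist E u v" if "u \<in> V" "v \<in> V" for u v
    using sep_h[OF that] card_image[OF inj_on_subset[OF g]] fd[OF that] by simp
  have fin_h: "finite (h v)" if "v \<in> V" for v
    using fU a that by (simp add: h_def)
  have h_eq: "u = v" if "u \<in> V" "v \<in> V" "h u = h v" for u v
  proof -
    have "gdist E u v = 0" using hd[OF that(1,2)] that(3) by simp
    then show ?thesis using connected_gdist[OF conn that(1,2)] by simp
  qed
  have edge: "(u, v) \<in> E \<longleftrightarrow> card (sep (h u) (h v)) = 1" if "u \<in> V" "v \<in> V" for u v
  proof
    assume uv: "(u, v) \<in> E"
    then have "u \<noteq> v" using gr(3) by (auto simp: irrefl_def)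
    then have "card (sep (h u) (h v)) \<noteq> 0" using h_eq that fin_h by auto
    moreover have "gdist E u v \<le> 1" using uv by (intro gdist_le) simp
    ultimately show "card (sep (h u) (h v)) = 1" using hd that by simp
  next
    assume "card (sep (h u) (h v)) = 1"
    then show "(u, v) \<in> E" using connected_gdist[OF conn that] hd[OF that] by simp
  qed
  let ?T = "h ` V"
  have "antipodal_family ?T (g ` ?W)"
  proof
    show "finite (g ` ?W)" using fin by simp
    show "?T \<noteq> {}" using gr by simp
  next
    fix t assume "t \<in> ?T"
    then obtain v where v: "v \<in> V" "t = h v" by blast
    show "finite t" using fin_h v by simp
    show tW: "t \<subseteq> g ` ?W" using sub[OF v(1)] v(2) unfolding h_def by blast
    \<comment> \<open>Both \<open>a\<close> and \<open>b\<close> lie between \<open>v\<close> and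
      its antipode, so this antipode differs from \<open>v\<close> in every coordinate that occurs;
      all antipodes are complements in the same set.\<close>
    obtain v' where v': "v' \<in> V" "V = geod_interval V E v v'" using anti v unfolding antipodal_def by blast
    have "sep (f v) (f a) \<subseteq> sep (f v) (f v')" "sep (f v) (f b) \<subseteq> sep (f v) (f v')"
      using between[OF v(1) v'(1)] v'(2) a b(1) by blast+
    then have "?W \<subseteq> sep (f v) (f v')" by (rule sep_subset_trans)
    then have "sep (f v) (f v') = ?W" using sep_h(2)[OF v(1) v'(1)] by blast
    then have "sep t (h v') = g ` ?W" using sep_h(1)[OF v(1) v'(1)] v(2) by simp
    then have "sep t (g ` ?W) = h v'" by (metis sep_sep(1))
    then show "sep t (g ` ?W) \<in> ?T" using v' by blast
  next
    fix s t assume "s \<in> ?T" "t \<in> ?T" "s \<noteq> t"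
    then obtain u v where uv: "u \<in> V" "v \<in> V" "s = h u" "t = h v" "u \<noteq> v" by blast
    then have "gdist E u v \<noteq> 0" using connected_gdist[OF conn uv(1,2)] by (intro notI) simp
    then obtain n where n: "gdist E u v = Suc n" by (cases "gdist E u v") auto
    then obtain w where w: "(u, w) \<in> E" "(w, v) \<in> E ^^ n"
      using connected_gdist[OF conn uv(1,2)] relpow_Suc_D2 by metis
    then have wV: "w \<in> V" using gr by blast
    have c1: "card (sep (h u) (h w)) = 1" using edge[OF uv(1) wV] w(1) by simp
    have cn: "card (sep (h w) (h v)) \<le> n" using gdist_le[OF w(2)] hd[OF wV uv(2)] by simp
    have "card (sep (h u) (h v)) = Suc n" using hd[OF uv(1,2)] n by simp
    \<comment> \<open>The first vertex \<open>w\<close> of a shortest path has additive distances,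
      which puts the coordinate flipped on its edge into \<open>sep (h u) (h v)\<close>.\<close>
    then have "card (sep (h u) (h w)) + card (sep (h w) (h v)) = card (sep (h u) (h v))"
      using c1 cn card_sep_triangle[OF fin_h[OF uv(1)] fin_h[OF wV] fin_h[OF uv(2)]] by linarith
    then have "sep (h u) (h w) \<subseteq> sep (h u) (h v)"
      using card_sep_additive_iff[OF fin_h[OF uv(1)] fin_h[OF wV] fin_h[OF uv(2)]] by blast
    moreover obtain e where e: "sep (h u) (h w) = {e}" using c1 by (auto simp: card_1_singleton_iff)
    moreover have "sep (h u) {e} = h w" using e by (metis sep_sep(1))
    ultimately show "\<exists>e\<in>sep s t. sep s {e} \<in> ?T" using uv wV by (intro bexI[of _ e]) auto
  qed
  moreover have "graph_isomorphic V E ?T (cube_edges ?T)"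
    unfolding graph_isomorphic_def
  proof (intro exI[of _ h] conjI ballI)
    show "bij_betw h V ?T" by (intro inj_on_imp_bij_betw inj_onI h_eq)
    fix u v assume "u \<in> V" "v \<in> V"
    then show "(u, v) \<in> E \<longleftrightarrow> (h u, h v) \<in> cube_edges ?T" using edge by (simp add: cube_edges_def)
  qed
  ultimately show ?thesis by blast
qed

lemma simplicial_om_family:
  assumes conn: "connected_graph V E" and om: "tope_graph_of_simplicial_om V E"
  shows "\<exists>(T :: nat set set) W. antipodal_family T W \<and> antipodal_family.has_meets T \<and> graph_isomorphic V E T (cube_edges T)"
proof -
  obtain F :: "nat set" and L where L: "simplicial_oriented_matroid F L"
    and iso: "graph_isomorphic V E (topes L) (tope_edges F L)"
    using om unfolding tope_graph_of_simplicial_om_def by blast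
  have V: "V \<noteq> {}" "E \<subseteq> V \<times> V" using conn by (simp_all add: connected_graph_def graph_def)
  obtain f where f: "bij_betw f V (topes L)" "\<forall>u\<in>V. \<forall>v\<in>V. (u, v) \<in> E \<longleftrightarrow> (f u, f v) \<in> tope_edges F L"
    using iso unfolding graph_isomorphic_def by blast
  interpret f: graph_iso V E "topes L" "tope_edges F L" f
    by unfold_locales (use f V in \<open>auto simp: tope_edges_def\<close>)
  interpret simplicial_om F L
  proof
    show "simplicial_oriented_matroid F L" by (rule L)
    show "topes L \<noteq> {}" using f.image V by blast
    fix S R assume "S \<in> topes L" "R \<in> topes L"
    then obtain u v where uv: "u \<in> V" "v \<in> V" "f u = S" "f v = R" using f.surj by metis
    then have "(S, R) \<in> tope_edges F L ^^ gdist E u v"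
      using f.relpow[OF uv(1,2)] connected_gdist[OF conn uv(1,2)] by blast
    then show "(S, R) \<in> (tope_edges F L)\<^sup>*" by (rule relpow_imp_rtrancl)
  qed
  have "graph_isomorphic V E (pos ` topes L) (cube_edges (pos ` topes L))"
    using graph_isomorphic_trans[OF iso graph_isomorphic_sym[OF pos.graph_isomorphic_topes[OF topes_eq]]] .
  then show ?thesis
    using pos.antipodal_family_axioms pos.local_joins_imp_meets[OF pos.local_joins] antipodal_family_pos by blast
qed

theorem theorem2:
  fixes V :: "'a set" and E :: "('a \<times> 'a) set" and U :: "'u set"
  assumes "partial_cube_over U V E"
  shows "(mediangle V E \<and> antipodal V E \<longleftrightarrow> apiculate V E \<and> antipodal V E) \<and>
         (apiculate V E \<and> antipodal V E \<longleftrightarrow> tope_graph_of_simplicial_om V E)"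
proof -
  have conn: "connected_graph V E" and E: "E \<subseteq> V \<times> V"
    using assms by (simp_all add: partial_cube_over_def connected_graph_def graph_def)
  have family: "(mediangle V E \<longleftrightarrow> apiculate V E) \<and> antipodal V E \<and> (apiculate V E \<longrightarrow> tope_graph_of_simplicial_om V E)"
    if T: "antipodal_family T W" and iso: "graph_isomorphic V E T (cube_edges T)" for T :: "nat set set" and W
  proof -
    interpret antipodal_family T W by (rule T)
    note inv = graph_iso_invariant[OF iso E cube_edges_subset]
    have lat: "mediangle T (cube_edges T) \<and> tope_graph_of_simplicial_om V E" if "has_meets"
    proof -
      interpret simplicial_family T W using that by unfold_locales
      have "graph_isomorphic V E (topes covectors) (tope_edges W covectors)"
        using graph_isomorphic_trans[OF iso graph_isomorphic_topes[OF topes_covectors]] .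
      then show ?thesis
        using mediangle_cube_edges simplicial_oriented_matroid_covectors
        unfolding tope_graph_of_simplicial_om_def by blast
    qed
    have "mediangle T (cube_edges T) \<Longrightarrow> has_meets"
      using mediangle_imp_local_joins local_joins_imp_meets by blast
    then show ?thesis
      using lat antipodal_cube_edges inv apiculate_iff_has_meets by blast
  qed
  \<comment> \<open>Here the family comes from the positive parts of the topes, and its antipodality
    from negating topes.\<close>
  have "apiculate V E \<and> antipodal V E" if om: "tope_graph_of_simplicial_om V E"
  proof -
    obtain T :: "nat set set" and W where T: "antipodal_family T W" "antipodal_family.has_meets T"
      and iso: "graph_isomorphic V E T (cube_edges T)"
      using simplicial_om_family[OF conn om] by blast
    then show ?thesis
      using antipodal_family.apiculate_iff_has_meets[OF T(1)] family[OF T(1) iso]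
        graph_iso_invariant(2)[OF iso E cube_edges_subset] by blast
  qed
  moreover have "(mediangle V E \<longleftrightarrow> apiculate V E) \<and> (apiculate V E \<longrightarrow> tope_graph_of_simplicial_om V E)"
    if "antipodal V E"
    using antipodal_partial_cube_family[OF assms that] family by blast
  ultimately show ?thesis by blast
qed

end
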